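(* If $\Gamma \vdash M = N : A\,!\,\Sigma/\mathcal{E}$ is derivable in $\lambda_{\mathrm{eff}}^{\mathcal{E}}$, then in every $\lambda_{\mathrm{eff}}^{\mathcal{E}}$-model $[\![M]\!]$ and $[\![N]\!]$ are defined and $[\![M]\!] = [\![N]\!]$.
   Context: Ground types $\hat A ::= b \mid \hat A_1\times\dots\times\hat A_n \mid \hat A_1+\dots+\hat A_n$ ($b$ base types); ground values $\hat V ::= x\mid\langle\hat V_1,\dots,\hat V_n\rangle\mid\pi_i\hat V\mid\iota_i\hat V$. Signatures $\Sigma$ are finite sets of entries $\mathtt{op}:\hat A\to\hat B$ with ground types (operation with argument type $\hat A$ and result type $\hat B$; this arrow denotes an operation signature). Effect theory terms $\hat M ::= \mathtt{return}\ \hat V \mid \mathtt{let}\ x\Leftarrow\mathtt{op}(\hat V)\ \mathtt{in}\ \hat M \mid \mathtt{case}\ \hat V\ \mathtt{of}\ \{\iota_i\,x_i\mapsto\hat M_i\}_{i=1}^n$. An equational axiom is a pair $\hat\Delta\vdash\hat M\sim\hat N:\hat A!\Sigma$; an effect theory is $(\Sigma,\mathcal{E})$ with $\mathcal{E}$ a set of axioms. The calculus $\lambda_{\mathrm{eff}}^{\mathcal{E}}$ extends $\lambda_{\mathrm{eff}}$ (fine-grain CBV with values, $\mathtt{return}$, $\mathtt{let}$, $\mathtt{op}(V)$, $\mathtt{handle}\ M\ \mathtt{with}\ H\ \mathtt{to}\ x.N$, handlers as finite sets of clauses $\mathtt{op}(x,k)\mapsto M_{\mathtt{op}}$) with base types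 and sum types, and computation types $A!\Sigma/\mathcal{E}$. For $\hat M$ and a handler $H$, $\hat M[H,k]$ is defined by $(\mathtt{return}\ \hat V)[H,k]=k\ \hat V$, $(\mathtt{let}\ x\Leftarrow\mathtt{op}(\hat V)\ \mathtt{in}\ \hat N)[H,k]=M_{\mathtt{op}}[\hat V/x,\lambda x.\hat N[H,k]/k']$ where $(\mathtt{op}(x,k')\mapsto M_{\mathtt{op}})\in H$, and case commuting. $\Gamma\vdash H:\Sigma\Rightarrow C\ \mathbf{respects}\ \mathcal{E}$ holds if $\Gamma\vdash H:\Sigma\Rightarrow C$ and $\Gamma,\hat\Delta,k:\hat A\to C\vdash\hat M[H,k]=\hat N[H,k]:C$ for each axiom in $\mathcal{E}$; handle-with $\mathtt{handle}\ M\ \mathtt{with}\ H\ \mathtt{to}\ x.N:C$ requires $M:A!\Sigma/\mathcal{E}$ and $H$ respecting $\mathcal{E}$. Typing and equations are defined simultaneously; equations are those of $\lambda_{\mathrm{eff}}$ (beta/eta for functions, products and sums, monad laws, and the three handler laws: handle of return gives $M[V/x]$, handle of let decomposes into nested handles, handle of $\mathtt{op}(V)$ gives $M_{\mathtt{op}}[V/x,\lambda x.M/k]$) plus the rule: if $\hat\Delta\vdash\hat M\sim\hat N\in\mathcal{E}$ and $\sigma:\Gamma\to\hat\Delta$ is a substitution then $\Gamma\vdash\hat M[\sigma]=\hat N[\sigma]:\hat A!\Sigma/\mathcal{E}$. Semantic notions (for $\mathcal{C}$ cartesian, $T$ strong with Kleisli exponentials $(Y\Rightarrow_T Z)$, evaluation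 $\mathrm{ev}$, currying $\Lambda$, and distributive Kleisli coproducts): $\mathcal{H}_\Sigma(X)=\prod_{(\mathtt{op}:\hat A_{\mathtt{op}}\to\hat B_{\mathtt{op}})\in\Sigma}(([\![\hat A_{\mathtt{op}}]\!]\times([\![\hat B_{\mathtt{op}}]\!]\Rightarrow_T X))\Rightarrow_T X)$. For $\hat M$ one defines $\langle\!\langle\hat M\rangle\!\rangle_X:\mathcal{H}_\Sigma(X)\to(([\![\hat\Delta]\!]\times([\![\hat A]\!]\Rightarrow_T X))\Rightarrow_T X)$ by: $\Lambda^{-1}\langle\!\langle\mathtt{return}\ \hat V\rangle\!\rangle=\mathrm{ev}\circ\mathrm{swap}\circ([\![\hat V]\!]\times\mathrm{id})\circ\pi_2$; $\Lambda^{-1}\langle\!\langle\mathtt{let}\ x\Leftarrow\mathtt{op}(\hat V)\ \mathtt{in}\ \hat M\rangle\!\rangle=\mathrm{ev}\circ\langle\pi_{\mathtt{op}}\circ\pi_1,\langle[\![\hat V]\!]\circ\pi_1\circ\pi_2,\Lambda(\Lambda^{-1}\langle\!\langle\hat M\rangle\!\rangle\circ w)\rangle\rangle$; case by copairing, with $w$ the canonical rearranging isomorphism. A morphism $f:Z\to\mathcal{H}_\Sigma(X)$ satisfies $\mathcal{E}$ if $\langle\!\langle\hat M\rangle\!\rangle\circ f=\langle\!\langle\hat N\rangle\!\rangle\circ f$ for every axiom. Operations $[\![\mathtt{op}]\!]:[\![\hat A_{\mathtt{op}}]\!]\to T[\![\hat B_{\mathtt{op}}]\!]$ satisfy $\mathcal{E}$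 if $[\![\hat M]\!]=[\![\hat N]\!]$ for every axiom, where $[\![\mathtt{return}\ \hat V]\!]=\eta\circ[\![\hat V]\!]$, $[\![\mathtt{let}\ x\Leftarrow\mathtt{op}(\hat V)\ \mathtt{in}\ \hat M]\!]=\mu\circ T[\![\hat M]\!]\circ\mathrm{st}\circ\langle\mathrm{id},[\![\mathtt{op}]\!]\circ[\![\hat V]\!]\rangle$, case by copairing. A $\lambda_{\mathrm{eff}}^{\mathcal{E}}$-model: a cartesian $\mathcal{C}$ with strong monads $T_{(\Sigma,\mathcal{E})}$ for each effect theory, Kleisli exponentials and joint distributive Kleisli coproducts; operations $[\![\mathtt{op}]\!]_{(\Sigma,\mathcal{E})}$ satisfying $\mathcal{E}$; and natural transformations $\mathrm{handle}_{\mathcal{T},\mathcal{T}',X}:H_{\mathcal{T}}\times\mathbf{y}(T_{\mathcal{T}}T_{\mathcal{T}'}X)\to\mathbf{y}(T_{\mathcal{T}'}X)$ in $[\mathcal{C}^{\mathrm{op}},\mathbf{Set}]$, where $\mathbf{y}$ is the Yoneda embedding and $H_{(\Sigma,\mathcal{E})}(Z)=\{f\in\mathcal{C}(Z,\mathcal{H}_\Sigma(X))\mid f \text{ satisfies }\mathcal{E}\}$, such that for $h\in H_{\mathcal{T}}(Z)$: $\mathrm{handle}(h,\eta\circ f)=f$; $\mathrm{handle}(h,\mu\circ f)=\mathrm{handle}(h,T\,\mathrm{handle}(h\circ\pi_1,\pi_2)\circ\mathrm{st}\circ\langle\mathrm{id},f\rangle)$; $\mathrm{handle}(h,a_{\mathtt{op}}\circ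 f)=\mathrm{ev}\circ\langle\pi_{\mathtt{op}}\circ h,f\rangle$, with $a_{\mathtt{op}}=T\,\mathrm{ev}\circ\mathrm{st}\circ\mathrm{swap}\circ([\![\mathtt{op}]\!]\times\mathrm{id})$. Terms are partially interpreted as for $\lambda_{\mathrm{eff}}$ except $[\![\mathtt{handle}\ M\ \mathtt{with}\ H\ \mathtt{to}\ x.N]\!]=\mathrm{handle}([\![H]\!],T[\![N]\!]\circ\mathrm{st}\circ\langle\mathrm{id},[\![M]\!]\rangle)$ if $[\![H]\!]\in H_{\mathcal{T}}([\![\Gamma]\!])$ and undefined otherwise. *)

theory Defs
  imports "HOL-Library.Finite_Map" "HOL-Library.Monad_Syntax"
begin

section \<open>Ground types, ground values and effect theories\<close>

text \<open>
  The type variable \<open>'b\<close> is the set of base types, \<open>'o\<close> the set of operation names.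
  All terms are in de Bruijn style: a context is a list of types, its head is the type of
  variable \<open>0\<close> (the most recently bound one).

  Terms are typed a la Church. Introduction forms are read against a given type, so it is the
  elimination forms that carry annotations: the product in a projection, the sum in a case, the
  domain in an application, the type of the bound variable in a let and the computation type of
  the handled computation in a handle-with. A judgement then has at most one reading,
  which is what makes the interpretation below a (partial) function of the judgement.
\<close>

datatype 'b gty = GBase 'b | GProd "'b gty list" | GSum "'b gty list"

datatype 'b gval =
    GVar nat
  | GTup "'b gval list"
  | GProj "'b gty list" nat "'b gval"
  | GInj nat "'b gval"

text \<open>\<open>GLet op V M\<close> is \<open>let x \<Leftarrow> op(V) in M\<close>; the type of \<open>x\<close> is determined by the signature.\<close>

datatype ('b, 'o) gcomp =
    GRet "'b gval"
  | GLet 'o "'b gval" "('b, 'o) gcomp"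
  | GCase "'b gty list" "'b gval" "('b, 'o) gcomp list"

type_synonym ('b, 'o) signat = "('o, 'b gty \<times> 'b gty) fmap"

text \<open>\<open>(\<Delta>, M, N, A)\<close> is the axiom \<open>\<Delta> \<turnstile> M \<sim> N : A\<close>.\<close>

type_synonym ('b, 'o) gaxiom = "'b gty list \<times> ('b, 'o) gcomp \<times> ('b, 'o) gcomp \<times> 'b gty"

inductive gvtyp :: "'b gty list \<Rightarrow> 'b gval \<Rightarrow> 'b gty \<Rightarrow> bool" where
  GVar: "i < length \<Delta> \<Longrightarrow> gvtyp \<Delta> (GVar i) (\<Delta> ! i)"
| GTup: "length Vs = length As \<Longrightarrow> (\<And>i. i < length As \<Longrightarrow> gvtyp \<Delta> (Vs ! i) (As ! i))
    \<Longrightarrow> gvtyp \<Delta> (GTup Vs) (GProd As)"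
| GProj: "gvtyp \<Delta> V (GProd As) \<Longrightarrow> i < length As \<Longrightarrow> gvtyp \<Delta> (GProj As i V) (As ! i)"
| GInj: "i < length As \<Longrightarrow> gvtyp \<Delta> V (As ! i) \<Longrightarrow> gvtyp \<Delta> (GInj i V) (GSum As)"

inductive gctyp :: "('b, 'o) signat \<Rightarrow> 'b gty list \<Rightarrow> ('b, 'o) gcomp \<Rightarrow> 'b gty \<Rightarrow> bool"
  for \<Sigma> where
  GRet: "gvtyp \<Delta> V A \<Longrightarrow> gctyp \<Sigma> \<Delta> (GRet V) A"
| GLet: "fmlookup \<Sigma> op = Some (A', B') \<Longrightarrow> gvtyp \<Delta> V A' \<Longrightarrow> gctyp \<Sigma> (B' # \<Delta>) M A
    \<Longrightarrow> gctyp \<Sigma> \<Delta> (GLet op V M) A"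
| GCase: "gvtyp \<Delta> V (GSum As) \<Longrightarrow> length Ms = length As
    \<Longrightarrow> (\<And>i. i < length As \<Longrightarrow> gctyp \<Sigma> (As ! i # \<Delta>) (Ms ! i) A)
    \<Longrightarrow> gctyp \<Sigma> \<Delta> (GCase As V Ms) A"

typedef ('b, 'o) effthy =
  "{(\<Sigma> :: ('b, 'o) signat, E :: ('b, 'o) gaxiom set).
      \<forall>(\<Delta>, M, N, A) \<in> E. gctyp \<Sigma> \<Delta> M A \<and> gctyp \<Sigma> \<Delta> N A}"
  by (rule exI[of _ "(fmempty, {})"]) auto

definition sig :: "('b, 'o) effthy \<Rightarrow> ('b, 'o) signat" where
  "sig T = fst (Rep_effthy T)"

definition axs :: "('b, 'o) effthy \<Rightarrow> ('b, 'o) gaxiom set" where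
  "axs T = snd (Rep_effthy T)"

primrec gvren :: "(nat \<Rightarrow> nat) \<Rightarrow> 'b gval \<Rightarrow> 'b gval" where
  "gvren r (GVar i) = GVar (r i)"
| "gvren r (GTup Vs) = GTup (map (gvren r) Vs)"
| "gvren r (GProj As i V) = GProj As i (gvren r V)"
| "gvren r (GInj i V) = GInj i (gvren r V)"

definition rlift :: "(nat \<Rightarrow> nat) \<Rightarrow> nat \<Rightarrow> nat" where
  "rlift r = case_nat 0 (Suc \<circ> r)"

primrec gcren :: "(nat \<Rightarrow> nat) \<Rightarrow> ('b, 'o) gcomp \<Rightarrow> ('b, 'o) gcomp" where
  "gcren r (GRet V) = GRet (gvren r V)"
| "gcren r (GLet op V M) = GLet op (gvren r V) (gcren (rlift r) M)"
| "gcren r (GCase As V Ms) = GCase As (gvren r V) (map (gcren (rlift r)) Ms)"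


section \<open>The calculus\<close>

text \<open>\<open>Eff A T\<close> is the computation type \<open>A ! \<Sigma>/\<E>\<close> for \<open>T = (\<Sigma>, \<E>)\<close>.\<close>

datatype ('b, 'o) ty =
    Base 'b
  | Prod "('b, 'o) ty list"
  | Sum "('b, 'o) ty list"
  | Fun "('b, 'o) ty" "('b, 'o) cty"
and ('b, 'o) cty = Eff "('b, 'o) ty" "('b, 'o) effthy"

text \<open>
  A clause \<open>op(x,k) \<mapsto> M\<close> of a handler binds \<open>x\<close> first and \<open>k\<close> second, so that \<open>k\<close> is variable \<open>0\<close>
  and \<open>x\<close> is variable \<open>1\<close> of \<open>M\<close>. \<open>Handle C M H N\<close> is \<open>handle M with H to x.N\<close>
  where \<open>M\<close> has type \<open>C\<close>.
\<close>

datatype ('b, 'o) val =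
    Var nat
  | Tup "('b, 'o) val list"
  | Proj "('b, 'o) ty list" nat "('b, 'o) val"
  | Inj nat "('b, 'o) val"
  | Lam "('b, 'o) comp"
and ('b, 'o) comp =
    Ret "('b, 'o) val"
  | Let "('b, 'o) ty" "('b, 'o) comp" "('b, 'o) comp"
  | App "('b, 'o) ty" "('b, 'o) val" "('b, 'o) val"
  | Op 'o "('b, 'o) val"
  | Handle "('b, 'o) cty" "('b, 'o) comp" "('o, ('b, 'o) comp) fmap" "('b, 'o) comp"
  | Case "('b, 'o) ty list" "('b, 'o) val" "('b, 'o) comp list"

type_synonym ('b, 'o) handler = "('o, ('b, 'o) comp) fmap"
type_synonym ('b, 'o) ctx = "('b, 'o) ty list"

primrec vren :: "(nat \<Rightarrow> nat) \<Rightarrow> ('b, 'o) val \<Rightarrow> ('b, 'o) val"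
  and cren :: "(nat \<Rightarrow> nat) \<Rightarrow> ('b, 'o) comp \<Rightarrow> ('b, 'o) comp" where
  "vren r (Var i) = Var (r i)"
| "vren r (Tup Vs) = Tup (map (vren r) Vs)"
| "vren r (Proj As i V) = Proj As i (vren r V)"
| "vren r (Inj i V) = Inj i (vren r V)"
| "vren r (Lam M) = Lam (cren (rlift r) M)"
| "cren r (Ret V) = Ret (vren r V)"
| "cren r (Let A M N) = Let A (cren r M) (cren (rlift r) N)"
| "cren r (App A V W) = App A (vren r V) (vren r W)"
| "cren r (Op op V) = Op op (vren r V)"
| "cren r (Handle C M H N) =
     Handle C (cren r M) (fmmap (cren (rlift (rlift r))) H) (cren (rlift r) N)"
| "cren r (Case As V Ms) = Case As (vren r V) (map (cren (rlift r)) Ms)"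

definition hren :: "(nat \<Rightarrow> nat) \<Rightarrow> ('b, 'o) handler \<Rightarrow> ('b, 'o) handler" where
  "hren r H = fmmap (cren (rlift (rlift r))) H"

definition slift :: "(nat \<Rightarrow> ('b, 'o) val) \<Rightarrow> nat \<Rightarrow> ('b, 'o) val" where
  "slift \<sigma> = case_nat (Var 0) (vren Suc \<circ> \<sigma>)"

primrec vsubst :: "(nat \<Rightarrow> ('b, 'o) val) \<Rightarrow> ('b, 'o) val \<Rightarrow> ('b, 'o) val"
  and csubst :: "(nat \<Rightarrow> ('b, 'o) val) \<Rightarrow> ('b, 'o) comp \<Rightarrow> ('b, 'o) comp" where
  "vsubst \<sigma> (Var i) = \<sigma> i"
| "vsubst \<sigma> (Tup Vs) = Tup (map (vsubst \<sigma>) Vs)"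
| "vsubst \<sigma> (Proj As i V) = Proj As i (vsubst \<sigma> V)"
| "vsubst \<sigma> (Inj i V) = Inj i (vsubst \<sigma> V)"
| "vsubst \<sigma> (Lam M) = Lam (csubst (slift \<sigma>) M)"
| "csubst \<sigma> (Ret V) = Ret (vsubst \<sigma> V)"
| "csubst \<sigma> (Let A M N) = Let A (csubst \<sigma> M) (csubst (slift \<sigma>) N)"
| "csubst \<sigma> (App A V W) = App A (vsubst \<sigma> V) (vsubst \<sigma> W)"
| "csubst \<sigma> (Op op V) = Op op (vsubst \<sigma> V)"
| "csubst \<sigma> (Handle C M H N) =
     Handle C (csubst \<sigma> M) (fmmap (csubst (slift (slift \<sigma>))) H) (csubst (slift \<sigma>) N)"
| "csubst \<sigma> (Case As V Ms) = Case As (vsubst \<sigma> V) (map (csubst (slift \<sigma>)) Ms)"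

text \<open>\<open>sub1 V\<close> is \<open>[V/x]\<close>; \<open>sub2 V K\<close> is \<open>[V/x, K/k]\<close> for the two variables of a handler clause.\<close>

definition sub1 :: "('b, 'o) val \<Rightarrow> nat \<Rightarrow> ('b, 'o) val" where
  "sub1 V = case_nat V Var"

definition sub2 :: "('b, 'o) val \<Rightarrow> ('b, 'o) val \<Rightarrow> nat \<Rightarrow> ('b, 'o) val" where
  "sub2 V K = case_nat K (case_nat V Var)"

primrec emb :: "'b gty \<Rightarrow> ('b, 'o) ty" where
  "emb (GBase b) = Base b"
| "emb (GProd As) = Prod (map emb As)"
| "emb (GSum As) = Sum (map emb As)"

primrec embv :: "'b gval \<Rightarrow> ('b, 'o) val" where
  "embv (GVar i) = Var i"
| "embv (GTup Vs) = Tup (map embv Vs)"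
| "embv (GProj As i V) = Proj (map emb As) i (embv V)"
| "embv (GInj i V) = Inj i (embv V)"

primrec embc :: "('b, 'o) signat \<Rightarrow> ('b, 'o) gcomp \<Rightarrow> ('b, 'o) comp" where
  "embc \<Sigma> (GRet V) = Ret (embv V)"
| "embc \<Sigma> (GLet op V M) = Let (emb (snd (the (fmlookup \<Sigma> op)))) (Op op (embv V)) (embc \<Sigma> M)"
| "embc \<Sigma> (GCase As V Ms) = Case (map emb As) (embv V) (map (embc \<Sigma>) Ms)"

text \<open>
  \<open>plug A H k M\<close> is \<open>M[H,k]\<close> for \<open>M\<close> of result type \<open>A\<close>. Here \<open>M\<close>, \<open>H\<close> and the value \<open>k\<close> live in one
  and the same context.
\<close>

primrec plug :: "'b gty \<Rightarrow> ('b, 'o) handler \<Rightarrow> ('b, 'o) val \<Rightarrow> ('b, 'o) gcomp \<Rightarrow> ('b, 'o) comp" where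
  "plug A H k (GRet V) = App (emb A) k (embv V)"
| "plug A H k (GLet op V M) =
     csubst (sub2 (embv V) (Lam (plug A (hren Suc H) (vren Suc k) M))) (the (fmlookup H op))"
| "plug A H k (GCase As V Ms) =
     Case (map emb As) (embv V) (map (plug A (hren Suc H) (vren Suc k)) Ms)"

text \<open>
  \<open>hresp \<Gamma> H T C\<close> is \<open>\<Gamma> \<turnstile> H : \<Sigma> \<Rightarrow> C respects \<E>\<close> for \<open>T = (\<Sigma>, \<E>)\<close>. The context
  \<open>\<Gamma>, \<Delta>, k : A \<rightarrow> C\<close> has \<open>k\<close> as variable \<open>0\<close>, so \<open>M\<close> and \<open>N\<close> are weakened by \<open>1\<close> and
  \<open>H\<close> by \<open>length \<Delta> + 1\<close>.
\<close>

inductive vtyp :: "('b, 'o) ctx \<Rightarrow> ('b, 'o) val \<Rightarrow> ('b, 'o) ty \<Rightarrow> bool"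
  and ctyp :: "('b, 'o) ctx \<Rightarrow> ('b, 'o) comp \<Rightarrow> ('b, 'o) cty \<Rightarrow> bool"
  and htyp :: "('b, 'o) ctx \<Rightarrow> ('b, 'o) handler \<Rightarrow> ('b, 'o) signat \<Rightarrow> ('b, 'o) cty \<Rightarrow> bool"
  and hresp :: "('b, 'o) ctx \<Rightarrow> ('b, 'o) handler \<Rightarrow> ('b, 'o) effthy \<Rightarrow> ('b, 'o) cty \<Rightarrow> bool"
  and veq :: "('b, 'o) ctx \<Rightarrow> ('b, 'o) val \<Rightarrow> ('b, 'o) val \<Rightarrow> ('b, 'o) ty \<Rightarrow> bool"
  and ceq :: "('b, 'o) ctx \<Rightarrow> ('b, 'o) comp \<Rightarrow> ('b, 'o) comp \<Rightarrow> ('b, 'o) cty \<Rightarrow> bool"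
where
  t_var: "i < length \<Gamma> \<Longrightarrow> vtyp \<Gamma> (Var i) (\<Gamma> ! i)"
| t_tup: "length Vs = length As \<Longrightarrow> (\<And>i. i < length As \<Longrightarrow> vtyp \<Gamma> (Vs ! i) (As ! i))
    \<Longrightarrow> vtyp \<Gamma> (Tup Vs) (Prod As)"
| t_proj: "vtyp \<Gamma> V (Prod As) \<Longrightarrow> i < length As \<Longrightarrow> vtyp \<Gamma> (Proj As i V) (As ! i)"
| t_inj: "i < length As \<Longrightarrow> vtyp \<Gamma> V (As ! i) \<Longrightarrow> vtyp \<Gamma> (Inj i V) (Sum As)"
| t_lam: "ctyp (A # \<Gamma>) M C \<Longrightarrow> vtyp \<Gamma> (Lam M) (Fun A C)"
| t_ret: "vtyp \<Gamma> V A \<Longrightarrow> ctyp \<Gamma> (Ret V) (Eff A T)"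
| t_let: "ctyp \<Gamma> M (Eff A T) \<Longrightarrow> ctyp (A # \<Gamma>) N (Eff B T) \<Longrightarrow> ctyp \<Gamma> (Let A M N) (Eff B T)"
| t_app: "vtyp \<Gamma> V (Fun A C) \<Longrightarrow> vtyp \<Gamma> W A \<Longrightarrow> ctyp \<Gamma> (App A V W) C"
| t_op: "fmlookup (sig T) op = Some (A, B) \<Longrightarrow> vtyp \<Gamma> V (emb A)
    \<Longrightarrow> ctyp \<Gamma> (Op op V) (Eff (emb B) T)"
| t_handle: "ctyp \<Gamma> M (Eff A T) \<Longrightarrow> hresp \<Gamma> H T C \<Longrightarrow> ctyp (A # \<Gamma>) N C
    \<Longrightarrow> ctyp \<Gamma> (Handle (Eff A T) M H N) C"
| t_case: "vtyp \<Gamma> V (Sum As) \<Longrightarrow> length Ms = length As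
    \<Longrightarrow> (\<And>i. i < length As \<Longrightarrow> ctyp (As ! i # \<Gamma>) (Ms ! i) C)
    \<Longrightarrow> ctyp \<Gamma> (Case As V Ms) C"
| t_handler: "fmdom H = fmdom \<Sigma>
    \<Longrightarrow> (\<And>op A B M. fmlookup \<Sigma> op = Some (A, B) \<Longrightarrow> fmlookup H op = Some M
          \<Longrightarrow> ctyp (Fun (emb B) C # emb A # \<Gamma>) M C)
    \<Longrightarrow> htyp \<Gamma> H \<Sigma> C"
| t_respects: "htyp \<Gamma> H (sig T) C
    \<Longrightarrow> (\<And>\<Delta> M N A. (\<Delta>, M, N, A) \<in> axs T
          \<Longrightarrow> ceq (Fun (emb A) C # map emb \<Delta> @ \<Gamma>)
                (plug A (hren ((+) (Suc (length \<Delta>))) H) (Var 0) (gcren Suc M))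
                (plug A (hren ((+) (Suc (length \<Delta>))) H) (Var 0) (gcren Suc N)) C)
    \<Longrightarrow> hresp \<Gamma> H T C"
| v_refl: "vtyp \<Gamma> V A \<Longrightarrow> veq \<Gamma> V V A"
| v_sym: "veq \<Gamma> V W A \<Longrightarrow> veq \<Gamma> W V A"
| v_trans: "veq \<Gamma> U V A \<Longrightarrow> veq \<Gamma> V W A \<Longrightarrow> veq \<Gamma> U W A"
| c_refl: "ctyp \<Gamma> M C \<Longrightarrow> ceq \<Gamma> M M C"
| c_sym: "ceq \<Gamma> M N C \<Longrightarrow> ceq \<Gamma> N M C"
| c_trans: "ceq \<Gamma> L M C \<Longrightarrow> ceq \<Gamma> M N C \<Longrightarrow> ceq \<Gamma> L N C"
| cong_tup: "length Vs = length As \<Longrightarrow> length Ws = length As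
    \<Longrightarrow> (\<And>i. i < length As \<Longrightarrow> veq \<Gamma> (Vs ! i) (Ws ! i) (As ! i))
    \<Longrightarrow> veq \<Gamma> (Tup Vs) (Tup Ws) (Prod As)"
| cong_proj: "veq \<Gamma> V W (Prod As) \<Longrightarrow> i < length As
    \<Longrightarrow> veq \<Gamma> (Proj As i V) (Proj As i W) (As ! i)"
| cong_inj: "i < length As \<Longrightarrow> veq \<Gamma> V W (As ! i) \<Longrightarrow> veq \<Gamma> (Inj i V) (Inj i W) (Sum As)"
| cong_lam: "ceq (A # \<Gamma>) M N C \<Longrightarrow> veq \<Gamma> (Lam M) (Lam N) (Fun A C)"
| cong_ret: "veq \<Gamma> V W A \<Longrightarrow> ceq \<Gamma> (Ret V) (Ret W) (Eff A T)"
| cong_let: "ceq \<Gamma> M M' (Eff A T) \<Longrightarrow> ceq (A # \<Gamma>) N N' (Eff B T)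
    \<Longrightarrow> ceq \<Gamma> (Let A M N) (Let A M' N') (Eff B T)"
| cong_app: "veq \<Gamma> V V' (Fun A C) \<Longrightarrow> veq \<Gamma> W W' A \<Longrightarrow> ceq \<Gamma> (App A V W) (App A V' W') C"
| cong_op: "fmlookup (sig T) op = Some (A, B) \<Longrightarrow> veq \<Gamma> V W (emb A)
    \<Longrightarrow> ceq \<Gamma> (Op op V) (Op op W) (Eff (emb B) T)"
| cong_handle: "ceq \<Gamma> M M' (Eff A T) \<Longrightarrow> hresp \<Gamma> H T C \<Longrightarrow> fmdom H' = fmdom H
    \<Longrightarrow> (\<And>op A' B' L L'. fmlookup (sig T) op = Some (A', B') \<Longrightarrow> fmlookup H op = Some L
          \<Longrightarrow> fmlookup H' op = Some L' \<Longrightarrow> ceq (Fun (emb B') C # emb A' # \<Gamma>) L L' C)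
    \<Longrightarrow> ceq (A # \<Gamma>) N N' C
    \<Longrightarrow> ceq \<Gamma> (Handle (Eff A T) M H N) (Handle (Eff A T) M' H' N') C"
| cong_case: "veq \<Gamma> V V' (Sum As) \<Longrightarrow> length Ms = length As \<Longrightarrow> length Ms' = length As
    \<Longrightarrow> (\<And>i. i < length As \<Longrightarrow> ceq (As ! i # \<Gamma>) (Ms ! i) (Ms' ! i) C)
    \<Longrightarrow> ceq \<Gamma> (Case As V Ms) (Case As V' Ms') C"
| fun_beta: "ctyp (A # \<Gamma>) M C \<Longrightarrow> vtyp \<Gamma> V A \<Longrightarrow> ceq \<Gamma> (App A (Lam M) V) (csubst (sub1 V) M) C"
| fun_eta: "vtyp \<Gamma> V (Fun A C) \<Longrightarrow> veq \<Gamma> (Lam (App A (vren Suc V) (Var 0))) V (Fun A C)"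
| prod_beta: "length Vs = length As \<Longrightarrow> (\<And>j. j < length As \<Longrightarrow> vtyp \<Gamma> (Vs ! j) (As ! j))
    \<Longrightarrow> i < length As \<Longrightarrow> veq \<Gamma> (Proj As i (Tup Vs)) (Vs ! i) (As ! i)"
| prod_eta: "vtyp \<Gamma> V (Prod As)
    \<Longrightarrow> veq \<Gamma> (Tup (map (\<lambda>i. Proj As i V) [0..<length As])) V (Prod As)"
| sum_beta: "i < length As \<Longrightarrow> vtyp \<Gamma> V (As ! i) \<Longrightarrow> length Ms = length As
    \<Longrightarrow> (\<And>j. j < length As \<Longrightarrow> ctyp (As ! j # \<Gamma>) (Ms ! j) C)
    \<Longrightarrow> ceq \<Gamma> (Case As (Inj i V) Ms) (csubst (sub1 V) (Ms ! i)) C"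
| sum_eta: "vtyp \<Gamma> V (Sum As) \<Longrightarrow> ctyp (Sum As # \<Gamma>) M C
    \<Longrightarrow> ceq \<Gamma> (csubst (sub1 V) M)
          (Case As V (map (\<lambda>i. csubst (case_nat (Inj i (Var 0)) (Var \<circ> Suc)) M) [0..<length As])) C"
| let_ret: "vtyp \<Gamma> V A \<Longrightarrow> ctyp (A # \<Gamma>) M (Eff B T)
    \<Longrightarrow> ceq \<Gamma> (Let A (Ret V) M) (csubst (sub1 V) M) (Eff B T)"
| let_eta: "ctyp \<Gamma> M (Eff A T) \<Longrightarrow> ceq \<Gamma> (Let A M (Ret (Var 0))) M (Eff A T)"
| let_assoc: "ctyp \<Gamma> L (Eff A T) \<Longrightarrow> ctyp (A # \<Gamma>) M (Eff B T) \<Longrightarrow> ctyp (B # \<Gamma>) N (Eff D T)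
    \<Longrightarrow> ceq \<Gamma> (Let B (Let A L M) N) (Let A L (Let B M (cren (rlift Suc) N))) (Eff D T)"
| handle_ret: "vtyp \<Gamma> V A \<Longrightarrow> hresp \<Gamma> H T C \<Longrightarrow> ctyp (A # \<Gamma>) N C
    \<Longrightarrow> ceq \<Gamma> (Handle (Eff A T) (Ret V) H N) (csubst (sub1 V) N) C"
| handle_let: "ctyp \<Gamma> L (Eff A T) \<Longrightarrow> ctyp (A # \<Gamma>) M (Eff B T) \<Longrightarrow> hresp \<Gamma> H T C
    \<Longrightarrow> ctyp (B # \<Gamma>) N C
    \<Longrightarrow> ceq \<Gamma> (Handle (Eff B T) (Let A L M) H N)
          (Handle (Eff A T) L H (Handle (Eff B T) M (hren Suc H) (cren (rlift Suc) N))) C"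
| handle_op: "fmlookup (sig T) op = Some (A, B) \<Longrightarrow> vtyp \<Gamma> V (emb A) \<Longrightarrow> hresp \<Gamma> H T C
    \<Longrightarrow> ctyp (emb B # \<Gamma>) N C \<Longrightarrow> fmlookup H op = Some M
    \<Longrightarrow> ceq \<Gamma> (Handle (Eff (emb B) T) (Op op V) H N) (csubst (sub2 V (Lam N)) M) C"
| axiom_inst: "(\<Delta>, M, N, A) \<in> axs T
    \<Longrightarrow> (\<And>i. i < length \<Delta> \<Longrightarrow> vtyp \<Gamma> (\<sigma> i) (emb (\<Delta> ! i)))
    \<Longrightarrow> ceq \<Gamma> (csubst \<sigma> (embc (sig T) M)) (csubst \<sigma> (embc (sig T) N)) (Eff (emb A) T)"


section \<open>Cartesian categories, strong monads, Kleisli exponentials and coproducts\<close>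

text \<open>
  Every element of \<open>'ob\<close> is an object; \<open>hom X Y\<close> is a set of elements of \<open>'m\<close>. Hom-sets need not be
  disjoint. Operations are indexed by objects whenever these cannot be recovered from the
  arguments (distinct pairs of objects may well have equal products).
\<close>

record ('ob, 'm) cartesian =
  hom :: "'ob \<Rightarrow> 'ob \<Rightarrow> 'm set"
  ide :: "'ob \<Rightarrow> 'm"
  cmp :: "'m \<Rightarrow> 'm \<Rightarrow> 'm"  (infixr "\<cdot>\<index>" 70)
  terminal :: "'ob"
  bang :: "'ob \<Rightarrow> 'm"
  prd :: "'ob \<Rightarrow> 'ob \<Rightarrow> 'ob"  (infixl "\<otimes>\<index>" 75)
  p1 :: "'ob \<Rightarrow> 'ob \<Rightarrow> 'm"
  p2 :: "'ob \<Rightarrow> 'ob \<Rightarrow> 'm"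
  pair :: "'m \<Rightarrow> 'm \<Rightarrow> 'm"  ("\<langle>_, _\<rangle>\<index>")

locale cartesian_category =
  fixes C :: "('ob, 'm, 'z) cartesian_scheme" (structure)
  assumes ide_hom: "ide C X \<in> hom C X X"
    and cmp_hom: "f \<in> hom C X Y \<Longrightarrow> g \<in> hom C Y Z \<Longrightarrow> g \<cdot> f \<in> hom C X Z"
    and ide_left: "f \<in> hom C X Y \<Longrightarrow> ide C Y \<cdot> f = f"
    and ide_right: "f \<in> hom C X Y \<Longrightarrow> f \<cdot> ide C X = f"
    and cmp_assoc: "f \<in> hom C W X \<Longrightarrow> g \<in> hom C X Y \<Longrightarrow> h \<in> hom C Y Z
      \<Longrightarrow> (h \<cdot> g) \<cdot> f = h \<cdot> (g \<cdot> f)"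
    and bang_hom: "bang C X \<in> hom C X (terminal C)"
    and bang_unique: "f \<in> hom C X (terminal C) \<Longrightarrow> f = bang C X"
    and p1_hom: "p1 C X Y \<in> hom C (X \<otimes> Y) X"
    and p2_hom: "p2 C X Y \<in> hom C (X \<otimes> Y) Y"
    and pair_hom: "f \<in> hom C Z X \<Longrightarrow> g \<in> hom C Z Y \<Longrightarrow> \<langle>f, g\<rangle> \<in> hom C Z (X \<otimes> Y)"
    and p1_pair: "f \<in> hom C Z X \<Longrightarrow> g \<in> hom C Z Y \<Longrightarrow> p1 C X Y \<cdot> \<langle>f, g\<rangle> = f"
    and p2_pair: "f \<in> hom C Z X \<Longrightarrow> g \<in> hom C Z Y \<Longrightarrow> p2 C X Y \<cdot> \<langle>f, g\<rangle> = g"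
    and pair_unique: "h \<in> hom C Z (X \<otimes> Y) \<Longrightarrow> \<langle>p1 C X Y \<cdot> h, p2 C X Y \<cdot> h\<rangle> = h"

context
  fixes C :: "('ob, 'm, 'z) cartesian_scheme" (structure)
begin

text \<open>\<open>cross X Y f g\<close> is \<open>f \<times> g\<close> for \<open>f\<close> and \<open>g\<close> with domains \<open>X\<close> and \<open>Y\<close>.\<close>

definition cross :: "'ob \<Rightarrow> 'ob \<Rightarrow> 'm \<Rightarrow> 'm \<Rightarrow> 'm" where
  "cross X Y f g = \<langle>f \<cdot> p1 C X Y, g \<cdot> p2 C X Y\<rangle>"

definition swap :: "'ob \<Rightarrow> 'ob \<Rightarrow> 'm" where
  "swap X Y = \<langle>p2 C X Y, p1 C X Y\<rangle>"

text \<open>\<open>assoc X Y Z : (X \<otimes> Y) \<otimes> Z \<rightarrow> X \<otimes> (Y \<otimes> Z)\<close>, with inverse \<open>unassoc X Y Z\<close>.\<close>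

definition assoc :: "'ob \<Rightarrow> 'ob \<Rightarrow> 'ob \<Rightarrow> 'm" where
  "assoc X Y Z =
     \<langle>p1 C X Y \<cdot> p1 C (X \<otimes> Y) Z, \<langle>p2 C X Y \<cdot> p1 C (X \<otimes> Y) Z, p2 C (X \<otimes> Y) Z\<rangle>\<rangle>"

definition unassoc :: "'ob \<Rightarrow> 'ob \<Rightarrow> 'ob \<Rightarrow> 'm" where
  "unassoc X Y Z =
     \<langle>\<langle>p1 C X (Y \<otimes> Z), p1 C Y Z \<cdot> p2 C X (Y \<otimes> Z)\<rangle>, p2 C Y Z \<cdot> p2 C X (Y \<otimes> Z)\<rangle>"

text \<open>
  Products of lists of objects. The head is the outermost factor on the right, so that the
  interpretation of a context extended by \<open>A\<close> is \<open>\<lbrakk>\<Gamma>\<rbrakk> \<otimes> \<lbrakk>A\<rbrakk>\<close>.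
\<close>

primrec lprod :: "'ob list \<Rightarrow> 'ob" where
  "lprod [] = terminal C"
| "lprod (X # Xs) = lprod Xs \<otimes> X"

primrec lproj :: "'ob list \<Rightarrow> nat \<Rightarrow> 'm" where
  "lproj [] i = undefined"
| "lproj (X # Xs) i =
     (case i of 0 \<Rightarrow> p2 C (lprod Xs) X | Suc j \<Rightarrow> lproj Xs j \<cdot> p1 C (lprod Xs) X)"

primrec ltup :: "'ob \<Rightarrow> 'm list \<Rightarrow> 'm" where
  "ltup Z [] = bang C Z"
| "ltup Z (f # fs) = \<langle>ltup Z fs, f\<rangle>"

end

record ('ob, 'm) smonad =
  TOb :: "'ob \<Rightarrow> 'ob"
  TMor :: "'m \<Rightarrow> 'm"
  unit :: "'ob \<Rightarrow> 'm"
  mult :: "'ob \<Rightarrow> 'm"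
  strn :: "'ob \<Rightarrow> 'ob \<Rightarrow> 'm"

locale strong_monad = cartesian_category C
  for C :: "('ob, 'm, 'z) cartesian_scheme" (structure) +
  fixes T :: "('ob, 'm, 'y) smonad_scheme"
  assumes TMor_hom: "f \<in> hom C X Y \<Longrightarrow> TMor T f \<in> hom C (TOb T X) (TOb T Y)"
    and TMor_ide: "TMor T (ide C X) = ide C (TOb T X)"
    and TMor_cmp: "f \<in> hom C X Y \<Longrightarrow> g \<in> hom C Y Z \<Longrightarrow> TMor T (g \<cdot> f) = TMor T g \<cdot> TMor T f"
    and unit_hom: "unit T X \<in> hom C X (TOb T X)"
    and unit_nat: "f \<in> hom C X Y \<Longrightarrow> TMor T f \<cdot> unit T X = unit T Y \<cdot> f"
    and mult_hom: "mult T X \<in> hom C (TOb T (TOb T X)) (TOb T X)"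
    and mult_nat: "f \<in> hom C X Y \<Longrightarrow> TMor T f \<cdot> mult T X = mult T Y \<cdot> TMor T (TMor T f)"
    and mult_unit: "mult T X \<cdot> unit T (TOb T X) = ide C (TOb T X)"
    and mult_TMor_unit: "mult T X \<cdot> TMor T (unit T X) = ide C (TOb T X)"
    and mult_mult: "mult T X \<cdot> mult T (TOb T X) = mult T X \<cdot> TMor T (mult T X)"
    and strn_hom: "strn T X Y \<in> hom C (X \<otimes> TOb T Y) (TOb T (X \<otimes> Y))"
    and strn_nat: "f \<in> hom C X X' \<Longrightarrow> g \<in> hom C Y Y'
      \<Longrightarrow> TMor T (cross C X Y f g) \<cdot> strn T X Y
          = strn T X' Y' \<cdot> cross C X (TOb T Y) f (TMor T g)"
    and strn_one: "TMor T (p2 C (terminal C) X) \<cdot> strn T (terminal C) X = p2 C (terminal C) (TOb T X)"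
    and strn_assoc: "TMor T (assoc C X Y Z) \<cdot> strn T (X \<otimes> Y) Z
      = strn T X (Y \<otimes> Z) \<cdot> cross C X (Y \<otimes> TOb T Z) (ide C X) (strn T Y Z) \<cdot> assoc C X Y (TOb T Z)"
    and strn_unit: "strn T X Y \<cdot> cross C X Y (ide C X) (unit T Y) = unit T (X \<otimes> Y)"
    and strn_mult: "strn T X Y \<cdot> cross C X (TOb T (TOb T Y)) (ide C X) (mult T Y)
      = mult T (X \<otimes> Y) \<cdot> TMor T (strn T X Y) \<cdot> strn T X (TOb T Y)"

text \<open>\<open>kexp Y Z\<close> is \<open>Y \<Rightarrow>\<^sub>T Z\<close>; \<open>cur X Y Z\<close> is \<open>\<Lambda>\<close> from \<open>X \<otimes> Y \<rightarrow> T Z\<close> to \<open>X \<rightarrow> (Y \<Rightarrow>\<^sub>T Z)\<close>.\<close>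

record ('ob, 'm) kmonad = "('ob, 'm) smonad" +
  kexp :: "'ob \<Rightarrow> 'ob \<Rightarrow> 'ob"
  ev :: "'ob \<Rightarrow> 'ob \<Rightarrow> 'm"
  cur :: "'ob \<Rightarrow> 'ob \<Rightarrow> 'ob \<Rightarrow> 'm \<Rightarrow> 'm"

locale kleisli_exponentials = strong_monad C T
  for C :: "('ob, 'm, 'z) cartesian_scheme" (structure)
    and T :: "('ob, 'm, 'y) kmonad_scheme" +
  assumes ev_hom: "ev T Y Z \<in> hom C (kexp T Y Z \<otimes> Y) (TOb T Z)"
    and cur_hom: "f \<in> hom C (X \<otimes> Y) (TOb T Z) \<Longrightarrow> cur T X Y Z f \<in> hom C X (kexp T Y Z)"
    and ev_cur: "f \<in> hom C (X \<otimes> Y) (TOb T Z)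
      \<Longrightarrow> ev T Y Z \<cdot> cross C X Y (cur T X Y Z f) (ide C Y) = f"
    and cur_ev: "g \<in> hom C X (kexp T Y Z)
      \<Longrightarrow> cur T X Y Z (ev T Y Z \<cdot> cross C X Y g (ide C Y)) = g"

text \<open>
  Finite Kleisli coproducts for a family of strong monads indexed by \<open>'i\<close>. They are \<^emph>\<open>joint\<close>: the
  object \<open>kcop Xs\<close> and the injections, which are morphisms of \<open>C\<close>, do not depend on the monad; and
  \<^emph>\<open>distributive\<close>: the morphisms \<open>G \<otimes> \<iota>\<^sub>i\<close> exhibit \<open>G \<otimes> kcop Xs\<close> as a coproduct of the \<open>G \<otimes> X\<^sub>i\<close> in each
  Kleisli category. \<open>copair i G Xs Z\<close> takes a family of morphisms \<open>G \<otimes> X\<^sub>j \<rightarrow> T\<^sub>i Z\<close> to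
  \<open>G \<otimes> kcop Xs \<rightarrow> T\<^sub>i Z\<close>.
\<close>

record ('i, 'ob, 'm) kcoproducts =
  kcop :: "'ob list \<Rightarrow> 'ob"
  kinj :: "'ob list \<Rightarrow> nat \<Rightarrow> 'm"
  copair :: "'i \<Rightarrow> 'ob \<Rightarrow> 'ob list \<Rightarrow> 'ob \<Rightarrow> 'm list \<Rightarrow> 'm"

locale joint_kleisli_coproducts = cartesian_category C
  for C :: "('ob, 'm, 'z) cartesian_scheme" (structure) +
  fixes Ts :: "'i \<Rightarrow> ('ob, 'm, 'y) smonad_scheme"
    and S :: "('i, 'ob, 'm, 'x) kcoproducts_scheme"
  assumes kinj_hom: "j < length Xs \<Longrightarrow> kinj S Xs j \<in> hom C (Xs ! j) (kcop S Xs)"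
    and copair_hom: "length fs = length Xs
      \<Longrightarrow> (\<And>j. j < length Xs \<Longrightarrow> fs ! j \<in> hom C (G \<otimes> (Xs ! j)) (TOb (Ts i) Z))
      \<Longrightarrow> copair S i G Xs Z fs \<in> hom C (G \<otimes> kcop S Xs) (TOb (Ts i) Z)"
    and copair_inj: "length fs = length Xs
      \<Longrightarrow> (\<And>j. j < length Xs \<Longrightarrow> fs ! j \<in> hom C (G \<otimes> (Xs ! j)) (TOb (Ts i) Z))
      \<Longrightarrow> j < length Xs
      \<Longrightarrow> copair S i G Xs Z fs \<cdot> cross C G (Xs ! j) (ide C G) (kinj S Xs j) = fs ! j"
    and copair_unique: "g \<in> hom C (G \<otimes> kcop S Xs) (TOb (Ts i) Z)
      \<Longrightarrow> copair S i G Xs Z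
            (map (\<lambda>j. g \<cdot> cross C G (Xs ! j) (ide C G) (kinj S Xs j)) [0..<length Xs]) = g"


section \<open>Models\<close>

text \<open>
  \<open>opm T op\<close> interprets \<open>op\<close> in the theory \<open>T\<close>; \<open>hdl T T' X Z h f\<close> is the component of
  \<open>handle\<^bsub>T,T',X\<^esub>\<close> at \<open>Z\<close>, applied to \<open>h \<in> H\<^sub>T(Z)\<close> and \<open>f : Z \<rightarrow> T T' X\<close>.
\<close>

record ('ob, 'm, 'b, 'o) model = "('ob, 'm) cartesian" +
  base :: "'b \<Rightarrow> 'ob"
  mon :: "('b, 'o) effthy \<Rightarrow> ('ob, 'm) kmonad"
  cops :: "(('b, 'o) effthy, 'ob, 'm) kcoproducts"
  opm :: "('b, 'o) effthy \<Rightarrow> 'o \<Rightarrow> 'm"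
  hdl :: "('b, 'o) effthy \<Rightarrow> ('b, 'o) effthy \<Rightarrow> 'ob \<Rightarrow> 'ob \<Rightarrow> 'm \<Rightarrow> 'm \<Rightarrow> 'm"

text \<open>The order of the factors of a product over \<open>\<Sigma>\<close> is immaterial, so an arbitrary one is chosen.\<close>

definition ops :: "('b, 'o) signat \<Rightarrow> 'o list" where
  "ops \<Sigma> = (SOME os. set os = fset (fmdom \<Sigma>) \<and> distinct os)"

lemma zip_size:
  assumes "(x, y) \<in> set (zip xs ys)"
  shows "size x < size_list size xs" "size y < size_list size ys"
proof -
  have *: "size z < size_list size zs" if "z \<in> set zs" for z :: "'c::size" and zs
    using that by (induction zs) auto
  show "size x < size_list size xs" "size y < size_list size ys"
    using assms by (auto intro: * dest: set_zip_leftD set_zip_rightD)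
qed

context
  fixes \<M> :: "('ob, 'm, 'b, 'o) model" (structure)
begin

fun tysem :: "('b, 'o) ty \<Rightarrow> 'ob"  ("\<lbrakk>_\<rbrakk>") where
  "\<lbrakk>Base b\<rbrakk> = base \<M> b"
| "\<lbrakk>Prod As\<rbrakk> = lprod \<M> (map tysem As)"
| "\<lbrakk>Sum As\<rbrakk> = kcop (cops \<M>) (map tysem As)"
| "\<lbrakk>Fun A (Eff B T)\<rbrakk> = kexp (mon \<M> T) \<lbrakk>A\<rbrakk> \<lbrakk>B\<rbrakk>"

abbreviation ctxsem :: "('b, 'o) ctx \<Rightarrow> 'ob"  ("\<lbrakk>_\<rbrakk>\<^sub>x") where
  "\<lbrakk>\<Gamma>\<rbrakk>\<^sub>x \<equiv> lprod \<M> (map tysem \<Gamma>)"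

abbreviation gtysem :: "'b gty \<Rightarrow> 'ob"  ("\<lbrakk>_\<rbrakk>\<^sub>g") where
  "\<lbrakk>A\<rbrakk>\<^sub>g \<equiv> \<lbrakk>emb A\<rbrakk>"

abbreviation gctxsem :: "'b gty list \<Rightarrow> 'ob"  ("\<lbrakk>_\<rbrakk>\<^sub>d") where
  "\<lbrakk>\<Delta>\<rbrakk>\<^sub>d \<equiv> lprod \<M> (map gtysem \<Delta>)"

function (sequential) gvsem :: "'b gty list \<Rightarrow> 'b gval \<Rightarrow> 'b gty \<Rightarrow> 'm" where
  "gvsem \<Delta> (GVar i) A = lproj \<M> (map gtysem \<Delta>) i"
| "gvsem \<Delta> (GTup Vs) (GProd As) = ltup \<M> \<lbrakk>\<Delta>\<rbrakk>\<^sub>d (map (\<lambda>(V, A). gvsem \<Delta> V A) (zip Vs As))"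
| "gvsem \<Delta> (GProj As i V) A = lproj \<M> (map gtysem As) i \<cdot> gvsem \<Delta> V (GProd As)"
| "gvsem \<Delta> (GInj i V) (GSum As) = kinj (cops \<M>) (map gtysem As) i \<cdot> gvsem \<Delta> V (As ! i)"
  by pat_completeness auto
termination by (relation "measure (\<lambda>(_, V, _). size V)") (auto dest: zip_size)

text \<open>\<open>gcsem T \<Delta> M A : \<lbrakk>\<Delta>\<rbrakk> \<rightarrow> T \<lbrakk>A\<rbrakk>\<close>\<close>

function (sequential) gcsem :: "('b, 'o) effthy \<Rightarrow> 'b gty list \<Rightarrow> ('b, 'o) gcomp \<Rightarrow> 'b gty \<Rightarrow> 'm" where
  "gcsem T \<Delta> (GRet V) A = unit (mon \<M> T) \<lbrakk>A\<rbrakk>\<^sub>g \<cdot> gvsem \<Delta> V A"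
| "gcsem T \<Delta> (GLet op V M) A =
     (let (A', B') = the (fmlookup (sig T) op) in
      mult (mon \<M> T) \<lbrakk>A\<rbrakk>\<^sub>g \<cdot> TMor (mon \<M> T) (gcsem T (B' # \<Delta>) M A) \<cdot> strn (mon \<M> T) \<lbrakk>\<Delta>\<rbrakk>\<^sub>d \<lbrakk>B'\<rbrakk>\<^sub>g
        \<cdot> \<langle>ide \<M> \<lbrakk>\<Delta>\<rbrakk>\<^sub>d, opm \<M> T op \<cdot> gvsem \<Delta> V A'\<rangle>)"
| "gcsem T \<Delta> (GCase As V Ms) A =
     copair (cops \<M>) T \<lbrakk>\<Delta>\<rbrakk>\<^sub>d (map gtysem As) \<lbrakk>A\<rbrakk>\<^sub>g
       (map (\<lambda>(M, A'). gcsem T (A' # \<Delta>) M A) (zip Ms As))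
       \<cdot> \<langle>ide \<M> \<lbrakk>\<Delta>\<rbrakk>\<^sub>d, gvsem \<Delta> V (GSum As)\<rangle>"
  by pat_completeness auto
termination by (relation "measure (\<lambda>(_, _, M, _). size M)") (auto dest: zip_size)

text \<open>
  The factor of \<open>\<H>\<^sub>\<Sigma>(X)\<close> at an operation, \<open>\<H>\<^sub>\<Sigma>(X)\<close> itself, and its projections. Only the monad
  of the theory \<open>T'\<close> enters here.
\<close>

definition hfac :: "('b, 'o) effthy \<Rightarrow> ('b, 'o) signat \<Rightarrow> 'ob \<Rightarrow> 'o \<Rightarrow> 'ob" where
  "hfac T' \<Sigma> X op =
     (let (A, B) = the (fmlookup \<Sigma> op) in
      kexp (mon \<M> T') (\<lbrakk>A\<rbrakk>\<^sub>g \<otimes> kexp (mon \<M> T') \<lbrakk>B\<rbrakk>\<^sub>g X) X)"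

definition hobj :: "('b, 'o) effthy \<Rightarrow> ('b, 'o) signat \<Rightarrow> 'ob \<Rightarrow> 'ob" where
  "hobj T' \<Sigma> X = lprod \<M> (map (hfac T' \<Sigma> X) (ops \<Sigma>))"

definition hproj :: "('b, 'o) effthy \<Rightarrow> ('b, 'o) signat \<Rightarrow> 'ob \<Rightarrow> 'o \<Rightarrow> 'm" where
  "hproj T' \<Sigma> X op =
     lproj \<M> (map (hfac T' \<Sigma> X) (ops \<Sigma>)) (THE i. i < length (ops \<Sigma>) \<and> ops \<Sigma> ! i = op)"

text \<open>
  The canonical isomorphism \<open>w : (P \<otimes> (D \<otimes> K)) \<otimes> B \<rightarrow> P \<otimes> ((D \<otimes> B) \<otimes> K)\<close>.
\<close>

definition rearr :: "'ob \<Rightarrow> 'ob \<Rightarrow> 'ob \<Rightarrow> 'ob \<Rightarrow> 'm" where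
  "rearr P D K B =
     (let q = p1 \<M> (P \<otimes> (D \<otimes> K)) B;
          r = p2 \<M> P (D \<otimes> K) \<cdot> q
      in \<langle>p1 \<M> P (D \<otimes> K) \<cdot> q,
           \<langle>\<langle>p1 \<M> D K \<cdot> r, p2 \<M> (P \<otimes> (D \<otimes> K)) B\<rangle>, p2 \<M> D K \<cdot> r\<rangle>\<rangle>)"

text \<open>
  \<open>hdenU T' \<Sigma> X \<Delta> M A\<close> is \<open>\<Lambda>\<^sup>-\<^sup>1\<langle>\<langle>M\<rangle>\<rangle>\<^sub>X : \<H>\<^sub>\<Sigma>(X) \<otimes> (\<lbrakk>\<Delta>\<rbrakk> \<otimes> (\<lbrakk>A\<rbrakk> \<Rightarrow> X)) \<rightarrow> T' X\<close> and \<open>hden\<close> is \<open>\<langle>\<langle>M\<rangle>\<rangle>\<^sub>X\<close>.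
\<close>

function (sequential) hdenU :: "('b, 'o) effthy \<Rightarrow> ('b, 'o) signat \<Rightarrow> 'ob \<Rightarrow> 'b gty list \<Rightarrow> ('b, 'o) gcomp \<Rightarrow> 'b gty \<Rightarrow> 'm"
where
  "hdenU T' \<Sigma> X \<Delta> (GRet V) A =
     (let K = kexp (mon \<M> T') \<lbrakk>A\<rbrakk>\<^sub>g X in
      ev (mon \<M> T') \<lbrakk>A\<rbrakk>\<^sub>g X \<cdot> swap \<M> \<lbrakk>A\<rbrakk>\<^sub>g K \<cdot> cross \<M> \<lbrakk>\<Delta>\<rbrakk>\<^sub>d K (gvsem \<Delta> V A) (ide \<M> K)
        \<cdot> p2 \<M> (hobj T' \<Sigma> X) (\<lbrakk>\<Delta>\<rbrakk>\<^sub>d \<otimes> K))"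
| "hdenU T' \<Sigma> X \<Delta> (GLet op V M) A =
     (let (A', B') = the (fmlookup \<Sigma> op);
          P = hobj T' \<Sigma> X;
          K = kexp (mon \<M> T') \<lbrakk>A\<rbrakk>\<^sub>g X;
          D = \<lbrakk>\<Delta>\<rbrakk>\<^sub>d
      in ev (mon \<M> T') (\<lbrakk>A'\<rbrakk>\<^sub>g \<otimes> kexp (mon \<M> T') \<lbrakk>B'\<rbrakk>\<^sub>g X) X
           \<cdot> \<langle>hproj T' \<Sigma> X op \<cdot> p1 \<M> P (D \<otimes> K),
               \<langle>gvsem \<Delta> V A' \<cdot> p1 \<M> D K \<cdot> p2 \<M> P (D \<otimes> K),
                cur (mon \<M> T') (P \<otimes> (D \<otimes> K)) \<lbrakk>B'\<rbrakk>\<^sub>g X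
                  (hdenU T' \<Sigma> X (B' # \<Delta>) M A \<cdot> rearr P D K \<lbrakk>B'\<rbrakk>\<^sub>g)\<rangle>\<rangle>)"
| "hdenU T' \<Sigma> X \<Delta> (GCase As V Ms) A =
     (let P = hobj T' \<Sigma> X;
          K = kexp (mon \<M> T') \<lbrakk>A\<rbrakk>\<^sub>g X;
          D = \<lbrakk>\<Delta>\<rbrakk>\<^sub>d
      in copair (cops \<M>) T' (P \<otimes> (D \<otimes> K)) (map gtysem As) X
           (map (\<lambda>(M, A'). hdenU T' \<Sigma> X (A' # \<Delta>) M A \<cdot> rearr P D K \<lbrakk>A'\<rbrakk>\<^sub>g) (zip Ms As))
           \<cdot> \<langle>ide \<M> (P \<otimes> (D \<otimes> K)),
               gvsem \<Delta> V (GSum As) \<cdot> p1 \<M> D K \<cdot> p2 \<M> P (D \<otimes> K)\<rangle>)"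
  by pat_completeness auto
termination by (relation "measure (\<lambda>(_, _, _, _, M, _). size M)") (auto dest: zip_size)

definition hden :: "('b, 'o) effthy \<Rightarrow> ('b, 'o) signat \<Rightarrow> 'ob \<Rightarrow> 'b gty list \<Rightarrow> ('b, 'o) gcomp \<Rightarrow> 'b gty \<Rightarrow> 'm"
where
  "hden T' \<Sigma> X \<Delta> M A =
     cur (mon \<M> T') (hobj T' \<Sigma> X) (\<lbrakk>\<Delta>\<rbrakk>\<^sub>d \<otimes> kexp (mon \<M> T') \<lbrakk>A\<rbrakk>\<^sub>g X) X (hdenU T' \<Sigma> X \<Delta> M A)"

text \<open>\<open>H\<^sub>T(Z)\<close>, for handlers into \<open>T' X\<close>\<close>

definition hpsh :: "('b, 'o) effthy \<Rightarrow> ('b, 'o) effthy \<Rightarrow> 'ob \<Rightarrow> 'ob \<Rightarrow> 'm set" where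
  "hpsh T T' X Z = {f \<in> hom \<M> Z (hobj T' (sig T) X).
     \<forall>(\<Delta>, M, N, A) \<in> axs T. hden T' (sig T) X \<Delta> M A \<cdot> f = hden T' (sig T) X \<Delta> N A \<cdot> f}"

text \<open>\<open>a\<^sub>o\<^sub>p : \<lbrakk>A\<rbrakk> \<otimes> (\<lbrakk>B\<rbrakk> \<Rightarrow>\<^sub>T\<^sub>' X) \<rightarrow> T T' X\<close> for \<open>op : A \<rightarrow> B\<close> in \<open>T\<close>\<close>

definition aop :: "('b, 'o) effthy \<Rightarrow> ('b, 'o) effthy \<Rightarrow> 'ob \<Rightarrow> 'o \<Rightarrow> 'm" where
  "aop T T' X op =
     (let (A, B) = the (fmlookup (sig T) op); K = kexp (mon \<M> T') \<lbrakk>B\<rbrakk>\<^sub>g X in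
      TMor (mon \<M> T) (ev (mon \<M> T') \<lbrakk>B\<rbrakk>\<^sub>g X) \<cdot> strn (mon \<M> T) K \<lbrakk>B\<rbrakk>\<^sub>g
        \<cdot> swap \<M> (TOb (mon \<M> T) \<lbrakk>B\<rbrakk>\<^sub>g) K \<cdot> cross \<M> \<lbrakk>A\<rbrakk>\<^sub>g K (opm \<M> T op) (ide \<M> K))"

end

locale eff_model =
  fixes \<M> :: "('ob, 'm, 'b, 'o) model" (structure)
  assumes mon: "kleisli_exponentials \<M> (mon \<M> T)"
    and cops: "joint_kleisli_coproducts \<M> (mon \<M>) (cops \<M>)"
    and opm_hom: "fmlookup (sig T) op = Some (A, B)
      \<Longrightarrow> opm \<M> T op \<in> hom \<M> (gtysem \<M> A) (TOb (mon \<M> T) (gtysem \<M> B))"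
    and opm_satisfy: "(\<Delta>, M, N, A) \<in> axs T \<Longrightarrow> gcsem \<M> T \<Delta> M A = gcsem \<M> T \<Delta> N A"
    and hdl_hom: "h \<in> hpsh \<M> T T' X Z \<Longrightarrow> f \<in> hom \<M> Z (TOb (mon \<M> T) (TOb (mon \<M> T') X))
      \<Longrightarrow> hdl \<M> T T' X Z h f \<in> hom \<M> Z (TOb (mon \<M> T') X)"
    and hdl_nat: "h \<in> hpsh \<M> T T' X Z \<Longrightarrow> f \<in> hom \<M> Z (TOb (mon \<M> T) (TOb (mon \<M> T') X))
      \<Longrightarrow> g \<in> hom \<M> Z' Z
      \<Longrightarrow> hdl \<M> T T' X Z' (h \<cdot> g) (f \<cdot> g) = hdl \<M> T T' X Z h f \<cdot> g"
    and hdl_unit: "h \<in> hpsh \<M> T T' X Z \<Longrightarrow> f \<in> hom \<M> Z (TOb (mon \<M> T') X)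
      \<Longrightarrow> hdl \<M> T T' X Z h (unit (mon \<M> T) (TOb (mon \<M> T') X) \<cdot> f) = f"
    and hdl_mult: "h \<in> hpsh \<M> T T' X Z
      \<Longrightarrow> f \<in> hom \<M> Z (TOb (mon \<M> T) (TOb (mon \<M> T) (TOb (mon \<M> T') X)))
      \<Longrightarrow> W = TOb (mon \<M> T) (TOb (mon \<M> T') X)
      \<Longrightarrow> hdl \<M> T T' X Z h (mult (mon \<M> T) (TOb (mon \<M> T') X) \<cdot> f)
          = hdl \<M> T T' X Z h
              (TMor (mon \<M> T) (hdl \<M> T T' X (Z \<otimes> W) (h \<cdot> p1 \<M> Z W) (p2 \<M> Z W))
                \<cdot> strn (mon \<M> T) Z W \<cdot> \<langle>ide \<M> Z, f\<rangle>)"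
    and hdl_op: "h \<in> hpsh \<M> T T' X Z \<Longrightarrow> fmlookup (sig T) op = Some (A, B)
      \<Longrightarrow> f \<in> hom \<M> Z (gtysem \<M> A \<otimes> kexp (mon \<M> T') (gtysem \<M> B) X)
      \<Longrightarrow> hdl \<M> T T' X Z h (aop \<M> T T' X op \<cdot> f)
          = ev (mon \<M> T') (gtysem \<M> A \<otimes> kexp (mon \<M> T') (gtysem \<M> B) X) X
              \<cdot> \<langle>hproj \<M> T' (sig T) X op \<cdot> h, f\<rangle>"


section \<open>Partial interpretation of terms\<close>

lemma size_fmlookup:
  assumes "fmlookup H op = Some M"
  shows "g M < size_fmap (\<lambda>_. 0) g H"
proof -
  have "(op, M) \<in> fset (fset_of_fmap H)" using assms by simp
  then have "(\<lambda>(a, b). 0 + g b) (op, M) < size_fset (\<lambda>(a, b). 0 + g b) (fset_of_fmap H)"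
    unfolding size_fset_simps
    using member_le_sum[of "(op, M)" "fset (fset_of_fmap H)" "Suc \<circ> (\<lambda>(a, b). 0 + g b)"] by simp
  then show ?thesis unfolding size_fmap_def by simp
qed

context
  fixes \<M> :: "('ob, 'm, 'b, 'o) model" (structure)
begin

text \<open>
  \<open>vsem \<Gamma> V A\<close> is \<open>\<lbrakk>\<Gamma> \<turnstile> V : A\<rbrakk> : \<lbrakk>\<Gamma>\<rbrakk> \<rightarrow> \<lbrakk>A\<rbrakk>\<close>, \<open>csem \<Gamma> M (Eff A T)\<close> is \<open>\<lbrakk>\<Gamma> \<turnstile> M : A ! T\<rbrakk> : \<lbrakk>\<Gamma>\<rbrakk> \<rightarrow> T \<lbrakk>A\<rbrakk>\<close>, and
  \<open>hsem \<Gamma> H \<Sigma> (Eff B T')\<close> is \<open>\<lbrakk>\<Gamma> \<turnstile> H : \<Sigma> \<Rightarrow> B ! T'\<rbrakk> : \<lbrakk>\<Gamma>\<rbrakk> \<rightarrow> \<H>\<^sub>\<Sigma> \<lbrakk>B\<rbrakk>\<close>; \<open>None\<close> means undefined. In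
  \<open>hsem\<close>, each clause is precomposed with
  \<open>\<lbrakk>\<Gamma>\<rbrakk> \<otimes> (\<lbrakk>A\<rbrakk> \<otimes> K) \<rightarrow> (\<lbrakk>\<Gamma>\<rbrakk> \<otimes> \<lbrakk>A\<rbrakk>) \<otimes> K\<close> and curried, where \<open>K\<close> interprets the type of the
  continuation.
\<close>

function (sequential) vsem :: "('b, 'o) ctx \<Rightarrow> ('b, 'o) val \<Rightarrow> ('b, 'o) ty \<Rightarrow> 'm option"
  and csem :: "('b, 'o) ctx \<Rightarrow> ('b, 'o) comp \<Rightarrow> ('b, 'o) cty \<Rightarrow> 'm option"
  and hsem :: "('b, 'o) ctx \<Rightarrow> ('b, 'o) handler \<Rightarrow> ('b, 'o) signat \<Rightarrow> ('b, 'o) cty \<Rightarrow> 'm option"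
where
  "vsem \<Gamma> (Var i) A =
     (if i < length \<Gamma> \<and> \<Gamma> ! i = A then Some (lproj \<M> (map (tysem \<M>) \<Gamma>) i) else None)"
| "vsem \<Gamma> (Tup Vs) (Prod As) =
     (if length Vs = length As
      then do { fs \<leftarrow> those (map (\<lambda>(V, A). vsem \<Gamma> V A) (zip Vs As));
                Some (ltup \<M> (ctxsem \<M> \<Gamma>) fs) }
      else None)"
| "vsem \<Gamma> (Proj As i V) A =
     (if i < length As \<and> As ! i = A
      then do { f \<leftarrow> vsem \<Gamma> V (Prod As); Some (lproj \<M> (map (tysem \<M>) As) i \<cdot> f) }
      else None)"
| "vsem \<Gamma> (Inj i V) (Sum As) =
     (if i < length As
      then do { f \<leftarrow> vsem \<Gamma> V (As ! i); Some (kinj (cops \<M>) (map (tysem \<M>) As) i \<cdot> f) }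
      else None)"
| "vsem \<Gamma> (Lam M) (Fun A (Eff B T)) =
     do { f \<leftarrow> csem (A # \<Gamma>) M (Eff B T);
          Some (cur (mon \<M> T) (ctxsem \<M> \<Gamma>) (tysem \<M> A) (tysem \<M> B) f) }"
| "vsem \<Gamma> V A = None"
| "csem \<Gamma> (Ret V) (Eff A T) =
     do { f \<leftarrow> vsem \<Gamma> V A; Some (unit (mon \<M> T) (tysem \<M> A) \<cdot> f) }"
| "csem \<Gamma> (Let A M N) (Eff B T) =
     do { f \<leftarrow> csem \<Gamma> M (Eff A T);
          g \<leftarrow> csem (A # \<Gamma>) N (Eff B T);
          Some (mult (mon \<M> T) (tysem \<M> B) \<cdot> TMor (mon \<M> T) g
                \<cdot> strn (mon \<M> T) (ctxsem \<M> \<Gamma>) (tysem \<M> A) \<cdot> \<langle>ide \<M> (ctxsem \<M> \<Gamma>), f\<rangle>) }"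
| "csem \<Gamma> (App A V W) (Eff B T) =
     do { f \<leftarrow> vsem \<Gamma> V (Fun A (Eff B T));
          g \<leftarrow> vsem \<Gamma> W A;
          Some (ev (mon \<M> T) (tysem \<M> A) (tysem \<M> B) \<cdot> \<langle>f, g\<rangle>) }"
| "csem \<Gamma> (Op op V) (Eff B T) =
     (case fmlookup (sig T) op of
        None \<Rightarrow> None
      | Some (A', B') \<Rightarrow>
          if emb B' = B then do { f \<leftarrow> vsem \<Gamma> V (emb A'); Some (opm \<M> T op \<cdot> f) } else None)"
| "csem \<Gamma> (Handle (Eff A T) M H N) (Eff B T') =
     do { h \<leftarrow> hsem \<Gamma> H (sig T) (Eff B T');
          f \<leftarrow> csem \<Gamma> M (Eff A T);
          g \<leftarrow> csem (A # \<Gamma>) N (Eff B T');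
          if h \<in> hpsh \<M> T T' (tysem \<M> B) (ctxsem \<M> \<Gamma>)
          then Some (hdl \<M> T T' (tysem \<M> B) (ctxsem \<M> \<Gamma>) h
                 (TMor (mon \<M> T) g \<cdot> strn (mon \<M> T) (ctxsem \<M> \<Gamma>) (tysem \<M> A)
                    \<cdot> \<langle>ide \<M> (ctxsem \<M> \<Gamma>), f\<rangle>))
          else None }"
| "csem \<Gamma> (Case As V Ms) (Eff B T) =
     (if length Ms = length As
      then do { f \<leftarrow> vsem \<Gamma> V (Sum As);
                gs \<leftarrow> those (map (\<lambda>(M, A). csem (A # \<Gamma>) M (Eff B T)) (zip Ms As));
                Some (copair (cops \<M>) T (ctxsem \<M> \<Gamma>) (map (tysem \<M>) As) (tysem \<M> B) gs
                      \<cdot> \<langle>ide \<M> (ctxsem \<M> \<Gamma>), f\<rangle>) }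
      else None)"
| "hsem \<Gamma> H \<Sigma> (Eff B T') =
     (if fmdom H = fmdom \<Sigma>
      then do { fs \<leftarrow> those (map
                  (\<lambda>op. case (fmlookup \<Sigma> op, fmlookup H op) of
                     (Some (A', B'), Some M) \<Rightarrow>
                       let K = kexp (mon \<M> T') (gtysem \<M> B') (tysem \<M> B) in
                       do { g \<leftarrow> csem (Fun (emb B') (Eff B T') # emb A' # \<Gamma>) M (Eff B T');
                            Some (cur (mon \<M> T') (ctxsem \<M> \<Gamma>) (gtysem \<M> A' \<otimes> K) (tysem \<M> B)
                                    (g \<cdot> unassoc \<M> (ctxsem \<M> \<Gamma>) (gtysem \<M> A') K)) }
                   | _ \<Rightarrow> None) (ops \<Sigma>));
                Some (ltup \<M> (ctxsem \<M> \<Gamma>) fs) }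
      else None)"
  by pat_completeness auto

termination
  by (relation "measure (case_sum (\<lambda>(_, V, _). size V)
      (case_sum (\<lambda>(_, M, _). size M) (\<lambda>(_, H, _, _). size_fmap (\<lambda>_. 0) size H)))")
    (auto dest: zip_size dest!: size_fmlookup[OF sym, where g = size])

end

end

theory Submission
  imports Defs
begin

text \<open>
  The interpretation is compositional: substituting in a term is composing its denotation with
  the denotation of the substitution. For a handle-with, whose denotation is only defined when the
  handler satisfies the axioms, this works because \<open>H\<^sub>T\<close> is a presheaf and \<open>handle\<close> is natural. Soundness
  is then shown by simultaneous induction on typing and equations. The crucial case is that of a handler
  \<open>H\<close> which respects the axioms: the denotation of \<open>M[H,k]\<close> is \<open>\<langle>\<langle>M\<rangle>\<rangle>\<close> precomposed with the denotations
  of \<open>H\<close>, of the context of \<open>M\<close> and of \<open>k\<close>, so that the equations \<open>M[H,k] = N[H,k]\<close>, sound by induction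
  hypothesis, say exactly that \<open>\<lbrakk>H\<rbrakk>\<close> satisfies the axioms.
\<close>

section \<open>Typed arrows\<close>

text \<open>Substitution is proved from the definedness of a denotation, by induction on terms, and
  so stays outside the mutual induction in which typing of handlers depends on equations. An
  equation, in turn, must yield that both of its sides are defined: in the congruence rule for
  handling, for instance, only one of the two handlers is assumed to respect the axioms. A second
  obstacle is the shape of contexts. The equation of \<open>M[H,k]\<close> and \<open>N[H,k]\<close>
  lives over a single list of types, interpreted as one iterated product, while satisfaction
  compares arrows from the denotation of \<Gamma> into an exponential over \<Delta> and the
  continuation. The two are related by an arrow given through its projections, and denotations of
  substitutions are described by their components for the same reason. Finally, \<open>Let\<close>
  and \<open>Handle\<close> both start from the composite of \<open>TMor\<close> of the body, the
  strength and a pairing with the identity. Isolating it as \<open>tmap\<close> lets one set of laws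
  serve the monad equations and the handler equations.\<close>

text \<open>
  Hom-sets may overlap, so a composite does not determine the object in its middle. Arrows that
  carry their source and target make the side conditions of all categorical laws decidable by rewriting.
\<close>

datatype ('ob, 'm) arrow = Arrow (src: 'ob) (mor: 'm) (tgt: 'ob)

context cartesian_category
begin

definition arr :: "('ob, 'm) arrow \<Rightarrow> bool" where
  "arr a \<longleftrightarrow> mor a \<in> hom C (src a) (tgt a)"

definition acomp :: "('ob, 'm) arrow \<Rightarrow> ('ob, 'm) arrow \<Rightarrow> ('ob, 'm) arrow"  (infixr "\<odot>" 70) where
  "b \<odot> a = Arrow (src a) (mor b \<cdot> mor a) (tgt b)"

definition aide :: "'ob \<Rightarrow> ('ob, 'm) arrow" where
  "aide X = Arrow X (ide C X) X"

definition afst :: "'ob \<Rightarrow> 'ob \<Rightarrow> ('ob, 'm) arrow" where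
  "afst X Y = Arrow (X \<otimes> Y) (p1 C X Y) X"

definition asnd :: "'ob \<Rightarrow> 'ob \<Rightarrow> ('ob, 'm) arrow" where
  "asnd X Y = Arrow (X \<otimes> Y) (p2 C X Y) Y"

definition apair :: "('ob, 'm) arrow \<Rightarrow> ('ob, 'm) arrow \<Rightarrow> ('ob, 'm) arrow" where
  "apair a b = Arrow (src a) \<langle>mor a, mor b\<rangle> (tgt a \<otimes> tgt b)"

lemmas arrow_defs = acomp_def aide_def afst_def asnd_def apair_def

text \<open>The endpoints are computed even for composites that do not fit. The simplifier can thus
  decide the side conditions of the other laws by evaluating sources and targets.\<close>

lemma src_tgt [simp]:
  "src (b \<odot> a) = src a" "tgt (b \<odot> a) = tgt b"
  "src (aide X) = X" "tgt (aide X) = X"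
  "src (afst X Y) = X \<otimes> Y" "tgt (afst X Y) = X"
  "src (asnd X Y) = X \<otimes> Y" "tgt (asnd X Y) = Y"
  "src (apair a b) = src a" "tgt (apair a b) = tgt a \<otimes> tgt b"
  by (simp_all add: arrow_defs)

lemma arr_simps [simp]:
  "arr (Arrow X f Y) \<longleftrightarrow> f \<in> hom C X Y"
  "arr a \<Longrightarrow> arr b \<Longrightarrow> tgt a = src b \<Longrightarrow> arr (b \<odot> a)"
  "arr (aide X)" "arr (afst X Y)" "arr (asnd X Y)"
  "arr a \<Longrightarrow> arr b \<Longrightarrow> src a = src b \<Longrightarrow> arr (apair a b)"
  by (auto simp: arr_def arrow_defs intro: cmp_hom ide_hom p1_hom p2_hom pair_hom)

lemma acomp_assoc [simp]:
  "arr a \<Longrightarrow> arr b \<Longrightarrow> arr c \<Longrightarrow> tgt a = src b \<Longrightarrow> tgt b = src c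
    \<Longrightarrow> (c \<odot> b) \<odot> a = c \<odot> (b \<odot> a)"
  by (simp add: arr_def arrow_defs cmp_assoc)

lemma acomp_aide [simp]:
  "arr a \<Longrightarrow> tgt a = X \<Longrightarrow> aide X \<odot> a = a"
  "arr a \<Longrightarrow> src a = X \<Longrightarrow> a \<odot> aide X = a"
  by (cases a; auto simp: arr_def arrow_defs intro: ide_left ide_right)+

lemma afst_asnd_apair [simp]:
  assumes "arr a" "arr b" "src a = src b" "tgt a = X" "tgt b = Y"
  shows "afst X Y \<odot> apair a b = a" "asnd X Y \<odot> apair a b = b"
  using assms by (cases a; cases b; auto simp: arr_def arrow_defs intro: p1_pair p2_pair)+

lemma apair_afst_asnd [simp]:
  "arr a \<Longrightarrow> tgt a = X \<otimes> Y \<Longrightarrow> apair (afst X Y \<odot> a) (asnd X Y \<odot> a) = a"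
  by (cases a) (auto simp: arr_def arrow_defs intro: pair_unique)

lemma apair_afst_asnd_aide [simp]: "apair (afst X Y) (asnd X Y) = aide (X \<otimes> Y)"
  using apair_afst_asnd[of "aide (X \<otimes> Y)"] by simp

text \<open>Both sides have the same projections. Together with right-nested composition, this rule
  normalises composites built from projections and pairings.\<close>

lemma apair_acomp [simp]:
  assumes "arr a" "arr b" "src a = src b" "arr c" "tgt c = src a"
  shows "apair a b \<odot> c = apair (a \<odot> c) (b \<odot> c)"
proof -
  have "apair a b \<odot> c =
    apair (afst (tgt a) (tgt b) \<odot> (apair a b \<odot> c)) (asnd (tgt a) (tgt b) \<odot> (apair a b \<odot> c))"
    using assms by (subst apair_afst_asnd) auto
  also have "\<dots> = apair (a \<odot> c) (b \<odot> c)"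
    using assms by (simp flip: acomp_assoc del: acomp_assoc)
  finally show ?thesis .
qed

lemma pair_cmp:
  assumes "f \<in> hom C Z X" "g \<in> hom C Z Y" "h \<in> hom C W Z"
  shows "\<langle>f, g\<rangle> \<cdot> h = \<langle>f \<cdot> h, g \<cdot> h\<rangle>"
  using apair_acomp[of "Arrow Z f X" "Arrow Z g Y" "Arrow W h Z"] assms by (simp add: arrow_defs)

section \<open>Finite products of lists of objects\<close>

lemma lproj_hom: "i < length Xs \<Longrightarrow> lproj C Xs i \<in> hom C (lprod C Xs) (Xs ! i)"
proof (induction Xs arbitrary: i)
  case (Cons X Xs)
  then show ?case by (cases i) (simp_all add: p2_hom cmp_hom[OF p1_hom])
qed simp

lemma ltup_hom:
  "length fs = length Xs \<Longrightarrow> (\<And>i. i < length Xs \<Longrightarrow> fs ! i \<in> hom C Z (Xs ! i))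
    \<Longrightarrow> ltup C Z fs \<in> hom C Z (lprod C Xs)"
proof (induction fs Xs rule: list_induct2')
  case (4 f fs X Xs)
  have "fs ! i \<in> hom C Z (Xs ! i)" if "i < length Xs" for i using 4(3)[of "Suc i"] that by simp
  moreover have "f \<in> hom C Z X" using 4(3)[of 0] by simp
  ultimately show ?case using 4(1,2) by (simp add: pair_hom)
qed (simp_all add: bang_hom)

lemma lproj_ltup:
  "length fs = length Xs \<Longrightarrow> (\<And>i. i < length Xs \<Longrightarrow> fs ! i \<in> hom C Z (Xs ! i))
    \<Longrightarrow> i < length Xs \<Longrightarrow> lproj C Xs i \<cdot> ltup C Z fs = fs ! i"
proof (induction fs Xs arbitrary: i rule: list_induct2')
  case (4 f fs X Xs)
  have fs: "fs ! i \<in> hom C Z (Xs ! i)" if "i < length Xs" for i using 4(3)[of "Suc i"] that by simp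
  have f: "f \<in> hom C Z X" using 4(3)[of 0] by simp
  have tup: "ltup C Z fs \<in> hom C Z (lprod C Xs)" using 4(2) fs by (intro ltup_hom) auto
  show ?case
  proof (cases i)
    case (Suc j)
    then have j: "j < length Xs" using 4(4) by simp
    have "(lproj C Xs j \<cdot> p1 C (lprod C Xs) X) \<cdot> \<langle>ltup C Z fs, f\<rangle> = lproj C Xs j \<cdot> ltup C Z fs"
      using cmp_assoc[OF pair_hom[OF tup f] p1_hom lproj_hom[OF j]] p1_pair[OF tup f] by simp
    then show ?thesis using 4(1)[of j] 4(2) fs j Suc by simp
  qed (simp add: p2_pair[OF tup f])
qed simp_all

text \<open>The projections are jointly monic: the outermost factor is split off, and over the empty
  list arrows into the terminal object are unique.\<close>

lemma lprod_ext:
  "f \<in> hom C Z (lprod C Xs) \<Longrightarrow> g \<in> hom C Z (lprod C Xs)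
    \<Longrightarrow> (\<And>i. i < length Xs \<Longrightarrow> lproj C Xs i \<cdot> f = lproj C Xs i \<cdot> g) \<Longrightarrow> f = g"
proof (induction Xs arbitrary: f g)
  case Nil
  then show ?case by (metis bang_unique lprod.simps(1))
next
  case (Cons X Xs)
  let ?p = "p1 C (lprod C Xs) X" and ?q = "p2 C (lprod C Xs) X"
  have hom: "f \<in> hom C Z (lprod C Xs \<otimes> X)" "g \<in> hom C Z (lprod C Xs \<otimes> X)"
    using Cons.prems(1,2) by simp_all
  have "?p \<cdot> f = ?p \<cdot> g"
  proof (rule Cons(1))
    fix i assume i: "i < length Xs"
    show "lproj C Xs i \<cdot> ?p \<cdot> f = lproj C Xs i \<cdot> ?p \<cdot> g"
      unfolding cmp_assoc[OF hom(1) p1_hom lproj_hom[OF i], symmetric]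
        cmp_assoc[OF hom(2) p1_hom lproj_hom[OF i], symmetric]
      using Cons.prems(3)[of "Suc i"] i by simp
  qed (use hom in \<open>simp_all add: cmp_hom[OF _ p1_hom]\<close>)
  moreover have "?q \<cdot> f = ?q \<cdot> g" using Cons.prems(3)[of 0] by simp
  ultimately show ?case using pair_unique[OF hom(1)] pair_unique[OF hom(2)] by metis
qed

lemma ltup_cmp:
  assumes "s \<in> hom C W Z" "\<And>f. f \<in> set fs \<Longrightarrow> \<exists>X. f \<in> hom C Z X"
  shows "ltup C Z fs \<cdot> s = ltup C W (map (\<lambda>f. f \<cdot> s) fs)"
  using assms(2)
proof (induction fs)
  case Nil
  then show ?case using bang_unique[OF cmp_hom[OF assms(1) bang_hom]] by simp
next
  case (Cons f fs)
  \<comment> \<open>Each component is only known to have some codomain. A choice of codomains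
    supplies the list of factors whose product is the target of the tuple.\<close>
  obtain F where F: "\<And>f. f \<in> set fs \<Longrightarrow> f \<in> hom C Z (F f)" using Cons(2) by (metis list.set_intros(2))
  have "ltup C Z fs \<in> hom C Z (lprod C (map F fs))" by (rule ltup_hom) (auto intro: F)
  moreover obtain X where "f \<in> hom C Z X" using Cons(2) by auto
  moreover have "ltup C Z fs \<cdot> s = ltup C W (map (\<lambda>f. f \<cdot> s) fs)" using Cons by simp
  ultimately show ?case using assms(1) by (simp add: pair_cmp)
qed

end

section \<open>Strong monads, Kleisli exponentials and coproducts\<close>

context strong_monad
begin

definition aT :: "('ob, 'm) arrow \<Rightarrow> ('ob, 'm) arrow" where
  "aT a = Arrow (TOb T (src a)) (TMor T (mor a)) (TOb T (tgt a))"

definition aunit :: "'ob \<Rightarrow> ('ob, 'm) arrow" where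
  "aunit X = Arrow X (unit T X) (TOb T X)"

definition amult :: "'ob \<Rightarrow> ('ob, 'm) arrow" where
  "amult X = Arrow (TOb T (TOb T X)) (mult T X) (TOb T X)"

definition astrn :: "'ob \<Rightarrow> 'ob \<Rightarrow> ('ob, 'm) arrow" where
  "astrn X Y = Arrow (X \<otimes> TOb T Y) (strn T X Y) (TOb T (X \<otimes> Y))"

lemmas marrow_defs = arrow_defs aT_def aunit_def amult_def astrn_def

lemma monad_src_tgt [simp]:
  "src (aT a) = TOb T (src a)" "tgt (aT a) = TOb T (tgt a)"
  "src (aunit X) = X" "tgt (aunit X) = TOb T X"
  "src (amult X) = TOb T (TOb T X)" "tgt (amult X) = TOb T X"
  "src (astrn X Y) = X \<otimes> TOb T Y" "tgt (astrn X Y) = TOb T (X \<otimes> Y)"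
  by (simp_all add: marrow_defs)

lemma monad_arr [simp]:
  "arr a \<Longrightarrow> arr (aT a)" "arr (aunit X)" "arr (amult X)" "arr (astrn X Y)"
  by (auto simp: arr_def marrow_defs intro: TMor_hom unit_hom mult_hom strn_hom)

lemma aT_acomp: "arr a \<Longrightarrow> arr b \<Longrightarrow> tgt a = src b \<Longrightarrow> aT (b \<odot> a) = aT b \<odot> aT a"
  by (simp add: arr_def marrow_defs TMor_cmp)

lemma aT_aide [simp]: "aT (aide X) = aide (TOb T X)"
  by (simp add: marrow_defs TMor_ide)

lemma astrn_nat:
  "arr a \<Longrightarrow> arr b \<Longrightarrow> X = src a \<Longrightarrow> Y = src b \<Longrightarrow>
    aT (apair (a \<odot> afst X Y) (b \<odot> asnd X Y)) \<odot> astrn X Y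
    = astrn (tgt a) (tgt b) \<odot> apair (a \<odot> afst X (TOb T Y)) (aT b \<odot> asnd X (TOb T Y))"
  by (simp add: arr_def marrow_defs strn_nat[unfolded cross_def])

lemma astrn_nat_left:
  assumes "arr a" "X = src a"
  shows "aT (apair (a \<odot> afst X Y) (asnd X Y)) \<odot> astrn X Y
    = astrn (tgt a) Y \<odot> apair (a \<odot> afst X (TOb T Y)) (asnd X (TOb T Y))"
  using astrn_nat[of a "aide Y"] assms by simp

lemma astrn_nat_right:
  assumes "arr b" "Y = src b"
  shows "aT (apair (afst X Y) (b \<odot> asnd X Y)) \<odot> astrn X Y
    = astrn X (tgt b) \<odot> apair (afst X (TOb T Y)) (aT b \<odot> asnd X (TOb T Y))"
  using astrn_nat[of "aide X" b] assms by simp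

lemma aunit_nat: "arr a \<Longrightarrow> X = src a \<Longrightarrow> aT a \<odot> aunit X = aunit (tgt a) \<odot> a"
  by (cases a) (simp add: arr_def marrow_defs unit_nat)

lemma amult_nat: "arr a \<Longrightarrow> X = src a \<Longrightarrow> aT a \<odot> amult X = amult (tgt a) \<odot> aT (aT a)"
  by (cases a) (simp add: arr_def marrow_defs mult_nat)

text \<open>Rewrites the first two factors of a right-nested composite, where an equation between
  binary composites does not match literally.\<close>

lemma acomp_cong_left:
  assumes "b \<odot> a = d \<odot> c" "arr a" "arr b" "arr c" "arr d" "arr x"
    "tgt a = src b" "tgt c = src d" "tgt x = src a" "tgt x = src c"
  shows "b \<odot> (a \<odot> x) = d \<odot> (c \<odot> x)"
  using assms acomp_assoc[of x a b] acomp_assoc[of x c d] by simp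

lemma astrn_aunit: "astrn X Y \<odot> apair (afst X Y) (aunit Y \<odot> asnd X Y) = aunit (X \<otimes> Y)"
  using strn_unit[of X Y] ide_left[OF p1_hom] by (simp add: marrow_defs cross_def)

lemma astrn_amult:
  "astrn X Y \<odot> apair (afst X (TOb T (TOb T Y))) (amult Y \<odot> asnd X (TOb T (TOb T Y)))
    = amult (X \<otimes> Y) \<odot> aT (astrn X Y) \<odot> astrn X (TOb T Y)"
  using strn_mult[of X Y] ide_left[OF p1_hom] by (simp add: marrow_defs cross_def)

lemma astrn_assoc:
  "aT (apair (afst X Y \<odot> afst (X \<otimes> Y) Z) (apair (asnd X Y \<odot> afst (X \<otimes> Y) Z) (asnd (X \<otimes> Y) Z)))
      \<odot> astrn (X \<otimes> Y) Z
    = astrn X (Y \<otimes> Z) \<odot> apair (afst X (Y \<otimes> TOb T Z)) (astrn Y Z \<odot> asnd X (Y \<otimes> TOb T Z))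
      \<odot> apair (afst X Y \<odot> afst (X \<otimes> Y) (TOb T Z))
          (apair (asnd X Y \<odot> afst (X \<otimes> Y) (TOb T Z)) (asnd (X \<otimes> Y) (TOb T Z)))"
  using strn_assoc[of X Y Z] ide_left[OF p1_hom]
  by (simp add: marrow_defs cross_def assoc_def)

text \<open>The functorial action of \<open>T\<close> in context: \<open>f : G \<rightarrow> T A\<close> and \<open>g : G \<otimes> A \<rightarrow> B\<close> give \<open>G \<rightarrow> T B\<close>.\<close>

definition tmap :: "'ob \<Rightarrow> 'ob \<Rightarrow> 'm \<Rightarrow> 'm \<Rightarrow> 'm" where
  "tmap G A f g = TMor T g \<cdot> strn T G A \<cdot> \<langle>ide C G, f\<rangle>"

definition atmap :: "'ob \<Rightarrow> 'ob \<Rightarrow> ('ob, 'm) arrow \<Rightarrow> ('ob, 'm) arrow \<Rightarrow> ('ob, 'm) arrow" where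
  "atmap G A f g = aT g \<odot> astrn G A \<odot> apair (aide G) f"

lemma atmap_src_tgt [simp]: "src (atmap G A f g) = G" "tgt (atmap G A f g) = TOb T (tgt g)"
  by (simp_all add: atmap_def)

lemma arr_atmap [simp]:
  "arr f \<Longrightarrow> arr g \<Longrightarrow> src f = G \<Longrightarrow> tgt f = TOb T A \<Longrightarrow> src g = G \<otimes> A \<Longrightarrow> arr (atmap G A f g)"
  by (simp add: atmap_def)

lemma mor_atmap: "mor (atmap G A f g) = tmap G A (mor f) (mor g)"
  by (simp add: atmap_def tmap_def marrow_defs)

text \<open>Naturality of the strength in its parameter moves \<open>s\<close> from the context into
  the body, so that the pairing is again with an identity.\<close>

lemma atmap_pair:
  assumes "arr n" "arr s" "arr f" "src s = W" "src f = W" "tgt s = G" "src n = G \<otimes> A" "tgt f = TOb T A"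
  shows "aT n \<odot> astrn G A \<odot> apair s f
    = atmap W A f (n \<odot> apair (s \<odot> afst W A) (asnd W A))"
proof -
  have "aT (apair (s \<odot> afst W A) (asnd W A)) \<odot> astrn W A \<odot> apair (aide W) f
    = astrn G A \<odot> apair (s \<odot> afst W (TOb T A)) (asnd W (TOb T A)) \<odot> apair (aide W) f"
    using assms by (intro acomp_cong_left) (auto simp: astrn_nat_left)
  then show ?thesis using assms by (simp add: atmap_def aT_acomp)
qed

lemma atmap_acomp:
  assumes "arr f" "arr g" "arr s" "src f = G" "tgt f = TOb T A" "src g = G \<otimes> A" "tgt s = G" "src s = W"
  shows "atmap G A f g \<odot> s = atmap W A (f \<odot> s) (g \<odot> apair (s \<odot> afst W A) (asnd W A))"
  using assms by (subst atmap_pair[symmetric]) (simp_all add: atmap_def)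

lemma atmap_aunit:
  assumes "arr f" "arr g" "src f = G" "tgt f = A" "src g = G \<otimes> A"
  shows "atmap G A (aunit A \<odot> f) g = aunit (tgt g) \<odot> g \<odot> apair (aide G) f"
proof -
  have "atmap G A (aunit A \<odot> f) g
    = aT g \<odot> (astrn G A \<odot> apair (afst G A) (aunit A \<odot> asnd G A)) \<odot> apair (aide G) f"
    using assms by (simp add: atmap_def)
  also have "\<dots> = (aT g \<odot> aunit (G \<otimes> A)) \<odot> apair (aide G) f"
    using assms unfolding astrn_aunit by simp
  also have "\<dots> = aunit (tgt g) \<odot> g \<odot> apair (aide G) f"
    using assms by (simp add: aunit_nat)
  finally show ?thesis .
qed

lemma aT_atmap:
  assumes "arr f" "arr g" "arr h" "src f = G" "tgt f = TOb T A" "src g = G \<otimes> A" "src h = tgt g"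
  shows "aT h \<odot> atmap G A f g = atmap G A f (h \<odot> g)"
  using assms by (simp add: atmap_def aT_acomp)

lemma atmap_amult:
  assumes "arr f" "arr g" "src f = G" "tgt f = TOb T (TOb T A)" "src g = G \<otimes> A"
  shows "atmap G A (amult A \<odot> f) g = amult (tgt g) \<odot> atmap G (TOb T A) f (aT g \<odot> astrn G A)"
proof -
  let ?A = "TOb T (TOb T A)"
  have "atmap G A (amult A \<odot> f) g
    = aT g \<odot> (astrn G A \<odot> apair (afst G ?A) (amult A \<odot> asnd G ?A)) \<odot> apair (aide G) f"
    using assms by (simp add: atmap_def)
  also have "\<dots> = aT g \<odot> (amult (G \<otimes> A) \<odot> aT (astrn G A) \<odot> astrn G (TOb T A)) \<odot> apair (aide G) f"
    by (simp only: astrn_amult)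
  also have "\<dots> = (aT g \<odot> amult (G \<otimes> A)) \<odot> aT (astrn G A) \<odot> astrn G (TOb T A) \<odot> apair (aide G) f"
    using assms by simp
  also have "\<dots> = amult (tgt g) \<odot> atmap G (TOb T A) f (aT g \<odot> astrn G A)"
    using assms by (simp add: amult_nat atmap_def aT_acomp)
  finally show ?thesis .
qed

text \<open>Associativity of the strength with both parameters equal to \<open>G\<close>,
  precomposed with the diagonal of \<open>G\<close>: using the context twice amounts to using it
  once and duplicating it under \<open>T\<close>.\<close>

lemma astrn_astrn:
  assumes "arr f" "src f = G" "tgt f = TOb T A"
  shows "astrn G (G \<otimes> A) \<odot> apair (aide G) (astrn G A \<odot> apair (aide G) f)
    = aT (apair (afst G A) (aide (G \<otimes> A))) \<odot> astrn G A \<odot> apair (aide G) f"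
proof -
  let ?d = "apair (aide G) (aide G)"
  have "astrn G (G \<otimes> A) \<odot> apair (aide G) (astrn G A \<odot> apair (aide G) f)
    = (astrn G (G \<otimes> A) \<odot> apair (afst G (G \<otimes> TOb T A)) (astrn G A \<odot> asnd G (G \<otimes> TOb T A))
      \<odot> apair (afst G G \<odot> afst (G \<otimes> G) (TOb T A))
          (apair (asnd G G \<odot> afst (G \<otimes> G) (TOb T A)) (asnd (G \<otimes> G) (TOb T A)))) \<odot> apair ?d f"
    using assms by simp
  also have "\<dots> = aT (apair (afst G G \<odot> afst (G \<otimes> G) A)
        (apair (asnd G G \<odot> afst (G \<otimes> G) A) (asnd (G \<otimes> G) A))) \<odot> astrn (G \<otimes> G) A \<odot> apair ?d f"
    unfolding astrn_assoc[symmetric] using assms by simp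
  also have "\<dots> = atmap G A f (apair (afst G A) (aide (G \<otimes> A)))"
    using assms by (subst atmap_pair) auto
  finally show ?thesis by (simp add: atmap_def)
qed

text \<open>Preservation of composition, for arrows that carry a parameter \<open>G\<close>:
  naturality of the strength in its second argument makes the two strengths adjacent, and
  \<open>astrn_astrn\<close> merges them.\<close>

lemma atmap_atmap:
  assumes "arr f" "arr g" "arr h" "src f = G" "tgt f = TOb T A" "src g = G \<otimes> A" "tgt g = B" "src h = G \<otimes> B"
  shows "atmap G B (atmap G A f g) h = atmap G A f (h \<odot> apair (afst G A) g)"
proof -
  let ?y = "astrn G A \<odot> apair (aide G) f"
  have "aT (apair (afst G (G \<otimes> A)) (g \<odot> asnd G (G \<otimes> A))) \<odot> astrn G (G \<otimes> A)
    = astrn G B \<odot> apair (afst G (TOb T (G \<otimes> A))) (aT g \<odot> asnd G (TOb T (G \<otimes> A)))"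
    using assms astrn_nat_right[of g "G \<otimes> A" G] by simp
  then have nat: "astrn G B \<odot> apair (afst G (TOb T (G \<otimes> A))) (aT g \<odot> asnd G (TOb T (G \<otimes> A)))
        \<odot> apair (aide G) ?y
    = aT (apair (afst G (G \<otimes> A)) (g \<odot> asnd G (G \<otimes> A))) \<odot> astrn G (G \<otimes> A) \<odot> apair (aide G) ?y"
    by (rule acomp_cong_left[OF sym]) (use assms in simp_all)
  have "atmap G B (atmap G A f g) h
    = aT h \<odot> (astrn G B \<odot> apair (afst G (TOb T (G \<otimes> A))) (aT g \<odot> asnd G (TOb T (G \<otimes> A))))
        \<odot> apair (aide G) ?y"
    using assms by (simp add: atmap_def)
  also have "\<dots> = aT h \<odot> aT (apair (afst G (G \<otimes> A)) (g \<odot> asnd G (G \<otimes> A)))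
        \<odot> astrn G (G \<otimes> A) \<odot> apair (aide G) ?y"
    by (subst nat[symmetric]) (use assms in \<open>simp del: apair_acomp\<close>)
  also have "\<dots> = aT h \<odot> aT (apair (afst G (G \<otimes> A)) (g \<odot> asnd G (G \<otimes> A)))
        \<odot> aT (apair (afst G A) (aide (G \<otimes> A))) \<odot> ?y"
    using assms by (simp add: astrn_astrn)
  also have "\<dots> = aT (h \<odot> apair (afst G (G \<otimes> A)) (g \<odot> asnd G (G \<otimes> A)) \<odot> apair (afst G A) (aide (G \<otimes> A))) \<odot> ?y"
    using assms by (simp add: aT_acomp del: apair_acomp)
  also have "\<dots> = atmap G A f (h \<odot> apair (afst G A) g)"
    using assms by (simp add: atmap_def)
  finally show ?thesis .
qed

text \<open>Preservation of identities for arrows with parameter \<open>G\<close>, whose identity on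
  \<open>A\<close> is the second projection.\<close>

lemma atmap_asnd:
  assumes "arr f" "src f = G" "tgt f = TOb T A"
  shows "atmap G A f (asnd G A) = f"
proof -
  let ?I = "terminal C" and ?b = "Arrow G (bang C G) (terminal C)"
  have b: "arr ?b" by (simp add: bang_hom)
  have one: "aT (asnd ?I A) \<odot> astrn ?I A = asnd ?I (TOb T A)"
    by (simp add: marrow_defs strn_one)
  \<comment> \<open>The unit law of the strength concerns a terminal parameter, so the context is
    first discarded along the unique arrow \<open>?b\<close>.\<close>
  have "atmap G A f (asnd G A) = aT (asnd ?I A) \<odot> astrn ?I A \<odot> apair ?b f"
    using assms b by (subst atmap_pair) auto
  also have "\<dots> = (aT (asnd ?I A) \<odot> astrn ?I A) \<odot> apair ?b f"
    using assms b by simp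
  also have "\<dots> = f" unfolding one using assms b by simp
  finally show ?thesis .
qed

section \<open>The functorial action in context, for plain morphisms\<close>

lemma tmap_hom:
  assumes "f \<in> hom C G (TOb T A)" "g \<in> hom C (G \<otimes> A) B"
  shows "tmap G A f g \<in> hom C G (TOb T B)"
proof -
  have "arr (atmap G A (Arrow G f (TOb T A)) (Arrow (G \<otimes> A) g B))" using assms by simp
  then show ?thesis unfolding arr_def by (simp add: mor_atmap)
qed

lemma tmap_pair:
  assumes "n \<in> hom C (G \<otimes> A) B" "s \<in> hom C W G" "f \<in> hom C W (TOb T A)"
  shows "TMor T n \<cdot> strn T G A \<cdot> \<langle>s, f\<rangle> = tmap W A f (n \<cdot> \<langle>s \<cdot> p1 C W A, p2 C W A\<rangle>)"
  using atmap_pair[of "Arrow (G \<otimes> A) n B" "Arrow W s G" "Arrow W f (TOb T A)", THEN arg_cong[where f = mor]] assms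
  by (simp add: mor_atmap marrow_defs)

lemma tmap_cmp:
  assumes "f \<in> hom C G (TOb T A)" "g \<in> hom C (G \<otimes> A) B" "s \<in> hom C W G"
  shows "tmap G A f g \<cdot> s = tmap W A (f \<cdot> s) (g \<cdot> \<langle>s \<cdot> p1 C W A, p2 C W A\<rangle>)"
  using atmap_acomp[of "Arrow G f (TOb T A)" "Arrow (G \<otimes> A) g B" "Arrow W s G", THEN arg_cong[where f = mor]] assms
  by (simp add: mor_atmap marrow_defs)

lemma tmap_unit:
  assumes "f \<in> hom C G A" "g \<in> hom C (G \<otimes> A) B"
  shows "tmap G A (unit T A \<cdot> f) g = unit T B \<cdot> g \<cdot> \<langle>ide C G, f\<rangle>"
  using atmap_aunit[of "Arrow G f A" "Arrow (G \<otimes> A) g B", THEN arg_cong[where f = mor]] assms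
  by (simp add: mor_atmap marrow_defs)

lemma TMor_tmap:
  assumes "f \<in> hom C G (TOb T A)" "g \<in> hom C (G \<otimes> A) B" "h \<in> hom C B D"
  shows "TMor T h \<cdot> tmap G A f g = tmap G A f (h \<cdot> g)"
  using aT_atmap[of "Arrow G f (TOb T A)" "Arrow (G \<otimes> A) g B" "Arrow B h D", THEN arg_cong[where f = mor]] assms
  by (simp add: mor_atmap marrow_defs)

lemma tmap_tmap:
  assumes "f \<in> hom C G (TOb T A)" "g \<in> hom C (G \<otimes> A) B" "h \<in> hom C (G \<otimes> B) D"
  shows "tmap G B (tmap G A f g) h = tmap G A f (h \<cdot> \<langle>p1 C G A, g\<rangle>)"
  using atmap_atmap[of "Arrow G f (TOb T A)" "Arrow (G \<otimes> A) g B" "Arrow (G \<otimes> B) h D", THEN arg_cong[where f = mor]] assms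
  by (simp add: mor_atmap marrow_defs)

lemma tmap_p2:
  assumes "f \<in> hom C G (TOb T A)"
  shows "tmap G A f (p2 C G A) = f"
  using atmap_asnd[of "Arrow G f (TOb T A)", THEN arg_cong[where f = mor]] assms
  by (simp add: mor_atmap marrow_defs)

text \<open>The target \<open>D\<close> is an arbitrary object. With a computation object of the
  same monad this gives associativity of \<open>Let\<close>; with one of another monad it prepares
  the handling of a \<open>Let\<close>.\<close>

lemma tmap_bind:
  assumes l: "l \<in> hom C G (TOb T A)" and m: "m \<in> hom C (G \<otimes> A) (TOb T B)"
    and n: "n \<in> hom C (G \<otimes> B) D"
  shows "tmap G B (mult T B \<cdot> tmap G A l m) n
    = mult T D \<cdot> tmap G A l (tmap (G \<otimes> A) B m (n \<cdot> \<langle>p1 C G A \<cdot> p1 C (G \<otimes> A) B, p2 C (G \<otimes> A) B\<rangle>))"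
proof -
  let ?s = "TMor T n \<cdot> strn T G B"
  have s: "?s \<in> hom C (G \<otimes> TOb T B) (TOb T D)" by (rule cmp_hom[OF strn_hom TMor_hom[OF n]])
  have lm: "tmap G A l m \<in> hom C G (TOb T (TOb T B))" using tmap_hom[OF l m] .
  have "tmap G B (mult T B \<cdot> tmap G A l m) n = mult T D \<cdot> tmap G (TOb T B) (tmap G A l m) ?s"
    using atmap_amult[of "Arrow G (tmap G A l m) (TOb T (TOb T B))" "Arrow (G \<otimes> B) n D", THEN arg_cong[where f = mor]] lm n
    by (simp add: mor_atmap marrow_defs)
  also have "tmap G (TOb T B) (tmap G A l m) ?s = tmap G A l (?s \<cdot> \<langle>p1 C G A, m\<rangle>)"
    by (rule tmap_tmap[OF l m s])
  also have "?s \<cdot> \<langle>p1 C G A, m\<rangle> = TMor T n \<cdot> strn T G B \<cdot> \<langle>p1 C G A, m\<rangle>"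
    by (rule cmp_assoc[OF pair_hom[OF p1_hom m] strn_hom TMor_hom[OF n]])
  also have "\<dots> = tmap (G \<otimes> A) B m (n \<cdot> \<langle>p1 C G A \<cdot> p1 C (G \<otimes> A) B, p2 C (G \<otimes> A) B\<rangle>)"
    by (rule tmap_pair[OF n p1_hom m])
  finally show ?thesis .
qed

section \<open>Kleisli composition in context\<close>

lemma bind_hom:
  assumes "f \<in> hom C G (TOb T A)" "g \<in> hom C (G \<otimes> A) (TOb T B)"
  shows "mult T B \<cdot> tmap G A f g \<in> hom C G (TOb T B)"
  by (rule cmp_hom[OF tmap_hom[OF assms] mult_hom])

lemma bind_cmp:
  assumes "f \<in> hom C G (TOb T A)" "g \<in> hom C (G \<otimes> A) (TOb T B)" "s \<in> hom C W G"
  shows "(mult T B \<cdot> tmap G A f g) \<cdot> s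
    = mult T B \<cdot> tmap W A (f \<cdot> s) (g \<cdot> \<langle>s \<cdot> p1 C W A, p2 C W A\<rangle>)"
  using cmp_assoc[OF assms(3) tmap_hom[OF assms(1,2)] mult_hom] tmap_cmp[OF assms] by simp

lemma bind_unit:
  assumes "f \<in> hom C G A" "g \<in> hom C (G \<otimes> A) (TOb T B)"
  shows "mult T B \<cdot> tmap G A (unit T A \<cdot> f) g = g \<cdot> \<langle>ide C G, f\<rangle>"
proof -
  have h: "g \<cdot> \<langle>ide C G, f\<rangle> \<in> hom C G (TOb T B)"
    by (rule cmp_hom[OF pair_hom[OF ide_hom assms(1)] assms(2)])
  show ?thesis
    using cmp_assoc[OF h unit_hom mult_hom] ide_left[OF h] by (simp add: tmap_unit[OF assms] mult_unit)
qed

lemma bind_eta: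
  assumes "f \<in> hom C G (TOb T A)"
  shows "mult T A \<cdot> tmap G A f (unit T A \<cdot> p2 C G A) = f"
proof -
  have "tmap G A f (unit T A \<cdot> p2 C G A) = TMor T (unit T A) \<cdot> f"
    using TMor_tmap[OF assms p2_hom unit_hom] tmap_p2[OF assms] by simp
  then show ?thesis
    using cmp_assoc[OF assms TMor_hom[OF unit_hom] mult_hom] ide_left[OF assms]
    by (simp add: mult_TMor_unit)
qed

lemma bind_bind:
  assumes l: "l \<in> hom C G (TOb T A)" and m: "m \<in> hom C (G \<otimes> A) (TOb T B)"
    and n: "n \<in> hom C (G \<otimes> B) (TOb T D)"
  shows "mult T D \<cdot> tmap G B (mult T B \<cdot> tmap G A l m) n
    = mult T D \<cdot> tmap G A l
        (mult T D \<cdot> tmap (G \<otimes> A) B m (n \<cdot> \<langle>p1 C G A \<cdot> p1 C (G \<otimes> A) B, p2 C (G \<otimes> A) B\<rangle>))"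
proof -
  let ?n = "n \<cdot> \<langle>p1 C G A \<cdot> p1 C (G \<otimes> A) B, p2 C (G \<otimes> A) B\<rangle>"
  have n': "?n \<in> hom C ((G \<otimes> A) \<otimes> B) (TOb T D)"
    by (rule cmp_hom[OF pair_hom[OF cmp_hom[OF p1_hom p1_hom] p2_hom] n])
  have k: "tmap (G \<otimes> A) B m ?n \<in> hom C (G \<otimes> A) (TOb T (TOb T D))" by (rule tmap_hom[OF m n'])
  have "mult T D \<cdot> tmap G B (mult T B \<cdot> tmap G A l m) n
    = mult T D \<cdot> mult T (TOb T D) \<cdot> tmap G A l (tmap (G \<otimes> A) B m ?n)"
    by (simp only: tmap_bind[OF l m n])
  also have "\<dots> = mult T D \<cdot> TMor T (mult T D) \<cdot> tmap G A l (tmap (G \<otimes> A) B m ?n)"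
    unfolding cmp_assoc[OF tmap_hom[OF l k] mult_hom mult_hom, symmetric]
      cmp_assoc[OF tmap_hom[OF l k] TMor_hom[OF mult_hom] mult_hom, symmetric]
    by (simp only: mult_mult)
  finally show ?thesis by (simp only: TMor_tmap[OF l k mult_hom])
qed

end

section \<open>Evaluation and currying in context\<close>

context kleisli_exponentials
begin

lemma ev_pair:
  assumes f: "f \<in> hom C (X \<otimes> Y) (TOb T Z)" and s: "s \<in> hom C W X" and g: "g \<in> hom C W Y"
  shows "ev T Y Z \<cdot> \<langle>cur T X Y Z f \<cdot> s, g\<rangle> = f \<cdot> \<langle>s, g\<rangle>"
proof -
  let ?f = "Arrow X (cur T X Y Z f) (kexp T Y Z)" and ?e = "Arrow (kexp T Y Z \<otimes> Y) (ev T Y Z) (TOb T Z)"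
  let ?c = "apair (?f \<odot> afst X Y) (asnd X Y)" and ?u = "apair (Arrow W s X) (Arrow W g Y)"
  have hom: "arr ?f" "arr ?e" using cur_hom[OF f] ev_hom by simp_all
  have "?e \<odot> (?c \<odot> ?u) = (?e \<odot> ?c) \<odot> ?u" using hom s g by simp
  then show ?thesis
    using ev_cur[OF f] p1_pair[OF s g] p2_pair[OF s g] hom(1) s g ide_left[OF p2_hom[of X Y]]
    by (simp add: apair_acomp[symmetric] cross_def arrow_defs del: apair_acomp)
       (simp add: pair_cmp[OF cmp_hom[OF p1_hom cur_hom[OF f]] p2_hom pair_hom[OF s g]]
         cmp_assoc[OF pair_hom[OF s g] p1_hom cur_hom[OF f]])
qed

text \<open>Currying is natural in the context: evaluating the left side gives, by
  \<open>ev_pair\<close>, exactly the arrow curried on the right, and \<open>cur_ev\<close> says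
  that an arrow into an exponential is determined by its evaluation.\<close>

lemma cur_cmp:
  assumes f: "f \<in> hom C (X \<otimes> Y) (TOb T Z)" and s: "s \<in> hom C W X"
  shows "cur T X Y Z f \<cdot> s = cur T W Y Z (f \<cdot> \<langle>s \<cdot> p1 C W Y, p2 C W Y\<rangle>)"
proof -
  have "cur T X Y Z f \<cdot> s = cur T W Y Z (ev T Y Z \<cdot> \<langle>(cur T X Y Z f \<cdot> s) \<cdot> p1 C W Y, p2 C W Y\<rangle>)"
    using cur_ev[OF cmp_hom[OF s cur_hom[OF f]]] ide_left[OF p2_hom] by (simp add: cross_def)
  also have "ev T Y Z \<cdot> \<langle>(cur T X Y Z f \<cdot> s) \<cdot> p1 C W Y, p2 C W Y\<rangle> = f \<cdot> \<langle>s \<cdot> p1 C W Y, p2 C W Y\<rangle>"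
    using ev_pair[OF f cmp_hom[OF p1_hom s] p2_hom] cmp_assoc[OF p1_hom s cur_hom[OF f]] by simp
  finally show ?thesis .
qed

lemma ev_pair_cur:
  assumes f: "f \<in> hom C (X \<otimes> Y) (TOb T Z)" and g: "g \<in> hom C X Y"
  shows "ev T Y Z \<cdot> \<langle>cur T X Y Z f, g\<rangle> = f \<cdot> \<langle>ide C X, g\<rangle>"
  using ev_pair[OF f ide_hom g] ide_right[OF cur_hom[OF f]] by simp

lemma cur_eta:
  assumes "v \<in> hom C X (kexp T Y Z)"
  shows "cur T X Y Z (ev T Y Z \<cdot> \<langle>v \<cdot> p1 C X Y, p2 C X Y\<rangle>) = v"
  using cur_ev[OF assms] ide_left[OF p2_hom] by (simp add: cross_def)

end

section \<open>Copairing in context\<close>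

context joint_kleisli_coproducts
begin

lemma copair_eta:
  assumes g: "g \<in> hom C (G \<otimes> kcop S Xs) (TOb (Ts i) Z)"
  shows "copair S i G Xs Z
      (map (\<lambda>j. g \<cdot> \<langle>p1 C G (Xs ! j), kinj S Xs j \<cdot> p2 C G (Xs ! j)\<rangle>) [0..<length Xs]) = g"
  using copair_unique[OF g] ide_left[OF p1_hom] by (simp add: cross_def)

lemma copair_inj':
  assumes "length fs = length Xs"
    and "\<And>j. j < length Xs \<Longrightarrow> fs ! j \<in> hom C (G \<otimes> (Xs ! j)) (TOb (Ts i) Z)"
    and j: "j < length Xs" and s: "s \<in> hom C W G" and v: "v \<in> hom C W (Xs ! j)"
  shows "copair S i G Xs Z fs \<cdot> \<langle>s, kinj S Xs j \<cdot> v\<rangle> = fs ! j \<cdot> \<langle>s, v\<rangle>"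
proof -
  let ?a = "Arrow (G \<otimes> kcop S Xs) (copair S i G Xs Z fs) (TOb (Ts i) Z)"
  let ?k = "Arrow (Xs ! j) (kinj S Xs j) (kcop S Xs)" and ?u = "apair (Arrow W s G) (Arrow W v (Xs ! j))"
  let ?c = "apair (afst G (Xs ! j)) (?k \<odot> asnd G (Xs ! j))"
  have hom: "arr ?a" "arr ?k" using copair_hom[of fs Xs G i Z] kinj_hom[OF j] assms by auto
  have "?a \<odot> apair (Arrow W s G) (?k \<odot> Arrow W v (Xs ! j)) = (?a \<odot> ?c) \<odot> ?u" using hom s v by simp
  moreover have "?a \<odot> ?c = Arrow (G \<otimes> (Xs ! j)) (fs ! j) (TOb (Ts i) Z)"
    using copair_inj[OF assms(1,2) j] ide_left[OF p1_hom[of G "Xs ! j"]] by (simp add: cross_def arrow_defs)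
  ultimately show ?thesis by (simp add: arrow_defs)
qed

text \<open>By the universal property, an arrow out of the coproduct is the copairing of its
  restrictions along the injections. On the left these restrictions are the reindexed branches
  \<open>gs\<close>.\<close>

lemma copair_cmp:
  assumes fs: "length fs = length Xs"
      "\<And>j. j < length Xs \<Longrightarrow> fs ! j \<in> hom C (G \<otimes> (Xs ! j)) (TOb (Ts i) Z)"
    and s: "s \<in> hom C W G"
    and gs: "length gs = length Xs"
      "\<And>j. j < length Xs \<Longrightarrow> gs ! j = fs ! j \<cdot> \<langle>s \<cdot> p1 C W (Xs ! j), p2 C W (Xs ! j)\<rangle>"
  shows "copair S i G Xs Z fs \<cdot> \<langle>s \<cdot> p1 C W (kcop S Xs), p2 C W (kcop S Xs)\<rangle> = copair S i W Xs Z gs"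
proof -
  let ?u = "\<langle>s \<cdot> p1 C W (kcop S Xs), p2 C W (kcop S Xs)\<rangle>"
  let ?g = "copair S i G Xs Z fs \<cdot> ?u"
  have c: "copair S i G Xs Z fs \<in> hom C (G \<otimes> kcop S Xs) (TOb (Ts i) Z)"
    using copair_hom fs by blast
  have u: "?u \<in> hom C (W \<otimes> kcop S Xs) (G \<otimes> kcop S Xs)"
    by (rule pair_hom[OF cmp_hom[OF p1_hom s] p2_hom])
  have "gs ! j = ?g \<cdot> \<langle>p1 C W (Xs ! j), kinj S Xs j \<cdot> p2 C W (Xs ! j)\<rangle>" if j: "j < length Xs" for j
  proof -
    let ?v = "\<langle>p1 C W (Xs ! j), kinj S Xs j \<cdot> p2 C W (Xs ! j)\<rangle>"
    note k = cmp_hom[OF p2_hom kinj_hom[OF j]]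
    have v: "?v \<in> hom C (W \<otimes> Xs ! j) (W \<otimes> kcop S Xs)"
      by (rule pair_hom[OF p1_hom k])
    have "?u \<cdot> ?v = \<langle>s \<cdot> p1 C W (Xs ! j), kinj S Xs j \<cdot> p2 C W (Xs ! j)\<rangle>"
      using pair_cmp[OF cmp_hom[OF p1_hom s] p2_hom v] cmp_assoc[OF v p1_hom s] p1_pair[OF p1_hom k]
        p2_pair[OF p1_hom k] by simp
    then show ?thesis
      using cmp_assoc[OF v u c] gs(2)[OF j] copair_inj'[OF fs j cmp_hom[OF p1_hom s] p2_hom] by simp
  qed
  then have "gs = map (\<lambda>j. ?g \<cdot> \<langle>p1 C W (Xs ! j), kinj S Xs j \<cdot> p2 C W (Xs ! j)\<rangle>) [0..<length Xs]"
    using gs(1) by (intro nth_equalityI) auto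
  then show ?thesis using copair_eta[OF cmp_hom[OF u c]] by simp
qed

lemma case_cmp:
  assumes fs: "length fs = length Xs"
      "\<And>j. j < length Xs \<Longrightarrow> fs ! j \<in> hom C (G \<otimes> (Xs ! j)) (TOb (Ts i) Z)"
    and f: "f \<in> hom C G (kcop S Xs)" and s: "s \<in> hom C W G"
    and gs: "length gs = length Xs"
      "\<And>j. j < length Xs \<Longrightarrow> gs ! j = fs ! j \<cdot> \<langle>s \<cdot> p1 C W (Xs ! j), p2 C W (Xs ! j)\<rangle>"
  shows "(copair S i G Xs Z fs \<cdot> \<langle>ide C G, f\<rangle>) \<cdot> s = copair S i W Xs Z gs \<cdot> \<langle>ide C W, f \<cdot> s\<rangle>"
proof -
  let ?c = "Arrow (G \<otimes> kcop S Xs) (copair S i G Xs Z fs) (TOb (Ts i) Z)"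
  let ?f = "Arrow G f (kcop S Xs)" and ?s = "Arrow W s G"
  have "arr ?c" using copair_hom[of fs Xs G i Z] fs by simp
  then have "(?c \<odot> apair (aide G) ?f) \<odot> ?s
    = (?c \<odot> apair (?s \<odot> afst W (kcop S Xs)) (asnd W (kcop S Xs))) \<odot> apair (aide W) (?f \<odot> ?s)"
    using f s by simp
  then show ?thesis using copair_cmp[OF fs s gs] by (simp add: arrow_defs)
qed

end

section \<open>The interpretation of terms\<close>

lemma those_eq_Some: "those xs = Some ys \<longleftrightarrow> xs = map Some ys"
proof (induction xs arbitrary: ys)
  case (Cons x xs)
  then show ?case by (cases ys; cases x) auto
qed auto

lemma those_map_eq_Some:
  "those (map f xs) = Some ys \<longleftrightarrow> length ys = length xs \<and> (\<forall>i < length xs. f (xs ! i) = Some (ys ! i))"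
  unfolding those_eq_Some by (auto simp: list_eq_iff_nth_eq)

lemma set_ops: "set (ops \<Sigma>) = fset (fmdom \<Sigma>)" and distinct_ops: "distinct (ops \<Sigma>)"
  using someI_ex[OF finite_distinct_list[of "fset (fmdom \<Sigma>)"]] unfolding ops_def by auto

context cartesian_category
begin

abbreviation lift :: "'ob \<Rightarrow> 'ob \<Rightarrow> 'm \<Rightarrow> 'm" where
  "lift W A s \<equiv> \<langle>s \<cdot> p1 C W A, p2 C W A\<rangle>"

lemma lift_hom: "s \<in> hom C W G \<Longrightarrow> lift W A s \<in> hom C (W \<otimes> A) (G \<otimes> A)"
  by (rule pair_hom[OF cmp_hom[OF p1_hom] p2_hom])

lemma unassoc_hom: "unassoc C X Y Z \<in> hom C (X \<otimes> (Y \<otimes> Z)) ((X \<otimes> Y) \<otimes> Z)"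
  unfolding unassoc_def by (intro pair_hom cmp_hom[OF p2_hom] p1_hom p2_hom)

lemma unassoc_pair:
  assumes "f \<in> hom C W X" "g \<in> hom C W Y" "h \<in> hom C W Z"
  shows "unassoc C X Y Z \<cdot> \<langle>f, \<langle>g, h\<rangle>\<rangle> = \<langle>\<langle>f, g\<rangle>, h\<rangle>"
proof -
  let ?u = "apair (apair (afst X (Y \<otimes> Z)) (afst Y Z \<odot> asnd X (Y \<otimes> Z))) (asnd Y Z \<odot> asnd X (Y \<otimes> Z))"
  let ?f = "Arrow W f X" and ?g = "Arrow W g Y" and ?h = "Arrow W h Z"
  have "?u \<odot> apair ?f (apair ?g ?h) = apair (apair ?f ?g) ?h"
    using assms by simp
  then show ?thesis by (simp add: arrow_defs unassoc_def)
qed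

lemma unassoc_lift:
  assumes "s \<in> hom C W X"
  shows "unassoc C X Y Z \<cdot> lift W (Y \<otimes> Z) s = lift (W \<otimes> Y) Z (lift W Y s) \<cdot> unassoc C W Y Z"
proof -
  let ?u = "\<lambda>X. apair (apair (afst X (Y \<otimes> Z)) (afst Y Z \<odot> asnd X (Y \<otimes> Z))) (asnd Y Z \<odot> asnd X (Y \<otimes> Z))"
  let ?s = "Arrow W s X"
  have "?u X \<odot> apair (?s \<odot> afst W (Y \<otimes> Z)) (asnd W (Y \<otimes> Z))
    = apair (apair (?s \<odot> afst W Y) (asnd W Y) \<odot> afst (W \<otimes> Y) Z) (asnd (W \<otimes> Y) Z) \<odot> ?u W"
    using assms by simp
  then show ?thesis by (simp add: arrow_defs unassoc_def)
qed

end

context kleisli_exponentials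
begin

text \<open>A handler clause binds its argument and its continuation one after the other but is
  curried over their product. Hence reindexing the curried form lifts \<open>s\<close> twice in the
  body.\<close>

lemma cur_unassoc_cmp:
  assumes g: "g \<in> hom C ((X \<otimes> Y) \<otimes> K) (TOb T Z)" and s: "s \<in> hom C W X"
  shows "cur T X (Y \<otimes> K) Z (g \<cdot> unassoc C X Y K) \<cdot> s
    = cur T W (Y \<otimes> K) Z ((g \<cdot> lift (W \<otimes> Y) K (lift W Y s)) \<cdot> unassoc C W Y K)"
  unfolding cur_cmp[OF cmp_hom[OF unassoc_hom g] s]
    cmp_assoc[OF lift_hom[OF s] unassoc_hom g] unassoc_lift[OF s]
    cmp_assoc[OF unassoc_hom lift_hom[OF lift_hom[OF s]] g] ..

end

sublocale eff_model \<subseteq> kleisli_exponentials \<M> "mon \<M> T" for T by (rule mon)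

sublocale eff_model \<subseteq> joint_kleisli_coproducts \<M> "mon \<M>" "cops \<M>" by (rule cops)

context eff_model
begin

abbreviation tyob ("\<lbrakk>_\<rbrakk>") where "\<lbrakk>A\<rbrakk> \<equiv> tysem \<M> A"

abbreviation ctxob ("\<lbrakk>_\<rbrakk>\<^sub>x") where "\<lbrakk>\<Gamma>\<rbrakk>\<^sub>x \<equiv> ctxsem \<M> \<Gamma>"

section \<open>The object of handlers and its projections\<close>

lemma
  assumes "fmlookup \<Sigma> op = Some (A, B)"
  shows hproj_hom: "hproj \<M> T' \<Sigma> X op \<in> hom \<M> (hobj \<M> T' \<Sigma> X)
    (kexp (mon \<M> T') (\<lbrakk>emb A\<rbrakk> \<otimes> kexp (mon \<M> T') \<lbrakk>emb B\<rbrakk> X) X)"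
    and hproj_ltup: "(\<And>op'. op' |\<in>| fmdom \<Sigma> \<Longrightarrow> F op' \<in> hom \<M> Z (hfac \<M> T' \<Sigma> X op'))
    \<Longrightarrow> hproj \<M> T' \<Sigma> X op \<cdot> ltup \<M> Z (map F (ops \<Sigma>)) = F op"
proof -
  let ?is = "THE i. i < length (ops \<Sigma>) \<and> ops \<Sigma> ! i = op"
  have "op \<in> set (ops \<Sigma>)" using assms by (auto simp: set_ops intro: fmdomI)
  \<comment> \<open>The list \<open>ops\<close> enumerates the domain of the signature without
    repetition, which makes the definite description in \<open>hproj\<close> meaningful.\<close>
  then have "\<exists>!i. i < length (ops \<Sigma>) \<and> ops \<Sigma> ! i = op"
    using distinct_ops[of \<Sigma>] by (auto simp: in_set_conv_nth nth_eq_iff_index_eq)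
  from theI'[OF this] have i: "?is < length (ops \<Sigma>)" "ops \<Sigma> ! ?is = op" by auto
  show "hproj \<M> T' \<Sigma> X op \<in> hom \<M> (hobj \<M> T' \<Sigma> X)
    (kexp (mon \<M> T') (\<lbrakk>emb A\<rbrakk> \<otimes> kexp (mon \<M> T') \<lbrakk>emb B\<rbrakk> X) X)"
    using lproj_hom[of ?is "map (hfac \<M> T' \<Sigma> X) (ops \<Sigma>)"] i assms
    by (simp add: hproj_def hobj_def hfac_def)
  show "hproj \<M> T' \<Sigma> X op \<cdot> ltup \<M> Z (map F (ops \<Sigma>)) = F op"
    if F: "\<And>op'. op' |\<in>| fmdom \<Sigma> \<Longrightarrow> F op' \<in> hom \<M> Z (hfac \<M> T' \<Sigma> X op')"
  proof -
    have "F (ops \<Sigma> ! j) \<in> hom \<M> Z (hfac \<M> T' \<Sigma> X (ops \<Sigma> ! j))" if "j < length (ops \<Sigma>)" for j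
      using F[of "ops \<Sigma> ! j"] that set_ops[of \<Sigma>] nth_mem by blast
    then show ?thesis
      using lproj_ltup[of "map F (ops \<Sigma>)" "map (hfac \<M> T' \<Sigma> X) (ops \<Sigma>)" Z ?is] i
      by (simp add: hproj_def)
  qed
qed

lemma hobj_ltup:
  assumes "\<And>op'. op' |\<in>| fmdom \<Sigma> \<Longrightarrow> F op' \<in> hom \<M> Z (hfac \<M> T' \<Sigma> X op')"
  shows "ltup \<M> Z (map F (ops \<Sigma>)) \<in> hom \<M> Z (hobj \<M> T' \<Sigma> X)"
proof -
  have "F (ops \<Sigma> ! j) \<in> hom \<M> Z (hfac \<M> T' \<Sigma> X (ops \<Sigma> ! j))" if "j < length (ops \<Sigma>)" for j
    using assms[of "ops \<Sigma> ! j"] that set_ops[of \<Sigma>] nth_mem by blast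
  then show ?thesis unfolding hobj_def by (intro ltup_hom) auto
qed

section \<open>Inversion of the partial interpretation, in place of its defining equations\<close>

lemma vsem_Var_iff:
  "vsem \<M> \<Gamma> (Var i) A = Some f
    \<longleftrightarrow> i < length \<Gamma> \<and> A = \<Gamma> ! i \<and> f = lproj \<M> (map (tysem \<M>) \<Gamma>) i"
  by auto

lemma vsem_Tup_iff:
  "vsem \<M> \<Gamma> (Tup Vs) A = Some f \<longleftrightarrow>
    (\<exists>As fs. A = Prod As \<and> length Vs = length As \<and> length fs = length As
      \<and> (\<forall>i < length As. vsem \<M> \<Gamma> (Vs ! i) (As ! i) = Some (fs ! i)) \<and> f = ltup \<M> \<lbrakk>\<Gamma>\<rbrakk>\<^sub>x fs)"
proof (cases A)
  case (Prod As)
  then show ?thesis by (auto simp: bind_eq_Some_conv those_map_eq_Some)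
qed auto

lemma vsem_Proj_iff:
  "vsem \<M> \<Gamma> (Proj As i V) A = Some f \<longleftrightarrow>
    (\<exists>g. i < length As \<and> A = As ! i \<and> vsem \<M> \<Gamma> V (Prod As) = Some g
      \<and> f = lproj \<M> (map (tysem \<M>) As) i \<cdot> g)"
  by (auto simp: bind_eq_Some_conv)

lemma vsem_Inj_iff:
  "vsem \<M> \<Gamma> (Inj i V) A = Some f \<longleftrightarrow>
    (\<exists>As g. A = Sum As \<and> i < length As \<and> vsem \<M> \<Gamma> V (As ! i) = Some g
      \<and> f = kinj (cops \<M>) (map (tysem \<M>) As) i \<cdot> g)"
  by (cases A) (auto simp: bind_eq_Some_conv)

lemma vsem_Lam_iff:
  "vsem \<M> \<Gamma> (Lam M) A = Some f \<longleftrightarrow>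
    (\<exists>A' B T g. A = Fun A' (Eff B T) \<and> csem \<M> (A' # \<Gamma>) M (Eff B T) = Some g
      \<and> f = cur (mon \<M> T) \<lbrakk>\<Gamma>\<rbrakk>\<^sub>x \<lbrakk>A'\<rbrakk> \<lbrakk>B\<rbrakk> g)"
proof (cases A)
  case (Fun A' C)
  then show ?thesis by (cases C) (auto simp: bind_eq_Some_conv)
qed auto

lemma csem_Ret_iff:
  "csem \<M> \<Gamma> (Ret V) (Eff A T) = Some f \<longleftrightarrow>
    (\<exists>g. vsem \<M> \<Gamma> V A = Some g \<and> f = unit (mon \<M> T) \<lbrakk>A\<rbrakk> \<cdot> g)"
  by (auto simp: bind_eq_Some_conv)

lemma csem_Let_iff:
  "csem \<M> \<Gamma> (Let A M N) (Eff B T) = Some f \<longleftrightarrow>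
    (\<exists>g h. csem \<M> \<Gamma> M (Eff A T) = Some g \<and> csem \<M> (A # \<Gamma>) N (Eff B T) = Some h
      \<and> f = mult (mon \<M> T) \<lbrakk>B\<rbrakk> \<cdot> tmap T \<lbrakk>\<Gamma>\<rbrakk>\<^sub>x \<lbrakk>A\<rbrakk> g h)"
  by (auto simp: bind_eq_Some_conv tmap_def)

lemma csem_App_iff:
  "csem \<M> \<Gamma> (App A V W) (Eff B T) = Some f \<longleftrightarrow>
    (\<exists>g h. vsem \<M> \<Gamma> V (Fun A (Eff B T)) = Some g \<and> vsem \<M> \<Gamma> W A = Some h
      \<and> f = ev (mon \<M> T) \<lbrakk>A\<rbrakk> \<lbrakk>B\<rbrakk> \<cdot> \<langle>g, h\<rangle>)"
  by (auto simp: bind_eq_Some_conv)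

lemma csem_Op_iff:
  "csem \<M> \<Gamma> (Op op V) (Eff B T) = Some f \<longleftrightarrow>
    (\<exists>A' B' g. fmlookup (sig T) op = Some (A', B') \<and> B = emb B' \<and> vsem \<M> \<Gamma> V (emb A') = Some g
      \<and> f = opm \<M> T op \<cdot> g)"
  by (auto simp: bind_eq_Some_conv split: option.splits prod.splits)

lemma csem_Handle_iff:
  "csem \<M> \<Gamma> (Handle D M H N) (Eff B T') = Some f \<longleftrightarrow>
    (\<exists>A T h g n. D = Eff A T \<and> hsem \<M> \<Gamma> H (sig T) (Eff B T') = Some h
      \<and> csem \<M> \<Gamma> M (Eff A T) = Some g \<and> csem \<M> (A # \<Gamma>) N (Eff B T') = Some n
      \<and> h \<in> hpsh \<M> T T' \<lbrakk>B\<rbrakk> \<lbrakk>\<Gamma>\<rbrakk>\<^sub>x \<and> f = hdl \<M> T T' \<lbrakk>B\<rbrakk> \<lbrakk>\<Gamma>\<rbrakk>\<^sub>x h (tmap T \<lbrakk>\<Gamma>\<rbrakk>\<^sub>x \<lbrakk>A\<rbrakk> g n))"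
  by (cases D) (auto simp: bind_eq_Some_conv tmap_def split: if_splits)

lemma csem_Case_iff:
  "csem \<M> \<Gamma> (Case As V Ms) (Eff B T) = Some f \<longleftrightarrow>
    (\<exists>v fs. length Ms = length As \<and> vsem \<M> \<Gamma> V (Sum As) = Some v \<and> length fs = length As
      \<and> (\<forall>i < length As. csem \<M> (As ! i # \<Gamma>) (Ms ! i) (Eff B T) = Some (fs ! i))
      \<and> f = copair (cops \<M>) T \<lbrakk>\<Gamma>\<rbrakk>\<^sub>x (map (tysem \<M>) As) \<lbrakk>B\<rbrakk> fs \<cdot> \<langle>ide \<M> \<lbrakk>\<Gamma>\<rbrakk>\<^sub>x, v\<rangle>)"
  by (auto simp: bind_eq_Some_conv those_map_eq_Some)

text \<open>The component at \<open>op\<close> of the interpretation of a handler, for a clause interpreted by \<open>g\<close>.\<close>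

definition clsem :: "('b, 'o) effthy \<Rightarrow> ('b, 'o) signat \<Rightarrow> 'ob \<Rightarrow> 'ob \<Rightarrow> 'o \<Rightarrow> 'm \<Rightarrow> 'm" where
  "clsem T' \<Sigma> G X op g =
    (let (A, B) = the (fmlookup \<Sigma> op); K = kexp (mon \<M> T') \<lbrakk>emb B\<rbrakk> X
     in cur (mon \<M> T') G (\<lbrakk>emb A\<rbrakk> \<otimes> K) X (g \<cdot> unassoc \<M> G \<lbrakk>emb A\<rbrakk> K))"

text \<open>A function from operations to clause denotations replaces the list over
  \<open>ops\<close>. Handlers can then be compared clause by clause, independently of the chosen
  order of operations.\<close>

lemma hsem_iff:
  "hsem \<M> \<Gamma> H \<Sigma> (Eff B T') = Some h \<longleftrightarrow>
    fmdom H = fmdom \<Sigma> \<and>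
    (\<exists>g. (\<forall>op A' B' M. fmlookup \<Sigma> op = Some (A', B') \<longrightarrow> fmlookup H op = Some M
          \<longrightarrow> csem \<M> (Fun (emb B') (Eff B T') # emb A' # \<Gamma>) M (Eff B T') = Some (g op))
      \<and> h = ltup \<M> \<lbrakk>\<Gamma>\<rbrakk>\<^sub>x (map (\<lambda>op. clsem T' \<Sigma> \<lbrakk>\<Gamma>\<rbrakk>\<^sub>x \<lbrakk>B\<rbrakk> op (g op)) (ops \<Sigma>)))"
  (is "_ \<longleftrightarrow> ?dom \<and> (\<exists>g. ?cl g \<and> h = ?tup g)")
proof (cases ?dom)
  case dom: True
  define F where "F = (\<lambda>op. case (fmlookup \<Sigma> op, fmlookup H op) of
    (Some (A', B'), Some M) \<Rightarrow> csem \<M> (Fun (emb B') (Eff B T') # emb A' # \<Gamma>) M (Eff B T') | _ \<Rightarrow> None)"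
  have F: "?cl g \<longleftrightarrow> (\<forall>op \<in> set (ops \<Sigma>). F op = Some (g op))" for g
  proof
    assume cl: "?cl g"
    show "\<forall>op \<in> set (ops \<Sigma>). F op = Some (g op)"
    proof
      fix op assume "op \<in> set (ops \<Sigma>)"
      then have "op |\<in>| fmdom \<Sigma>" "op |\<in>| fmdom H" by (simp_all add: set_ops dom)
      then obtain A' B' M where "fmlookup \<Sigma> op = Some (A', B')" "fmlookup H op = Some M"
        by (metis fmdomE surj_pair)
      then show "F op = Some (g op)" using cl by (simp add: F_def)
    qed
  next
    assume F: "\<forall>op \<in> set (ops \<Sigma>). F op = Some (g op)"
    show "?cl g"
    proof (intro allI impI)
      fix op A' B' M assume l: "fmlookup \<Sigma> op = Some (A', B')" "fmlookup H op = Some M"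
      then have "op \<in> set (ops \<Sigma>)" by (auto simp: set_ops intro: fmdomI)
      then show "csem \<M> (Fun (emb B') (Eff B T') # emb A' # \<Gamma>) M (Eff B T') = Some (g op)"
        using F l by (force simp: F_def)
    qed
  qed
  have eq: "hsem \<M> \<Gamma> H \<Sigma> (Eff B T') =
    those (map (\<lambda>op. map_option (clsem T' \<Sigma> \<lbrakk>\<Gamma>\<rbrakk>\<^sub>x \<lbrakk>B\<rbrakk> op) (F op)) (ops \<Sigma>)) \<bind> (\<lambda>fs. Some (ltup \<M> \<lbrakk>\<Gamma>\<rbrakk>\<^sub>x fs))"
    unfolding hsem.simps using dom
    by (auto intro!: arg_cong[where f = "\<lambda>x. those x \<bind> _"] map_cong split: option.splits
        simp: F_def clsem_def Let_def map_conv_bind_option comp_def)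
  show ?thesis
  proof
    assume "hsem \<M> \<Gamma> H \<Sigma> (Eff B T') = Some h"
    then obtain fs where fs: "map (\<lambda>op. map_option (clsem T' \<Sigma> \<lbrakk>\<Gamma>\<rbrakk>\<^sub>x \<lbrakk>B\<rbrakk> op) (F op)) (ops \<Sigma>) = map Some fs"
      and h: "h = ltup \<M> \<lbrakk>\<Gamma>\<rbrakk>\<^sub>x fs"
      unfolding eq by (auto simp: bind_eq_Some_conv those_eq_Some)
    \<comment> \<open>An undefined clause would leave a \<open>None\<close> in a list that consists
      of \<open>Some\<close> values only.\<close>
    have "F op \<noteq> None" if "op \<in> set (ops \<Sigma>)" for op
    proof
      assume "F op = None"
      then have "None \<in> set (map Some fs)" unfolding fs[symmetric] using that by force
      then show False by auto
    qed
    then have g: "\<forall>op \<in> set (ops \<Sigma>). F op = Some (the (F op))" by auto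
    have "map Some fs = map Some (map (\<lambda>op. clsem T' \<Sigma> \<lbrakk>\<Gamma>\<rbrakk>\<^sub>x \<lbrakk>B\<rbrakk> op (the (F op))) (ops \<Sigma>))"
      unfolding fs[symmetric] map_map by (rule map_cong) (use g in force)+
    then have "fs = map (\<lambda>op. clsem T' \<Sigma> \<lbrakk>\<Gamma>\<rbrakk>\<^sub>x \<lbrakk>B\<rbrakk> op (the (F op))) (ops \<Sigma>)"
      by (rule map_injective) simp
    then have "h = ?tup (\<lambda>op. the (F op))" using h by (simp only:)
    moreover have "?cl (\<lambda>op. the (F op))" using F g by (simp only:)
    ultimately show "?dom \<and> (\<exists>g. ?cl g \<and> h = ?tup g)"
      using dom by (intro conjI exI[of _ "\<lambda>op. the (F op)"])
  next
    assume "?dom \<and> (\<exists>g. ?cl g \<and> h = ?tup g)"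
    then obtain g where g: "\<forall>op \<in> set (ops \<Sigma>). F op = Some (g op)" and h: "h = ?tup g" using F by auto
    have "map (\<lambda>op. map_option (clsem T' \<Sigma> \<lbrakk>\<Gamma>\<rbrakk>\<^sub>x \<lbrakk>B\<rbrakk> op) (F op)) (ops \<Sigma>)
      = map Some (map (\<lambda>op. clsem T' \<Sigma> \<lbrakk>\<Gamma>\<rbrakk>\<^sub>x \<lbrakk>B\<rbrakk> op (g op)) (ops \<Sigma>))"
      unfolding map_map by (rule map_cong) (use g in auto)
    from this[folded those_eq_Some] show "hsem \<M> \<Gamma> H \<Sigma> (Eff B T') = Some h"
      unfolding eq h by simp
  qed
qed auto

declare vsem.simps [simp del] csem.simps [simp del] hsem.simps [simp del]

text \<open>The interpretation checks types wherever it branches, so a defined denotation is an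
  arrow between the expected objects.\<close>

lemma sem_hom:
  shows "vsem \<M> \<Gamma> V A = Some f \<Longrightarrow> f \<in> hom \<M> \<lbrakk>\<Gamma>\<rbrakk>\<^sub>x \<lbrakk>A\<rbrakk>"
    and "csem \<M> \<Gamma> M (Eff B T) = Some f \<Longrightarrow> f \<in> hom \<M> \<lbrakk>\<Gamma>\<rbrakk>\<^sub>x (TOb (mon \<M> T) \<lbrakk>B\<rbrakk>)"
proof (induction V and M arbitrary: \<Gamma> A f and \<Gamma> B T f rule: val.induct comp.induct)
  case (Var i)
  then show ?case using lproj_hom[of i "map (tysem \<M>) \<Gamma>"] by (simp add: vsem_Var_iff)
next
  case (Tup Vs)
  then obtain As fs where *: "A = Prod As" "length Vs = length As" "length fs = length As"
    "\<forall>i < length As. vsem \<M> \<Gamma> (Vs ! i) (As ! i) = Some (fs ! i)" "f = ltup \<M> \<lbrakk>\<Gamma>\<rbrakk>\<^sub>x fs"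
    unfolding vsem_Tup_iff by blast
  have "fs ! i \<in> hom \<M> \<lbrakk>\<Gamma>\<rbrakk>\<^sub>x \<lbrakk>As ! i\<rbrakk>" if "i < length As" for i
    using Tup.IH[of "Vs ! i" \<Gamma> "As ! i"] * that by simp
  then show ?case using ltup_hom[of fs "map (tysem \<M>) As" "\<lbrakk>\<Gamma>\<rbrakk>\<^sub>x"] * by simp
next
  case (Proj As i V)
  then obtain g where "i < length As" "A = As ! i" "vsem \<M> \<Gamma> V (Prod As) = Some g"
      "f = lproj \<M> (map (tysem \<M>) As) i \<cdot> g"
    unfolding vsem_Proj_iff by blast
  then show ?case using Proj.IH[of \<Gamma> "Prod As" g] lproj_hom[of i "map (tysem \<M>) As"]
    by (simp add: cmp_hom)
next
  case (Inj i V)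
  then obtain As g where "A = Sum As" "i < length As" "vsem \<M> \<Gamma> V (As ! i) = Some g"
      "f = kinj (cops \<M>) (map (tysem \<M>) As) i \<cdot> g"
    unfolding vsem_Inj_iff by blast
  then show ?case using Inj.IH[of \<Gamma> "As ! i" g] kinj_hom[of i "map (tysem \<M>) As"]
    by (simp add: cmp_hom)
next
  case (Lam M)
  then show ?case by (force simp: vsem_Lam_iff intro!: cur_hom dest: Lam.IH)
next
  case (Ret V)
  then show ?case by (auto simp: csem_Ret_iff intro!: cmp_hom[OF _ unit_hom])
next
  case (Let A M N)
  then show ?case by (force simp: csem_Let_iff intro!: bind_hom dest: Let.IH)
next
  case (App A V W)
  then obtain g h where "vsem \<M> \<Gamma> V (Fun A (Eff B T)) = Some g" "vsem \<M> \<Gamma> W A = Some h"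
      "f = ev (mon \<M> T) \<lbrakk>A\<rbrakk> \<lbrakk>B\<rbrakk> \<cdot> \<langle>g, h\<rangle>" unfolding csem_App_iff by blast
  then show ?case using cmp_hom[OF pair_hom ev_hom] App.IH(1)[of \<Gamma> "Fun A (Eff B T)" g] App.IH(2)[of \<Gamma> A h]
    by simp
next
  case (Op op V)
  then show ?case by (auto simp: csem_Op_iff intro!: cmp_hom[OF _ opm_hom])
next
  case (Handle D M H N)
  then obtain A T' h g n where *: "h \<in> hpsh \<M> T' T \<lbrakk>B\<rbrakk> \<lbrakk>\<Gamma>\<rbrakk>\<^sub>x" "csem \<M> \<Gamma> M (Eff A T') = Some g"
      "csem \<M> (A # \<Gamma>) N (Eff B T) = Some n" "f = hdl \<M> T' T \<lbrakk>B\<rbrakk> \<lbrakk>\<Gamma>\<rbrakk>\<^sub>x h (tmap T' \<lbrakk>\<Gamma>\<rbrakk>\<^sub>x \<lbrakk>A\<rbrakk> g n)"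
    unfolding csem_Handle_iff by blast
  have "g \<in> hom \<M> \<lbrakk>\<Gamma>\<rbrakk>\<^sub>x (TOb (mon \<M> T') \<lbrakk>A\<rbrakk>)" using Handle.IH(1) * by blast
  moreover have "n \<in> hom \<M> (\<lbrakk>\<Gamma>\<rbrakk>\<^sub>x \<otimes> \<lbrakk>A\<rbrakk>) (TOb (mon \<M> T) \<lbrakk>B\<rbrakk>)" using Handle.IH(3)[of "A # \<Gamma>"] * by simp
  \<comment> \<open>The condition under which a handled computation is defined is membership in
    \<open>hpsh\<close>, which is what \<open>hdl_hom\<close> asks of the handler.\<close>
  ultimately show ?case using * by (auto intro!: hdl_hom tmap_hom)
next
  case (Case As V Ms)
  then obtain v fs where *: "length Ms = length As" "vsem \<M> \<Gamma> V (Sum As) = Some v" "length fs = length As"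
      "\<forall>i < length As. csem \<M> (As ! i # \<Gamma>) (Ms ! i) (Eff B T) = Some (fs ! i)"
      "f = copair (cops \<M>) T \<lbrakk>\<Gamma>\<rbrakk>\<^sub>x (map (tysem \<M>) As) \<lbrakk>B\<rbrakk> fs \<cdot> \<langle>ide \<M> \<lbrakk>\<Gamma>\<rbrakk>\<^sub>x, v\<rangle>"
    unfolding csem_Case_iff by blast
  have v: "v \<in> hom \<M> \<lbrakk>\<Gamma>\<rbrakk>\<^sub>x (kcop (cops \<M>) (map (tysem \<M>) As))"
    using Case.IH(1)[OF *(2)] by simp
  have "fs ! i \<in> hom \<M> (\<lbrakk>\<Gamma>\<rbrakk>\<^sub>x \<otimes> \<lbrakk>As ! i\<rbrakk>) (TOb (mon \<M> T) \<lbrakk>B\<rbrakk>)" if "i < length As" for i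
    using Case.IH(2)[of "Ms ! i" "As ! i # \<Gamma>"] * that by simp
  then have "copair (cops \<M>) T \<lbrakk>\<Gamma>\<rbrakk>\<^sub>x (map (tysem \<M>) As) \<lbrakk>B\<rbrakk> fs
      \<in> hom \<M> (\<lbrakk>\<Gamma>\<rbrakk>\<^sub>x \<otimes> kcop (cops \<M>) (map (tysem \<M>) As)) (TOb (mon \<M> T) \<lbrakk>B\<rbrakk>)"
    using * by (intro copair_hom) auto
  then show ?case unfolding *(5) by (rule cmp_hom[OF pair_hom[OF ide_hom v]])
qed

lemma clsem_hom:
  assumes "fmlookup \<Sigma> op = Some (A', B')"
    and "g \<in> hom \<M> ((G \<otimes> \<lbrakk>emb A'\<rbrakk>) \<otimes> kexp (mon \<M> T') \<lbrakk>emb B'\<rbrakk> X) (TOb (mon \<M> T') X)"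
  shows "clsem T' \<Sigma> G X op g \<in> hom \<M> G (hfac \<M> T' \<Sigma> X op)"
  using cur_hom[OF cmp_hom[OF unassoc_hom assms(2)]] assms(1) by (simp add: clsem_def hfac_def Let_def)

lemma clsem_cmp:
  assumes "fmlookup \<Sigma> op = Some (A', B')"
    and "g \<in> hom \<M> ((G \<otimes> \<lbrakk>emb A'\<rbrakk>) \<otimes> kexp (mon \<M> T') \<lbrakk>emb B'\<rbrakk> X) (TOb (mon \<M> T') X)"
    and "s \<in> hom \<M> W G"
  shows "clsem T' \<Sigma> G X op g \<cdot> s = clsem T' \<Sigma> W X op
    (g \<cdot> lift (W \<otimes> \<lbrakk>emb A'\<rbrakk>) (kexp (mon \<M> T') \<lbrakk>emb B'\<rbrakk> X) (lift W \<lbrakk>emb A'\<rbrakk> s))"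
  using cur_unassoc_cmp[OF assms(2,3)] assms(1) by (simp add: clsem_def Let_def)

end

section \<open>Effect theory terms and substitution\<close>

lemma axs_typed:
  assumes "(\<Delta>, M, N, A) \<in> axs T"
  shows "gctyp (sig T) \<Delta> M A" "gctyp (sig T) \<Delta> N A"
  using Rep_effthy[of T] assms unfolding axs_def sig_def by (auto split: prod.splits)

context eff_model
begin

notation acomp (infixr "\<odot>" 70)

section \<open>Effect theory terms as arrows out of the object of handlers\<close>

lemma rearr_pair:
  assumes "h \<in> hom \<M> W P" "d \<in> hom \<M> W D" "k \<in> hom \<M> W K" "b \<in> hom \<M> W B"
  shows "rearr \<M> P D K B \<cdot> \<langle>\<langle>h, \<langle>d, k\<rangle>\<rangle>, b\<rangle> = \<langle>h, \<langle>\<langle>d, b\<rangle>, k\<rangle>\<rangle>"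
proof -
  let ?q = "afst (P \<otimes> (D \<otimes> K)) B"
  let ?r = "asnd P (D \<otimes> K) \<odot> ?q"
  have "apair (afst P (D \<otimes> K) \<odot> ?q) (apair (apair (afst D K \<odot> ?r) (asnd (P \<otimes> (D \<otimes> K)) B)) (asnd D K \<odot> ?r))
      \<odot> apair (apair (Arrow W h P) (apair (Arrow W d D) (Arrow W k K))) (Arrow W b B)
    = apair (Arrow W h P) (apair (apair (Arrow W d D) (Arrow W b B)) (Arrow W k K))"
    using assms by simp
  then show ?thesis by (simp add: arrow_defs rearr_def Let_def)
qed

lemma rearr_hom: "rearr \<M> P D K B \<in> hom \<M> ((P \<otimes> (D \<otimes> K)) \<otimes> B) (P \<otimes> ((D \<otimes> B) \<otimes> K))"
  unfolding rearr_def Let_def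
  by (intro pair_hom) (rule cmp_hom p1_hom p2_hom | rule cmp_hom[OF cmp_hom])+

abbreviation gctxob ("\<lbrakk>_\<rbrakk>\<^sub>d") where "\<lbrakk>\<Delta>\<rbrakk>\<^sub>d \<equiv> ctxsem \<M> (map emb \<Delta>)"

text \<open>Ground values have a total interpretation of their own. Identifying it with that of the
  embedded value makes \<open>sem_hom\<close> and the substitution lemmas available for it.\<close>

lemma gvsem_embv:
  "gvtyp \<Delta> V A \<Longrightarrow> vsem \<M> (map emb \<Delta>) (embv V) (emb A) = Some (gvsem \<M> \<Delta> V A)"
proof (induction rule: gvtyp.induct)
  case (GTup Vs As \<Delta>)
  then show ?case
    by (auto simp: vsem_Tup_iff comp_def intro!: exI[of _ "map (\<lambda>(V, A). gvsem \<M> \<Delta> V A) (zip Vs As)"])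
qed (auto simp: vsem_Var_iff vsem_Proj_iff vsem_Inj_iff comp_def)

lemma gvsem_hom: "gvtyp \<Delta> V A \<Longrightarrow> gvsem \<M> \<Delta> V A \<in> hom \<M> \<lbrakk>\<Delta>\<rbrakk>\<^sub>d \<lbrakk>emb A\<rbrakk>"
  using sem_hom(1)[OF gvsem_embv] .

lemma hdenU_hom:
  "gctyp \<Sigma> \<Delta> M A \<Longrightarrow> hdenU \<M> T' \<Sigma> X \<Delta> M A
    \<in> hom \<M> (hobj \<M> T' \<Sigma> X \<otimes> (\<lbrakk>\<Delta>\<rbrakk>\<^sub>d \<otimes> kexp (mon \<M> T') \<lbrakk>emb A\<rbrakk> X)) (TOb (mon \<M> T') X)"
proof (induction rule: gctyp.induct)
  case (GRet \<Delta> V A)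
  let ?K = "kexp (mon \<M> T') \<lbrakk>emb A\<rbrakk> X"
  have "cross \<M> \<lbrakk>\<Delta>\<rbrakk>\<^sub>d ?K (gvsem \<M> \<Delta> V A) (ide \<M> ?K) \<in> hom \<M> (\<lbrakk>\<Delta>\<rbrakk>\<^sub>d \<otimes> ?K) (\<lbrakk>emb A\<rbrakk> \<otimes> ?K)"
    unfolding cross_def by (rule pair_hom[OF cmp_hom[OF p1_hom gvsem_hom[OF GRet]] cmp_hom[OF p2_hom ide_hom]])
  moreover have "swap \<M> \<lbrakk>emb A\<rbrakk> ?K \<in> hom \<M> (\<lbrakk>emb A\<rbrakk> \<otimes> ?K) (?K \<otimes> \<lbrakk>emb A\<rbrakk>)"
    unfolding swap_def by (rule pair_hom[OF p2_hom p1_hom])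
  ultimately show ?case
    by (simp add: Let_def comp_def) (rule cmp_hom[OF cmp_hom[OF cmp_hom[OF p2_hom]] ev_hom])
next
  case (GLet op A' B' \<Delta> V M A)
  let ?P = "hobj \<M> T' \<Sigma> X" and ?K = "kexp (mon \<M> T') \<lbrakk>emb A\<rbrakk> X"
  have M: "hdenU \<M> T' \<Sigma> X (B' # \<Delta>) M A \<in> hom \<M> (?P \<otimes> ((\<lbrakk>\<Delta>\<rbrakk>\<^sub>d \<otimes> \<lbrakk>emb B'\<rbrakk>) \<otimes> ?K)) (TOb (mon \<M> T') X)"
    using GLet.IH by simp
  show ?case
    using cmp_hom[OF pair_hom[OF cmp_hom[OF p1_hom hproj_hom[OF GLet(1)]]
      pair_hom[OF cmp_hom[OF cmp_hom[OF p2_hom p1_hom] gvsem_hom[OF GLet(2)]]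
        cur_hom[OF cmp_hom[OF rearr_hom M]]]] ev_hom]
    by (simp add: Let_def comp_def GLet(1))
next
  case (GCase \<Delta> V As Ms A)
  let ?P = "hobj \<M> T' \<Sigma> X" and ?K = "kexp (mon \<M> T') \<lbrakk>emb A\<rbrakk> X"
  let ?fs = "map (\<lambda>(M, A'). hdenU \<M> T' \<Sigma> X (A' # \<Delta>) M A \<cdot> rearr \<M> ?P \<lbrakk>\<Delta>\<rbrakk>\<^sub>d ?K \<lbrakk>emb A'\<rbrakk>) (zip Ms As)"
  have "?fs ! i \<in> hom \<M> ((?P \<otimes> (\<lbrakk>\<Delta>\<rbrakk>\<^sub>d \<otimes> ?K)) \<otimes> \<lbrakk>emb (As ! i)\<rbrakk>) (TOb (mon \<M> T') X)"
    if "i < length As" for i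
    using cmp_hom[OF rearr_hom] GCase.IH[OF that] GCase(2) that by simp
  then have c: "copair (cops \<M>) T' (?P \<otimes> (\<lbrakk>\<Delta>\<rbrakk>\<^sub>d \<otimes> ?K)) (map (\<lambda>A. \<lbrakk>emb A\<rbrakk>) As) X ?fs
    \<in> hom \<M> ((?P \<otimes> (\<lbrakk>\<Delta>\<rbrakk>\<^sub>d \<otimes> ?K)) \<otimes> kcop (cops \<M>) (map (\<lambda>A. \<lbrakk>emb A\<rbrakk>) As)) (TOb (mon \<M> T') X)"
    using GCase(2) by (intro copair_hom) auto
  have v: "gvsem \<M> \<Delta> V (GSum As) \<in> hom \<M> \<lbrakk>\<Delta>\<rbrakk>\<^sub>d (kcop (cops \<M>) (map (\<lambda>A. \<lbrakk>emb A\<rbrakk>) As))"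
    using gvsem_hom[OF GCase(1)] by (simp add: comp_def)
  show ?case
    using cmp_hom[OF pair_hom[OF ide_hom cmp_hom[OF cmp_hom[OF p2_hom p1_hom] v]] c]
    by (simp add: Let_def comp_def)
qed

lemma hden_hom:
  assumes "gctyp \<Sigma> \<Delta> M A"
  shows "hden \<M> T' \<Sigma> X \<Delta> M A
    \<in> hom \<M> (hobj \<M> T' \<Sigma> X) (kexp (mon \<M> T') (\<lbrakk>\<Delta>\<rbrakk>\<^sub>d \<otimes> kexp (mon \<M> T') \<lbrakk>emb A\<rbrakk> X) X)"
  using cur_hom[OF hdenU_hom[OF assms]] by (simp add: hden_def comp_def)

lemma hpsh_hom: "h \<in> hpsh \<M> T T' X Z \<Longrightarrow> h \<in> hom \<M> Z (hobj \<M> T' (sig T) X)"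
  by (simp add: hpsh_def)

text \<open>Satisfaction equates two postcomposites of \<open>h\<close>, and precomposing with
  \<open>g\<close> preserves such an equation. Axioms are well typed, so \<open>hden_hom\<close>
  licenses the reassociation.\<close>

lemma hpsh_cmp:
  assumes h: "h \<in> hpsh \<M> T T' X Z" and g: "g \<in> hom \<M> W Z"
  shows "h \<cdot> g \<in> hpsh \<M> T T' X W"
proof -
  have eq: "hden \<M> T' (sig T) X \<Delta> M A \<cdot> h \<cdot> g = (hden \<M> T' (sig T) X \<Delta> M A \<cdot> h) \<cdot> g"
    if "gctyp (sig T) \<Delta> M A" for \<Delta> M A
    by (rule cmp_assoc[OF g hpsh_hom[OF h] hden_hom[OF that], symmetric])
  have "hden \<M> T' (sig T) X \<Delta> M A \<cdot> h \<cdot> g = hden \<M> T' (sig T) X \<Delta> N A \<cdot> h \<cdot> g"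
    if "(\<Delta>, M, N, A) \<in> axs T" for \<Delta> M N A
    using h that eq axs_typed[OF that] by (auto simp: hpsh_def)
  then show ?thesis using cmp_hom[OF g hpsh_hom[OF h]] by (auto simp: hpsh_def)
qed

text \<open>The arrow \<open>s\<close> is specified by its components and not built as a tuple.
  Going under a binder or extending a substitution is then verified projection by
  projection.\<close>

definition sub_sem :: "('b, 'o) ctx \<Rightarrow> (nat \<Rightarrow> ('b, 'o) val) \<Rightarrow> ('b, 'o) ctx \<Rightarrow> 'm \<Rightarrow> bool" where
  "sub_sem \<Gamma> \<sigma> \<Delta> s \<longleftrightarrow> s \<in> hom \<M> \<lbrakk>\<Gamma>\<rbrakk>\<^sub>x \<lbrakk>\<Delta>\<rbrakk>\<^sub>x
    \<and> (\<forall>i < length \<Delta>. vsem \<M> \<Gamma> (\<sigma> i) (\<Delta> ! i) = Some (lproj \<M> (map (tysem \<M>) \<Delta>) i \<cdot> s))"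

text \<open>The operation \<open>F\<close> on clauses is left abstract so that both renaming and
  substitution are instances. The arrow \<open>s\<close> is lifted twice because a clause binds an
  argument and a continuation.\<close>

lemma hsem_fmmap:
  assumes h: "hsem \<M> \<Delta> H \<Sigma> (Eff B T') = Some h" and s: "s \<in> hom \<M> \<lbrakk>\<Gamma>\<rbrakk>\<^sub>x \<lbrakk>\<Delta>\<rbrakk>\<^sub>x"
    and F: "\<And>op A' B' M g. fmlookup \<Sigma> op = Some (A', B') \<Longrightarrow> fmlookup H op = Some M
      \<Longrightarrow> csem \<M> (Fun (emb B') (Eff B T') # emb A' # \<Delta>) M (Eff B T') = Some g
      \<Longrightarrow> csem \<M> (Fun (emb B') (Eff B T') # emb A' # \<Gamma>) (F M) (Eff B T') = Some
        (g \<cdot> lift (\<lbrakk>\<Gamma>\<rbrakk>\<^sub>x \<otimes> \<lbrakk>emb A'\<rbrakk>) \<lbrakk>Fun (emb B') (Eff B T')\<rbrakk> (lift \<lbrakk>\<Gamma>\<rbrakk>\<^sub>x \<lbrakk>emb A'\<rbrakk> s))"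
  shows "hsem \<M> \<Gamma> (fmmap F H) \<Sigma> (Eff B T') = Some (h \<cdot> s)"
proof -
  obtain g where dom: "fmdom H = fmdom \<Sigma>"
    and g: "\<And>op A' B' M. fmlookup \<Sigma> op = Some (A', B') \<Longrightarrow> fmlookup H op = Some M
        \<Longrightarrow> csem \<M> (Fun (emb B') (Eff B T') # emb A' # \<Delta>) M (Eff B T') = Some (g op)"
    and h: "h = ltup \<M> \<lbrakk>\<Delta>\<rbrakk>\<^sub>x (map (\<lambda>op. clsem T' \<Sigma> \<lbrakk>\<Delta>\<rbrakk>\<^sub>x \<lbrakk>B\<rbrakk> op (g op)) (ops \<Sigma>))"
    using h unfolding hsem_iff by blast
  \<comment> \<open>The types of the two bound variables vary with the operation, so the lifted
    arrow is computed from its entry in the signature.\<close>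
  define g' where "g' = (\<lambda>op. let (A', B') = the (fmlookup \<Sigma> op)
    in g op \<cdot> lift (\<lbrakk>\<Gamma>\<rbrakk>\<^sub>x \<otimes> \<lbrakk>emb A'\<rbrakk>) \<lbrakk>Fun (emb B') (Eff B T')\<rbrakk> (lift \<lbrakk>\<Gamma>\<rbrakk>\<^sub>x \<lbrakk>emb A'\<rbrakk> s))"
  have cl: "clsem T' \<Sigma> \<lbrakk>\<Delta>\<rbrakk>\<^sub>x \<lbrakk>B\<rbrakk> op (g op) \<in> hom \<M> \<lbrakk>\<Delta>\<rbrakk>\<^sub>x (hfac \<M> T' \<Sigma> \<lbrakk>B\<rbrakk> op)
      \<and> clsem T' \<Sigma> \<lbrakk>\<Delta>\<rbrakk>\<^sub>x \<lbrakk>B\<rbrakk> op (g op) \<cdot> s = clsem T' \<Sigma> \<lbrakk>\<Gamma>\<rbrakk>\<^sub>x \<lbrakk>B\<rbrakk> op (g' op)"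
    if op: "op \<in> set (ops \<Sigma>)" for op
  proof -
    have "op |\<in>| fmdom \<Sigma>" "op |\<in>| fmdom H" using op by (simp_all add: set_ops dom)
    then obtain A' B' M where l: "fmlookup \<Sigma> op = Some (A', B')" "fmlookup H op = Some M"
      by (metis fmdomE surj_pair)
    show ?thesis
      using clsem_hom[OF l(1)] clsem_cmp[OF l(1)] sem_hom(2)[OF g[OF l]] s l(1)
      by (simp add: g'_def)
  qed
  have "h \<cdot> s = ltup \<M> \<lbrakk>\<Gamma>\<rbrakk>\<^sub>x (map (\<lambda>op. clsem T' \<Sigma> \<lbrakk>\<Gamma>\<rbrakk>\<^sub>x \<lbrakk>B\<rbrakk> op (g' op)) (ops \<Sigma>))"
    unfolding h using cl by (subst ltup_cmp[OF s]) (auto simp: comp_def intro!: arg_cong[where f = "ltup \<M> \<lbrakk>\<Gamma>\<rbrakk>\<^sub>x"])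
  moreover have "csem \<M> (Fun (emb B') (Eff B T') # emb A' # \<Gamma>) M (Eff B T') = Some (g' op)"
    if \<Sigma>: "fmlookup \<Sigma> op = Some (A', B')" and FH: "fmlookup (fmmap F H) op = Some M" for op A' B' M
  proof -
    obtain L where L: "fmlookup H op = Some L" "M = F L" using FH by auto
    show ?thesis using F[OF \<Sigma> L(1) g[OF \<Sigma> L(1)]] \<Sigma> L(2) by (simp add: g'_def)
  qed
  ultimately show ?thesis unfolding hsem_iff using dom by auto
qed

text \<open>
  Substitution is sound for every class \<open>R\<close> of substitutions that is closed under going below
  a binder. The renamings form such a class; once renaming is known to be sound, so do all substitutions.
\<close>

lemma sem_subst_closed:
  assumes R_sem: "\<And>\<Gamma> \<sigma> \<Delta> s. R \<Gamma> \<sigma> \<Delta> s \<Longrightarrow> sub_sem \<Gamma> \<sigma> \<Delta> s"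
    and R_lift: "\<And>\<Gamma> \<sigma> \<Delta> s A. R \<Gamma> \<sigma> \<Delta> s \<Longrightarrow> R (A # \<Gamma>) (slift \<sigma>) (A # \<Delta>) (lift \<lbrakk>\<Gamma>\<rbrakk>\<^sub>x \<lbrakk>A\<rbrakk> s)"
  shows "vsem \<M> \<Delta> V A = Some f \<Longrightarrow> R \<Gamma> \<sigma> \<Delta> s \<Longrightarrow> vsem \<M> \<Gamma> (vsubst \<sigma> V) A = Some (f \<cdot> s)"
    and "csem \<M> \<Delta> M (Eff B T) = Some f \<Longrightarrow> R \<Gamma> \<sigma> \<Delta> s
      \<Longrightarrow> csem \<M> \<Gamma> (csubst \<sigma> M) (Eff B T) = Some (f \<cdot> s)"
proof (induction V and M arbitrary: \<Gamma> \<Delta> \<sigma> s A f and \<Gamma> \<Delta> \<sigma> s B T f rule: val.induct comp.induct)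
  case (Var i)
  then show ?case using R_sem[OF Var(2)] by (auto simp: vsem_Var_iff sub_sem_def)
next
  case (Tup Vs)
  have s: "s \<in> hom \<M> \<lbrakk>\<Gamma>\<rbrakk>\<^sub>x \<lbrakk>\<Delta>\<rbrakk>\<^sub>x" using R_sem[OF Tup(3)] by (simp add: sub_sem_def)
  obtain As fs where *: "A = Prod As" "length Vs = length As" "length fs = length As"
    "\<forall>i < length As. vsem \<M> \<Delta> (Vs ! i) (As ! i) = Some (fs ! i)" "f = ltup \<M> \<lbrakk>\<Delta>\<rbrakk>\<^sub>x fs"
    using Tup(2) unfolding vsem_Tup_iff by blast
  have "\<exists>X. g \<in> hom \<M> \<lbrakk>\<Delta>\<rbrakk>\<^sub>x X" if "g \<in> set fs" for g
    using that * sem_hom(1) by (metis in_set_conv_nth)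
  then have "f \<cdot> s = ltup \<M> \<lbrakk>\<Gamma>\<rbrakk>\<^sub>x (map (\<lambda>g. g \<cdot> s) fs)"
    unfolding *(5) by (rule ltup_cmp[OF s])
  moreover have "vsem \<M> \<Gamma> (vsubst \<sigma> (Vs ! i)) (As ! i) = Some (fs ! i \<cdot> s)" if "i < length As" for i
    using Tup.IH[OF _ _ Tup(3), of "Vs ! i"] * that by simp
  ultimately show ?case using * by (auto simp: vsem_Tup_iff intro!: exI[of _ "map (\<lambda>g. g \<cdot> s) fs"])
next
  case (Proj As i V)
  have s: "s \<in> hom \<M> \<lbrakk>\<Gamma>\<rbrakk>\<^sub>x \<lbrakk>\<Delta>\<rbrakk>\<^sub>x" using R_sem[OF Proj(3)] by (simp add: sub_sem_def)
  obtain g where *: "i < length As" "A = As ! i" "vsem \<M> \<Delta> V (Prod As) = Some g"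
      "f = lproj \<M> (map (tysem \<M>) As) i \<cdot> g"
    using Proj(2) unfolding vsem_Proj_iff by blast
  have "f \<cdot> s = lproj \<M> (map (tysem \<M>) As) i \<cdot> g \<cdot> s"
    using cmp_assoc[OF s] sem_hom(1)[OF *(3)] lproj_hom[of i "map (tysem \<M>) As"] * by simp
  then show ?case using Proj.IH[OF *(3) Proj(3)] * by (simp add: vsem_Proj_iff)
next
  case (Inj i V)
  have s: "s \<in> hom \<M> \<lbrakk>\<Gamma>\<rbrakk>\<^sub>x \<lbrakk>\<Delta>\<rbrakk>\<^sub>x" using R_sem[OF Inj(3)] by (simp add: sub_sem_def)
  obtain As g where *: "A = Sum As" "i < length As" "vsem \<M> \<Delta> V (As ! i) = Some g"
      "f = kinj (cops \<M>) (map (tysem \<M>) As) i \<cdot> g"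
    using Inj(2) unfolding vsem_Inj_iff by blast
  have "f \<cdot> s = kinj (cops \<M>) (map (tysem \<M>) As) i \<cdot> g \<cdot> s"
    using cmp_assoc[OF s] sem_hom(1)[OF *(3)] kinj_hom[of i "map (tysem \<M>) As"] * by simp
  then show ?case using Inj.IH[OF *(3) Inj(3)] * by (simp add: vsem_Inj_iff)
next
  case (Lam M)
  have s: "s \<in> hom \<M> \<lbrakk>\<Gamma>\<rbrakk>\<^sub>x \<lbrakk>\<Delta>\<rbrakk>\<^sub>x" using R_sem[OF Lam(3)] by (simp add: sub_sem_def)
  obtain A' B T g where *: "A = Fun A' (Eff B T)" "csem \<M> (A' # \<Delta>) M (Eff B T) = Some g"
      "f = cur (mon \<M> T) \<lbrakk>\<Delta>\<rbrakk>\<^sub>x \<lbrakk>A'\<rbrakk> \<lbrakk>B\<rbrakk> g"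
    using Lam(2) unfolding vsem_Lam_iff by blast
  then show ?case
    using Lam.IH[OF *(2) R_lift[OF Lam(3)]] cur_cmp[OF _ s] sem_hom(2)[OF *(2)] by (simp add: vsem_Lam_iff)
next
  case (Ret V)
  have s: "s \<in> hom \<M> \<lbrakk>\<Gamma>\<rbrakk>\<^sub>x \<lbrakk>\<Delta>\<rbrakk>\<^sub>x" using R_sem[OF Ret(3)] by (simp add: sub_sem_def)
  obtain g where *: "vsem \<M> \<Delta> V B = Some g" "f = unit (mon \<M> T) \<lbrakk>B\<rbrakk> \<cdot> g"
    using Ret(2) unfolding csem_Ret_iff by blast
  then show ?case using Ret.IH[OF *(1) Ret(3)] cmp_assoc[OF s sem_hom(1)[OF *(1)] unit_hom]
    by (simp add: csem_Ret_iff)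
next
  case (Let A M N)
  have s: "s \<in> hom \<M> \<lbrakk>\<Gamma>\<rbrakk>\<^sub>x \<lbrakk>\<Delta>\<rbrakk>\<^sub>x" using R_sem[OF Let(4)] by (simp add: sub_sem_def)
  obtain g h where *: "csem \<M> \<Delta> M (Eff A T) = Some g" "csem \<M> (A # \<Delta>) N (Eff B T) = Some h"
      "f = mult (mon \<M> T) \<lbrakk>B\<rbrakk> \<cdot> tmap T \<lbrakk>\<Delta>\<rbrakk>\<^sub>x \<lbrakk>A\<rbrakk> g h"
    using Let(3) unfolding csem_Let_iff by blast
  show ?case
    using Let.IH(1)[OF *(1) Let(4)] Let.IH(2)[OF *(2) R_lift[OF Let(4)]] *(3)
      bind_cmp[OF sem_hom(2)[OF *(1)] _ s, of h "\<lbrakk>B\<rbrakk>"] sem_hom(2)[OF *(2)]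
    by (simp add: csem_Let_iff)
next
  case (App A V W)
  have s: "s \<in> hom \<M> \<lbrakk>\<Gamma>\<rbrakk>\<^sub>x \<lbrakk>\<Delta>\<rbrakk>\<^sub>x" using R_sem[OF App(4)] by (simp add: sub_sem_def)
  obtain g h where *: "vsem \<M> \<Delta> V (Fun A (Eff B T)) = Some g" "vsem \<M> \<Delta> W A = Some h"
      "f = ev (mon \<M> T) \<lbrakk>A\<rbrakk> \<lbrakk>B\<rbrakk> \<cdot> \<langle>g, h\<rangle>" using App(3) unfolding csem_App_iff by blast
  have gh: "g \<in> hom \<M> \<lbrakk>\<Delta>\<rbrakk>\<^sub>x (kexp (mon \<M> T) \<lbrakk>A\<rbrakk> \<lbrakk>B\<rbrakk>)" "h \<in> hom \<M> \<lbrakk>\<Delta>\<rbrakk>\<^sub>x \<lbrakk>A\<rbrakk>"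
    using sem_hom(1)[OF *(1)] sem_hom(1)[OF *(2)] by simp_all
  show ?case
    using App.IH(1)[OF *(1) App(4)] App.IH(2)[OF *(2) App(4)] *(3)
      cmp_assoc[OF s pair_hom[OF gh] ev_hom] pair_cmp[OF gh s]
    by (simp add: csem_App_iff)
next
  case (Op op V)
  have s: "s \<in> hom \<M> \<lbrakk>\<Gamma>\<rbrakk>\<^sub>x \<lbrakk>\<Delta>\<rbrakk>\<^sub>x" using R_sem[OF Op(3)] by (simp add: sub_sem_def)
  obtain A' B' g where *: "fmlookup (sig T) op = Some (A', B')" "B = emb B'"
      "vsem \<M> \<Delta> V (emb A') = Some g" "f = opm \<M> T op \<cdot> g" using Op(2) unfolding csem_Op_iff by blast
  show ?case
    using Op.IH[OF *(3) Op(3)] *(1,2,4) cmp_assoc[OF s sem_hom(1)[OF *(3)] opm_hom[OF *(1)]]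
    by (simp add: csem_Op_iff)
next
  case (Handle D M H N)
  have s: "s \<in> hom \<M> \<lbrakk>\<Gamma>\<rbrakk>\<^sub>x \<lbrakk>\<Delta>\<rbrakk>\<^sub>x" using R_sem[OF Handle(5)] by (simp add: sub_sem_def)
  obtain A T' h g n where *: "D = Eff A T'" "hsem \<M> \<Delta> H (sig T') (Eff B T) = Some h"
      "csem \<M> \<Delta> M (Eff A T') = Some g" "csem \<M> (A # \<Delta>) N (Eff B T) = Some n"
      "h \<in> hpsh \<M> T' T \<lbrakk>B\<rbrakk> \<lbrakk>\<Delta>\<rbrakk>\<^sub>x" "f = hdl \<M> T' T \<lbrakk>B\<rbrakk> \<lbrakk>\<Delta>\<rbrakk>\<^sub>x h (tmap T' \<lbrakk>\<Delta>\<rbrakk>\<^sub>x \<lbrakk>A\<rbrakk> g n)"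
    using Handle(4) unfolding csem_Handle_iff by blast
  note g = sem_hom(2)[OF *(3)]
  have n: "n \<in> hom \<M> (\<lbrakk>\<Delta>\<rbrakk>\<^sub>x \<otimes> \<lbrakk>A\<rbrakk>) (TOb (mon \<M> T) \<lbrakk>B\<rbrakk>)" using sem_hom(2)[OF *(4)] by simp
  have "hsem \<M> \<Gamma> (fmmap (csubst (slift (slift \<sigma>))) H) (sig T') (Eff B T) = Some (h \<cdot> s)"
  proof (rule hsem_fmmap[OF *(2) s])
    fix op A' B' L l
    assume L: "fmlookup H op = Some L" "csem \<M> (Fun (emb B') (Eff B T) # emb A' # \<Delta>) L (Eff B T) = Some l"
    show "csem \<M> (Fun (emb B') (Eff B T) # emb A' # \<Gamma>) (csubst (slift (slift \<sigma>)) L) (Eff B T) = Some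
        (l \<cdot> lift (\<lbrakk>\<Gamma>\<rbrakk>\<^sub>x \<otimes> \<lbrakk>emb A'\<rbrakk>) \<lbrakk>Fun (emb B') (Eff B T)\<rbrakk> (lift \<lbrakk>\<Gamma>\<rbrakk>\<^sub>x \<lbrakk>emb A'\<rbrakk> s))"
      using Handle.IH(2)[OF fmran'I[OF L(1)] L(2) R_lift[OF R_lift[OF Handle(5)]]] by simp
  qed
  \<comment> \<open>The handler precomposed with \<open>s\<close> is still in \<open>hpsh\<close>,
    so the substituted term is defined; \<open>hdl_nat\<close> and \<open>tmap_cmp\<close> then
    identify its denotation.\<close>
  then show ?case
    using Handle.IH(1)[OF *(3) Handle(5)] Handle.IH(3)[OF *(4) R_lift[OF Handle(5)]] *(1)
      hpsh_cmp[OF *(5) s] hdl_nat[OF *(5) tmap_hom[OF g n] s] tmap_cmp[OF g n s] *(6)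
    by (simp add: csem_Handle_iff)
next
  case (Case As V Ms)
  have s: "s \<in> hom \<M> \<lbrakk>\<Gamma>\<rbrakk>\<^sub>x \<lbrakk>\<Delta>\<rbrakk>\<^sub>x" using R_sem[OF Case(4)] by (simp add: sub_sem_def)
  obtain v fs where *: "length Ms = length As" "vsem \<M> \<Delta> V (Sum As) = Some v" "length fs = length As"
      "\<forall>i < length As. csem \<M> (As ! i # \<Delta>) (Ms ! i) (Eff B T) = Some (fs ! i)"
      "f = copair (cops \<M>) T \<lbrakk>\<Delta>\<rbrakk>\<^sub>x (map (tysem \<M>) As) \<lbrakk>B\<rbrakk> fs \<cdot> \<langle>ide \<M> \<lbrakk>\<Delta>\<rbrakk>\<^sub>x, v\<rangle>"
    using Case(3) unfolding csem_Case_iff by blast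
  let ?gs = "map (\<lambda>i. fs ! i \<cdot> lift \<lbrakk>\<Gamma>\<rbrakk>\<^sub>x \<lbrakk>As ! i\<rbrakk> s) [0..<length As]"
  have fs: "fs ! i \<in> hom \<M> (\<lbrakk>\<Delta>\<rbrakk>\<^sub>x \<otimes> \<lbrakk>As ! i\<rbrakk>) (TOb (mon \<M> T) \<lbrakk>B\<rbrakk>)" if "i < length As" for i
    using sem_hom(2)[of "As ! i # \<Delta>" "Ms ! i" B T "fs ! i"] * that by simp
  have "csem \<M> (As ! i # \<Gamma>) (csubst (slift \<sigma>) (Ms ! i)) (Eff B T) = Some (?gs ! i)" if "i < length As" for i
    using Case.IH(2)[OF _ _ R_lift[OF Case(4)], of "Ms ! i" "As ! i" B T "fs ! i"] * that by simp
  moreover have "f \<cdot> s = copair (cops \<M>) T \<lbrakk>\<Gamma>\<rbrakk>\<^sub>x (map (tysem \<M>) As) \<lbrakk>B\<rbrakk> ?gs \<cdot> \<langle>ide \<M> \<lbrakk>\<Gamma>\<rbrakk>\<^sub>x, v \<cdot> s\<rangle>"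
    unfolding *(5) using * fs sem_hom(1)[OF *(2)] s by (intro case_cmp) auto
  ultimately show ?case
    using Case.IH(1)[OF *(2) Case(4)] *(1)
    by (auto simp: csem_Case_iff intro!: exI[of _ ?gs])
qed

end

section \<open>Renamings as substitutions of variables\<close>

lemma slift_Var_comp: "slift (Var \<circ> r) = Var \<circ> rlift r"
  by (auto simp: fun_eq_iff slift_def rlift_def split: nat.split)

text \<open>With this, soundness of renaming becomes an instance of the induction already carried
  out for substitutions.\<close>

lemma ren_as_subst:
  fixes V :: "('b, 'o) val" and M :: "('b, 'o) comp"
  shows "vren r V = vsubst (Var \<circ> r) V" and "cren r M = csubst (Var \<circ> r) M"
  by (induction V and M arbitrary: r and r rule: val.induct comp.induct)
    (auto simp: slift_Var_comp intro: fmap.map_cong0)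

lemma embv_gvren: "embv (gvren r V) = vren r (embv V)"
  by (induction V) auto

context cartesian_category
begin

lemma ex_ltup:
  assumes "\<And>i. i < length Xs \<Longrightarrow> F i \<in> hom C Z (Xs ! i)"
  obtains s where "s \<in> hom C Z (lprod C Xs)" "\<And>i. i < length Xs \<Longrightarrow> lproj C Xs i \<cdot> s = F i"
proof
  show "ltup C Z (map F [0..<length Xs]) \<in> hom C Z (lprod C Xs)"
    using assms by (intro ltup_hom) auto
  show "lproj C Xs i \<cdot> ltup C Z (map F [0..<length Xs]) = F i" if "i < length Xs" for i
    using assms that by (subst lproj_ltup) auto
qed

end

context eff_model
begin

text \<open>The condition speaks of indices and projections only. Closure under binders can
  therefore be checked before weakening of values is known to be sound.\<close>

definition ren_sem :: "('b, 'o) ctx \<Rightarrow> (nat \<Rightarrow> nat) \<Rightarrow> ('b, 'o) ctx \<Rightarrow> 'm \<Rightarrow> bool" where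
  "ren_sem \<Gamma> r \<Delta> s \<longleftrightarrow> s \<in> hom \<M> \<lbrakk>\<Gamma>\<rbrakk>\<^sub>x \<lbrakk>\<Delta>\<rbrakk>\<^sub>x
    \<and> (\<forall>i < length \<Delta>. r i < length \<Gamma> \<and> \<Gamma> ! r i = \<Delta> ! i
        \<and> lproj \<M> (map (tysem \<M>) \<Gamma>) (r i) = lproj \<M> (map (tysem \<M>) \<Delta>) i \<cdot> s)"

lemma lproj_ctx_hom: "i < length \<Gamma> \<Longrightarrow> lproj \<M> (map (tysem \<M>) \<Gamma>) i \<in> hom \<M> \<lbrakk>\<Gamma>\<rbrakk>\<^sub>x \<lbrakk>\<Gamma> ! i\<rbrakk>"
  using lproj_hom[of i "map (tysem \<M>) \<Gamma>"] by simp

lemma lproj_Suc_lift: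
  assumes s: "s \<in> hom \<M> \<lbrakk>\<Gamma>\<rbrakk>\<^sub>x \<lbrakk>\<Delta>\<rbrakk>\<^sub>x" and i: "i < length \<Delta>"
  shows "lproj \<M> (map (tysem \<M>) (A # \<Delta>)) (Suc i) \<cdot> lift \<lbrakk>\<Gamma>\<rbrakk>\<^sub>x \<lbrakk>A\<rbrakk> s
    = (lproj \<M> (map (tysem \<M>) \<Delta>) i \<cdot> s) \<cdot> p1 \<M> \<lbrakk>\<Gamma>\<rbrakk>\<^sub>x \<lbrakk>A\<rbrakk>"
  using cmp_assoc[OF lift_hom[OF s] p1_hom lproj_ctx_hom[OF i], of "\<lbrakk>A\<rbrakk>"]
    p1_pair[OF cmp_hom[OF p1_hom s] p2_hom] cmp_assoc[OF p1_hom s lproj_ctx_hom[OF i]]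
  by simp

lemma lproj_0_lift:
  assumes s: "s \<in> hom \<M> \<lbrakk>\<Gamma>\<rbrakk>\<^sub>x \<lbrakk>\<Delta>\<rbrakk>\<^sub>x"
  shows "lproj \<M> (map (tysem \<M>) (A # \<Delta>)) 0 \<cdot> lift \<lbrakk>\<Gamma>\<rbrakk>\<^sub>x \<lbrakk>A\<rbrakk> s = p2 \<M> \<lbrakk>\<Gamma>\<rbrakk>\<^sub>x \<lbrakk>A\<rbrakk>"
  using p2_pair[OF cmp_hom[OF p1_hom s] p2_hom] by simp

lemma ren_sem_lift:
  assumes "ren_sem \<Gamma> r \<Delta> s"
  shows "ren_sem (A # \<Gamma>) (rlift r) (A # \<Delta>) (lift \<lbrakk>\<Gamma>\<rbrakk>\<^sub>x \<lbrakk>A\<rbrakk> s)"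
proof -
  have s: "s \<in> hom \<M> \<lbrakk>\<Gamma>\<rbrakk>\<^sub>x \<lbrakk>\<Delta>\<rbrakk>\<^sub>x" using assms by (simp add: ren_sem_def)
  have "rlift r i < length (A # \<Gamma>) \<and> (A # \<Gamma>) ! rlift r i = (A # \<Delta>) ! i
      \<and> lproj \<M> (map (tysem \<M>) (A # \<Gamma>)) (rlift r i)
        = lproj \<M> (map (tysem \<M>) (A # \<Delta>)) i \<cdot> lift \<lbrakk>\<Gamma>\<rbrakk>\<^sub>x \<lbrakk>A\<rbrakk> s" if "i < length (A # \<Delta>)" for i
  proof (cases i)
    case 0
    then show ?thesis using lproj_0_lift[OF s, of A] by (simp add: rlift_def)
  next
    case (Suc j)
    then have j: "j < length \<Delta>" using that by simp
    show ?thesis unfolding Suc lproj_Suc_lift[OF s j] using assms j by (simp add: rlift_def ren_sem_def)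
  qed
  then show ?thesis unfolding ren_sem_def using lift_hom[OF s] by simp
qed

lemma ren_sem_Suc: "ren_sem (A # \<Gamma>) Suc \<Gamma> (p1 \<M> \<lbrakk>\<Gamma>\<rbrakk>\<^sub>x \<lbrakk>A\<rbrakk>)"
  by (simp add: ren_sem_def p1_hom)

lemma ren_sem_sub_sem: "ren_sem \<Gamma> r \<Delta> s \<Longrightarrow> sub_sem \<Gamma> (Var \<circ> r) \<Delta> s"
  by (simp add: ren_sem_def sub_sem_def vsem_Var_iff)

lemma sem_ren:
  assumes "ren_sem \<Gamma> r \<Delta> s"
  shows "vsem \<M> \<Delta> V A = Some f \<Longrightarrow> vsem \<M> \<Gamma> (vren r V) A = Some (f \<cdot> s)"
    and "csem \<M> \<Delta> M (Eff B T) = Some g \<Longrightarrow> csem \<M> \<Gamma> (cren r M) (Eff B T) = Some (g \<cdot> s)"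
proof -
  \<comment> \<open>Closed classes consist of substitutions, so a renaming enters through its
    composite with \<open>Var\<close>.\<close>
  define R where "R = (\<lambda>\<Gamma> (\<sigma> :: nat \<Rightarrow> ('b, 'o) val) \<Delta> s. \<exists>r. \<sigma> = Var \<circ> r \<and> ren_sem \<Gamma> r \<Delta> s)"
  have R: "R \<Gamma> (Var \<circ> r) \<Delta> s" using assms by (auto simp: R_def)
  have sem: "sub_sem \<Gamma> \<sigma> \<Delta> s" if "R \<Gamma> \<sigma> \<Delta> s" for \<Gamma> \<sigma> \<Delta> s
    using that ren_sem_sub_sem by (auto simp: R_def)
  have R_lift: "R (A # \<Gamma>) (slift \<sigma>) (A # \<Delta>) (lift \<lbrakk>\<Gamma>\<rbrakk>\<^sub>x \<lbrakk>A\<rbrakk> s)" if "R \<Gamma> \<sigma> \<Delta> s" for \<Gamma> \<sigma> \<Delta> s A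
    using that ren_sem_lift slift_Var_comp unfolding R_def by blast
  show "vsem \<M> \<Delta> V A = Some f \<Longrightarrow> vsem \<M> \<Gamma> (vren r V) A = Some (f \<cdot> s)"
    unfolding ren_as_subst by (rule sem_subst_closed(1)[of R, OF sem R_lift _ R])
  show "csem \<M> \<Delta> M (Eff B T) = Some g \<Longrightarrow> csem \<M> \<Gamma> (cren r M) (Eff B T) = Some (g \<cdot> s)"
    unfolding ren_as_subst by (rule sem_subst_closed(2)[of R, OF sem R_lift _ R])
qed

lemma hsem_hren:
  assumes r: "ren_sem \<Gamma> r \<Delta> s" and H: "hsem \<M> \<Delta> H \<Sigma> (Eff B T) = Some h"
  shows "hsem \<M> \<Gamma> (hren r H) \<Sigma> (Eff B T) = Some (h \<cdot> s)"
  unfolding hren_def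
proof (rule hsem_fmmap[OF H])
  show "s \<in> hom \<M> \<lbrakk>\<Gamma>\<rbrakk>\<^sub>x \<lbrakk>\<Delta>\<rbrakk>\<^sub>x" using r by (simp add: ren_sem_def)
qed (use sem_ren(2)[OF ren_sem_lift[OF ren_sem_lift[OF r]]] in simp)

text \<open>Lifting a substitution weakens its values, and weakening denotes precomposition with the
  first projection. This is where soundness of renaming enters soundness of substitution.\<close>

lemma sub_sem_lift:
  assumes "sub_sem \<Gamma> \<sigma> \<Delta> s"
  shows "sub_sem (A # \<Gamma>) (slift \<sigma>) (A # \<Delta>) (lift \<lbrakk>\<Gamma>\<rbrakk>\<^sub>x \<lbrakk>A\<rbrakk> s)"
proof -
  have s: "s \<in> hom \<M> \<lbrakk>\<Gamma>\<rbrakk>\<^sub>x \<lbrakk>\<Delta>\<rbrakk>\<^sub>x" using assms by (simp add: sub_sem_def)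
  have "vsem \<M> (A # \<Gamma>) (slift \<sigma> i) ((A # \<Delta>) ! i)
      = Some (lproj \<M> (map (tysem \<M>) (A # \<Delta>)) i \<cdot> lift \<lbrakk>\<Gamma>\<rbrakk>\<^sub>x \<lbrakk>A\<rbrakk> s)" if "i < length (A # \<Delta>)" for i
  proof (cases i)
    case 0
    then show ?thesis using lproj_0_lift[OF s, of A] by (simp add: slift_def vsem_Var_iff)
  next
    case (Suc j)
    then have j: "j < length \<Delta>" using that by simp
    show ?thesis unfolding Suc lproj_Suc_lift[OF s j]
      using assms j by (auto simp: slift_def sub_sem_def intro!: sem_ren(1)[OF ren_sem_Suc])
  qed
  then show ?thesis unfolding sub_sem_def using lift_hom[OF s] by simp
qed

lemma sem_subst:
  assumes "sub_sem \<Gamma> \<sigma> \<Delta> s"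
  shows "vsem \<M> \<Delta> V A = Some f \<Longrightarrow> vsem \<M> \<Gamma> (vsubst \<sigma> V) A = Some (f \<cdot> s)"
    and "csem \<M> \<Delta> M (Eff B T) = Some g \<Longrightarrow> csem \<M> \<Gamma> (csubst \<sigma> M) (Eff B T) = Some (g \<cdot> s)"
  using sem_subst_closed[of sub_sem] assms sub_sem_lift by blast+

text \<open>Weakening past a whole block of variables has a denotation by the universal property of
  the context product, without an explicit composite of projections.\<close>

lemma ex_ren_sem:
  assumes "\<And>i. i < length \<Delta> \<Longrightarrow> r i < length \<Gamma> \<and> \<Gamma> ! r i = \<Delta> ! i"
  obtains s where "ren_sem \<Gamma> r \<Delta> s"
proof -
  have "lproj \<M> (map (tysem \<M>) \<Gamma>) (r i) \<in> hom \<M> \<lbrakk>\<Gamma>\<rbrakk>\<^sub>x (map (tysem \<M>) \<Delta> ! i)"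
    if "i < length (map (tysem \<M>) \<Delta>)" for i
    using assms[of i] that lproj_ctx_hom[of "r i" \<Gamma>] by simp
  from ex_ltup[OF this] obtain s where "s \<in> hom \<M> \<lbrakk>\<Gamma>\<rbrakk>\<^sub>x \<lbrakk>\<Delta>\<rbrakk>\<^sub>x"
    "\<And>i. i < length \<Delta> \<Longrightarrow> lproj \<M> (map (tysem \<M>) \<Delta>) i \<cdot> s = lproj \<M> (map (tysem \<M>) \<Gamma>) (r i)"
    by (metis length_map)
  then show thesis using assms by (intro that[of s]) (simp add: ren_sem_def)
qed

lemma ex_sub_sem:
  assumes "\<And>i. i < length \<Delta> \<Longrightarrow> \<exists>f. vsem \<M> \<Gamma> (\<sigma> i) (\<Delta> ! i) = Some f"
  obtains s where "sub_sem \<Gamma> \<sigma> \<Delta> s"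
proof -
  obtain F where F: "\<And>i. i < length \<Delta> \<Longrightarrow> vsem \<M> \<Gamma> (\<sigma> i) (\<Delta> ! i) = Some (F i)"
    using assms by metis
  have "F i \<in> hom \<M> \<lbrakk>\<Gamma>\<rbrakk>\<^sub>x (map (tysem \<M>) \<Delta> ! i)" if "i < length (map (tysem \<M>) \<Delta>)" for i
    using sem_hom(1)[OF F] that by simp
  from ex_ltup[OF this] obtain s where "s \<in> hom \<M> \<lbrakk>\<Gamma>\<rbrakk>\<^sub>x \<lbrakk>\<Delta>\<rbrakk>\<^sub>x"
    "\<And>i. i < length \<Delta> \<Longrightarrow> lproj \<M> (map (tysem \<M>) \<Delta>) i \<cdot> s = F i"
    by (metis length_map)
  then show thesis using F by (intro that[of s]) (simp add: sub_sem_def)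
qed

section \<open>Substitution for the most recent variables\<close>

lemma sub_sem_Var: "sub_sem \<Gamma> Var \<Gamma> (ide \<M> \<lbrakk>\<Gamma>\<rbrakk>\<^sub>x)"
  using ide_right[OF lproj_ctx_hom] by (simp add: sub_sem_def ide_hom vsem_Var_iff)

lemma sub_sem_Cons:
  assumes \<sigma>: "sub_sem \<Gamma> \<sigma> \<Delta> s" and V: "vsem \<M> \<Gamma> V A = Some f"
  shows "sub_sem \<Gamma> (case_nat V \<sigma>) (A # \<Delta>) \<langle>s, f\<rangle>"
proof -
  have s: "s \<in> hom \<M> \<lbrakk>\<Gamma>\<rbrakk>\<^sub>x \<lbrakk>\<Delta>\<rbrakk>\<^sub>x" using \<sigma> by (simp add: sub_sem_def)
  have "vsem \<M> \<Gamma> (case_nat V \<sigma> i) ((A # \<Delta>) ! i)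
      = Some (lproj \<M> (map (tysem \<M>) (A # \<Delta>)) i \<cdot> \<langle>s, f\<rangle>)" if "i < length (A # \<Delta>)" for i
  proof (cases i)
    case 0
    then show ?thesis using V p2_pair[OF s sem_hom(1)[OF V]] by simp
  next
    case (Suc j)
    then have j: "j < length \<Delta>" using that by simp
    show ?thesis
      using \<sigma> j Suc p1_pair[OF s sem_hom(1)[OF V]]
        cmp_assoc[OF pair_hom[OF s sem_hom(1)[OF V]] p1_hom lproj_ctx_hom[OF j]]
      by (simp add: sub_sem_def)
  qed
  then show ?thesis unfolding sub_sem_def using pair_hom[OF s sem_hom(1)[OF V]] by simp
qed

lemma sub_sem_sub1: "vsem \<M> \<Gamma> V A = Some f \<Longrightarrow> sub_sem \<Gamma> (sub1 V) (A # \<Gamma>) \<langle>ide \<M> \<lbrakk>\<Gamma>\<rbrakk>\<^sub>x, f\<rangle>"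
  unfolding sub1_def by (rule sub_sem_Cons[OF sub_sem_Var])

lemma sub_sem_sub2:
  "vsem \<M> \<Gamma> V A = Some f \<Longrightarrow> vsem \<M> \<Gamma> K B = Some k
    \<Longrightarrow> sub_sem \<Gamma> (sub2 V K) (B # A # \<Gamma>) \<langle>\<langle>ide \<M> \<lbrakk>\<Gamma>\<rbrakk>\<^sub>x, f\<rangle>, k\<rangle>"
  unfolding sub2_def by (rule sub_sem_Cons[OF sub_sem_Cons[OF sub_sem_Var]])

text \<open>The model validates the axioms through \<open>gcsem\<close>. This carries them over to
  the interpretation of the calculus, where instances of axioms are formed.\<close>

lemma gcsem_embc:
  "gctyp (sig T) \<Delta> M A
    \<Longrightarrow> csem \<M> (map emb \<Delta>) (embc (sig T) M) (Eff (emb A) T) = Some (gcsem \<M> T \<Delta> M A)"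
proof (induction rule: gctyp.induct)
  case (GRet \<Delta> V A)
  then show ?case by (simp add: csem_Ret_iff gvsem_embv)
next
  case (GLet op A' B' \<Delta> V M A)
  then show ?case by (simp add: csem_Let_iff csem_Op_iff gvsem_embv tmap_def comp_def)
next
  case (GCase \<Delta> V As Ms A)
  then show ?case
    using gvsem_embv[OF GCase(1)]
    by (auto simp: csem_Case_iff comp_def
        intro!: exI[of _ "map (\<lambda>(M, A'). gcsem \<M> T (A' # \<Delta>) M A) (zip Ms As)"])
qed

text \<open>\<open>hsem_ev\<close> is the computation rule of a handler: evaluating its component at
  an argument and a continuation substitutes both in the clause. It serves the operation case of
  \<open>plug\<close> as well as the handler law for operations.\<close>

lemma
  assumes H: "hsem \<M> \<Gamma> H \<Sigma> (Eff B T) = Some h"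
  shows hsem_hom: "h \<in> hom \<M> \<lbrakk>\<Gamma>\<rbrakk>\<^sub>x (hobj \<M> T \<Sigma> \<lbrakk>B\<rbrakk>)"
    and hsem_dom: "fmdom H = fmdom \<Sigma>"
    and hsem_ev: "\<lbrakk>fmlookup \<Sigma> op = Some (A', B'); fmlookup H op = Some M\<rbrakk> \<Longrightarrow>
      \<exists>g. csem \<M> (Fun (emb B') (Eff B T) # emb A' # \<Gamma>) M (Eff B T) = Some g
        \<and> (\<forall>v k. v \<in> hom \<M> \<lbrakk>\<Gamma>\<rbrakk>\<^sub>x \<lbrakk>emb A'\<rbrakk> \<longrightarrow> k \<in> hom \<M> \<lbrakk>\<Gamma>\<rbrakk>\<^sub>x (kexp (mon \<M> T) \<lbrakk>emb B'\<rbrakk> \<lbrakk>B\<rbrakk>) \<longrightarrow>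
          ev (mon \<M> T) (\<lbrakk>emb A'\<rbrakk> \<otimes> kexp (mon \<M> T) \<lbrakk>emb B'\<rbrakk> \<lbrakk>B\<rbrakk>) \<lbrakk>B\<rbrakk> \<cdot> \<langle>hproj \<M> T \<Sigma> \<lbrakk>B\<rbrakk> op \<cdot> h, \<langle>v, k\<rangle>\<rangle>
            = g \<cdot> \<langle>\<langle>ide \<M> \<lbrakk>\<Gamma>\<rbrakk>\<^sub>x, v\<rangle>, k\<rangle>)"
proof -
  obtain g where dom: "fmdom H = fmdom \<Sigma>"
    and g: "\<And>op A' B' M. fmlookup \<Sigma> op = Some (A', B') \<Longrightarrow> fmlookup H op = Some M
        \<Longrightarrow> csem \<M> (Fun (emb B') (Eff B T) # emb A' # \<Gamma>) M (Eff B T) = Some (g op)"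
    and h: "h = ltup \<M> \<lbrakk>\<Gamma>\<rbrakk>\<^sub>x (map (\<lambda>op. clsem T \<Sigma> \<lbrakk>\<Gamma>\<rbrakk>\<^sub>x \<lbrakk>B\<rbrakk> op (g op)) (ops \<Sigma>))"
    using H unfolding hsem_iff by blast
  have cl: "clsem T \<Sigma> \<lbrakk>\<Gamma>\<rbrakk>\<^sub>x \<lbrakk>B\<rbrakk> op (g op) \<in> hom \<M> \<lbrakk>\<Gamma>\<rbrakk>\<^sub>x (hfac \<M> T \<Sigma> \<lbrakk>B\<rbrakk> op)" if "op |\<in>| fmdom \<Sigma>" for op
  proof -
    have "op |\<in>| fmdom H" using that dom by simp
    with that obtain A' B' M where l: "fmlookup \<Sigma> op = Some (A', B')" "fmlookup H op = Some M"
      by (metis fmdomE surj_pair)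
    show ?thesis using clsem_hom[OF l(1)] sem_hom(2)[OF g[OF l]] by simp
  qed
  show "h \<in> hom \<M> \<lbrakk>\<Gamma>\<rbrakk>\<^sub>x (hobj \<M> T \<Sigma> \<lbrakk>B\<rbrakk>)" unfolding h by (rule hobj_ltup[OF cl])
  show "fmdom H = fmdom \<Sigma>" by fact
  assume l: "fmlookup \<Sigma> op = Some (A', B')" "fmlookup H op = Some M"
  let ?K = "kexp (mon \<M> T) \<lbrakk>emb B'\<rbrakk> \<lbrakk>B\<rbrakk>"
  have gop: "g op \<in> hom \<M> ((\<lbrakk>\<Gamma>\<rbrakk>\<^sub>x \<otimes> \<lbrakk>emb A'\<rbrakk>) \<otimes> ?K) (TOb (mon \<M> T) \<lbrakk>B\<rbrakk>)"
    using sem_hom(2)[OF g[OF l]] by simp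
  have "hproj \<M> T \<Sigma> \<lbrakk>B\<rbrakk> op \<cdot> h
    = cur (mon \<M> T) \<lbrakk>\<Gamma>\<rbrakk>\<^sub>x (\<lbrakk>emb A'\<rbrakk> \<otimes> ?K) \<lbrakk>B\<rbrakk> (g op \<cdot> unassoc \<M> \<lbrakk>\<Gamma>\<rbrakk>\<^sub>x \<lbrakk>emb A'\<rbrakk> ?K)"
    unfolding h using hproj_ltup[OF l(1) cl] l(1) by (simp add: clsem_def Let_def)
  then have "ev (mon \<M> T) (\<lbrakk>emb A'\<rbrakk> \<otimes> ?K) \<lbrakk>B\<rbrakk> \<cdot> \<langle>hproj \<M> T \<Sigma> \<lbrakk>B\<rbrakk> op \<cdot> h, \<langle>v, k\<rangle>\<rangle>
      = g op \<cdot> \<langle>\<langle>ide \<M> \<lbrakk>\<Gamma>\<rbrakk>\<^sub>x, v\<rangle>, k\<rangle>"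
    if vk: "v \<in> hom \<M> \<lbrakk>\<Gamma>\<rbrakk>\<^sub>x \<lbrakk>emb A'\<rbrakk>" "k \<in> hom \<M> \<lbrakk>\<Gamma>\<rbrakk>\<^sub>x ?K" for v k
    using ev_pair_cur[OF cmp_hom[OF unassoc_hom gop] pair_hom[OF vk]] unassoc_pair[OF ide_hom vk]
      cmp_assoc[OF pair_hom[OF ide_hom pair_hom[OF vk]] unassoc_hom gop] by simp
  then show "\<exists>g. csem \<M> (Fun (emb B') (Eff B T) # emb A' # \<Gamma>) M (Eff B T) = Some g
        \<and> (\<forall>v k. v \<in> hom \<M> \<lbrakk>\<Gamma>\<rbrakk>\<^sub>x \<lbrakk>emb A'\<rbrakk> \<longrightarrow> k \<in> hom \<M> \<lbrakk>\<Gamma>\<rbrakk>\<^sub>x ?K \<longrightarrow>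
          ev (mon \<M> T) (\<lbrakk>emb A'\<rbrakk> \<otimes> ?K) \<lbrakk>B\<rbrakk> \<cdot> \<langle>hproj \<M> T \<Sigma> \<lbrakk>B\<rbrakk> op \<cdot> h, \<langle>v, k\<rangle>\<rangle>
            = g \<cdot> \<langle>\<langle>ide \<M> \<lbrakk>\<Gamma>\<rbrakk>\<^sub>x, v\<rangle>, k\<rangle>)"
    using g[OF l] by blast
qed

section \<open>The denotation of plugging a handler into an effect theory term\<close>

lemma hdenU_GRet_cmp:
  assumes V: "gvtyp \<Delta> V A" and "h \<in> hom \<M> W (hobj \<M> T \<Sigma> X)" "d \<in> hom \<M> W \<lbrakk>\<Delta>\<rbrakk>\<^sub>d"
    "k \<in> hom \<M> W (kexp (mon \<M> T) \<lbrakk>emb A\<rbrakk> X)"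
  shows "hdenU \<M> T \<Sigma> X \<Delta> (GRet V) A \<cdot> \<langle>h, \<langle>d, k\<rangle>\<rangle>
    = ev (mon \<M> T) \<lbrakk>emb A\<rbrakk> X \<cdot> \<langle>k, gvsem \<M> \<Delta> V A \<cdot> d\<rangle>"
proof -
  let ?K = "kexp (mon \<M> T) \<lbrakk>emb A\<rbrakk> X" and ?P = "hobj \<M> T \<Sigma> X"
  let ?e = "Arrow (?K \<otimes> \<lbrakk>emb A\<rbrakk>) (ev (mon \<M> T) \<lbrakk>emb A\<rbrakk> X) (TOb (mon \<M> T) X)"
  let ?v = "Arrow \<lbrakk>\<Delta>\<rbrakk>\<^sub>d (gvsem \<M> \<Delta> V A) \<lbrakk>emb A\<rbrakk>"
  let ?h = "Arrow W h ?P" and ?d = "Arrow W d \<lbrakk>\<Delta>\<rbrakk>\<^sub>d" and ?k = "Arrow W k ?K"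
  have "(?e \<odot> apair (asnd \<lbrakk>emb A\<rbrakk> ?K) (afst \<lbrakk>emb A\<rbrakk> ?K)
      \<odot> apair (?v \<odot> afst \<lbrakk>\<Delta>\<rbrakk>\<^sub>d ?K) (aide ?K \<odot> asnd \<lbrakk>\<Delta>\<rbrakk>\<^sub>d ?K) \<odot> asnd ?P (\<lbrakk>\<Delta>\<rbrakk>\<^sub>d \<otimes> ?K)) \<odot> apair ?h (apair ?d ?k)
    = ?e \<odot> apair ?k (?v \<odot> ?d)"
    using assms gvsem_hom[OF V] by (simp add: ev_hom)
  then show ?thesis by (simp add: arrow_defs cross_def swap_def Let_def comp_def)
qed

text \<open>Describes the parameters under a binder: the new variable joins the ground context,
  while the handler and the continuation are merely weakened.\<close>

lemma rearr_lift:
  assumes "h \<in> hom \<M> W P" "d \<in> hom \<M> W D" "k \<in> hom \<M> W K"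
  shows "rearr \<M> P D K B \<cdot> lift W B \<langle>h, \<langle>d, k\<rangle>\<rangle>
    = \<langle>h \<cdot> p1 \<M> W B, \<langle>lift W B d, k \<cdot> p1 \<M> W B\<rangle>\<rangle>"
  using pair_cmp[OF assms(1) pair_hom[OF assms(2,3)] p1_hom] pair_cmp[OF assms(2,3) p1_hom]
    rearr_pair[OF cmp_hom[OF p1_hom assms(1)] cmp_hom[OF p1_hom assms(2)] cmp_hom[OF p1_hom assms(3)] p2_hom]
  by simp

text \<open>The recursion of \<open>plug\<close> weakens the handler and the continuation and lifts
  the renaming of the term. The context, the renaming and the continuation value are therefore
  arbitrary here, and the induction varies them all.\<close>

lemma csem_plug:
  assumes "gctyp \<Sigma> \<Delta> M A" "ren_sem \<Theta> r (map emb \<Delta>) d" "hsem \<M> \<Theta> H \<Sigma> (Eff B T) = Some h"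
    "vsem \<M> \<Theta> K (Fun (emb A) (Eff B T)) = Some k"
  shows "csem \<M> \<Theta> (plug A H K (gcren r M)) (Eff B T) = Some (hdenU \<M> T \<Sigma> \<lbrakk>B\<rbrakk> \<Delta> M A \<cdot> \<langle>h, \<langle>d, k\<rangle>\<rangle>)"
  using assms
proof (induction arbitrary: \<Theta> r d H h K k rule: gctyp.induct)
  case (GRet \<Delta> V A)
  have d: "d \<in> hom \<M> \<lbrakk>\<Theta>\<rbrakk>\<^sub>x \<lbrakk>\<Delta>\<rbrakk>\<^sub>d" using GRet by (simp add: ren_sem_def)
  show ?case
    using hdenU_GRet_cmp[OF GRet(1) hsem_hom[OF GRet(3)] d] sem_hom(1)[OF GRet(4)] GRet(4)
      sem_ren(1)[OF GRet(2) gvsem_embv[OF GRet(1)]]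
    by (simp add: csem_App_iff embv_gvren)
next
  case (GLet op A' B' \<Delta> V M A)
  let ?P = "hobj \<M> T \<Sigma> \<lbrakk>B\<rbrakk>" and ?K = "kexp (mon \<M> T) \<lbrakk>emb A\<rbrakk> \<lbrakk>B\<rbrakk>" and ?K' = "kexp (mon \<M> T) \<lbrakk>emb B'\<rbrakk> \<lbrakk>B\<rbrakk>"
  let ?m = "hdenU \<M> T \<Sigma> \<lbrakk>B\<rbrakk> (B' # \<Delta>) M A" and ?v = "gvsem \<M> \<Delta> V A'" and ?u = "\<langle>h, \<langle>d, k\<rangle>\<rangle>"
  note wk = ren_sem_Suc[of "emb B'" \<Theta>]
  have d: "d \<in> hom \<M> \<lbrakk>\<Theta>\<rbrakk>\<^sub>x \<lbrakk>\<Delta>\<rbrakk>\<^sub>d" using GLet by (simp add: ren_sem_def)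
  have h: "h \<in> hom \<M> \<lbrakk>\<Theta>\<rbrakk>\<^sub>x ?P" by (rule hsem_hom[OF GLet.prems(2)])
  have k: "k \<in> hom \<M> \<lbrakk>\<Theta>\<rbrakk>\<^sub>x ?K" using sem_hom(1)[OF GLet.prems(3)] by simp
  have m: "?m \<in> hom \<M> (?P \<otimes> ((\<lbrakk>\<Delta>\<rbrakk>\<^sub>d \<otimes> \<lbrakk>emb B'\<rbrakk>) \<otimes> ?K)) (TOb (mon \<M> T) \<lbrakk>B\<rbrakk>)"
    using hdenU_hom[OF GLet.hyps(3)] by simp
  have u: "?u \<in> hom \<M> \<lbrakk>\<Theta>\<rbrakk>\<^sub>x (?P \<otimes> (\<lbrakk>\<Delta>\<rbrakk>\<^sub>d \<otimes> ?K))" by (rule pair_hom[OF h pair_hom[OF d k]])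
  have v: "?v \<in> hom \<M> \<lbrakk>\<Delta>\<rbrakk>\<^sub>d \<lbrakk>emb A'\<rbrakk>" by (rule gvsem_hom[OF GLet.hyps(2)])
  \<comment> \<open>The continuation as it occurs in \<open>hdenU\<close>. Composed with
    \<open>?u\<close> it becomes the denotation of the abstraction that \<open>plug\<close>
    substitutes for the continuation variable.\<close>
  define c where "c = cur (mon \<M> T) (?P \<otimes> (\<lbrakk>\<Delta>\<rbrakk>\<^sub>d \<otimes> ?K)) \<lbrakk>emb B'\<rbrakk> \<lbrakk>B\<rbrakk> (?m \<cdot> rearr \<M> ?P \<lbrakk>\<Delta>\<rbrakk>\<^sub>d ?K \<lbrakk>emb B'\<rbrakk>)"
  have c: "c \<in> hom \<M> (?P \<otimes> (\<lbrakk>\<Delta>\<rbrakk>\<^sub>d \<otimes> ?K)) ?K'" unfolding c_def by (rule cur_hom[OF cmp_hom[OF rearr_hom m]])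
  \<comment> \<open>The result of the operation is the newest variable both of the ground context
    and of \<Theta>. Hence \<open>r\<close> is lifted and its denotation becomes \<open>lift\<close>
    of \<open>d\<close>, whereas \<open>h\<close> and \<open>k\<close> are composed with the first
    projection.\<close>
  have "csem \<M> (emb B' # \<Theta>) (plug A (hren Suc H) (vren Suc K) (gcren (rlift r) M)) (Eff B T)
      = Some (?m \<cdot> \<langle>h \<cdot> p1 \<M> \<lbrakk>\<Theta>\<rbrakk>\<^sub>x \<lbrakk>emb B'\<rbrakk>, \<langle>lift \<lbrakk>\<Theta>\<rbrakk>\<^sub>x \<lbrakk>emb B'\<rbrakk> d, k \<cdot> p1 \<M> \<lbrakk>\<Theta>\<rbrakk>\<^sub>x \<lbrakk>emb B'\<rbrakk>\<rangle>\<rangle>)"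
    using GLet.IH[OF _ hsem_hren[OF wk GLet.prems(2)] sem_ren(1)[OF wk GLet.prems(3)]]
      ren_sem_lift[OF GLet.prems(1), of "emb B'"] by simp
  moreover have "c \<cdot> ?u = cur (mon \<M> T) \<lbrakk>\<Theta>\<rbrakk>\<^sub>x \<lbrakk>emb B'\<rbrakk> \<lbrakk>B\<rbrakk>
      (?m \<cdot> \<langle>h \<cdot> p1 \<M> \<lbrakk>\<Theta>\<rbrakk>\<^sub>x \<lbrakk>emb B'\<rbrakk>, \<langle>lift \<lbrakk>\<Theta>\<rbrakk>\<^sub>x \<lbrakk>emb B'\<rbrakk> d, k \<cdot> p1 \<M> \<lbrakk>\<Theta>\<rbrakk>\<^sub>x \<lbrakk>emb B'\<rbrakk>\<rangle>\<rangle>)"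
    unfolding c_def cur_cmp[OF cmp_hom[OF rearr_hom m] u]
      cmp_assoc[OF lift_hom[OF u] rearr_hom m] rearr_lift[OF h d k] ..
  ultimately have kont: "vsem \<M> \<Theta> (Lam (plug A (hren Suc H) (vren Suc K) (gcren (rlift r) M)))
      (Fun (emb B') (Eff B T)) = Some (c \<cdot> ?u)"
    by (simp add: vsem_Lam_iff)
  have arg: "vsem \<M> \<Theta> (embv (gvren r V)) (emb A') = Some (?v \<cdot> d)"
    using sem_ren(1)[OF GLet.prems(1) gvsem_embv[OF GLet.hyps(2)]] by (simp add: embv_gvren)
  have "op |\<in>| fmdom H" using hsem_dom[OF GLet.prems(2)] GLet.hyps(1) by (auto intro: fmdomI)
  then obtain L where L: "fmlookup H op = Some L" by (rule fmdomE)
  obtain g where g: "csem \<M> (Fun (emb B') (Eff B T) # emb A' # \<Theta>) L (Eff B T) = Some g"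
    and ev: "ev (mon \<M> T) (\<lbrakk>emb A'\<rbrakk> \<otimes> ?K') \<lbrakk>B\<rbrakk> \<cdot> \<langle>hproj \<M> T \<Sigma> \<lbrakk>B\<rbrakk> op \<cdot> h, \<langle>?v \<cdot> d, c \<cdot> ?u\<rangle>\<rangle>
      = g \<cdot> \<langle>\<langle>ide \<M> \<lbrakk>\<Theta>\<rbrakk>\<^sub>x, ?v \<cdot> d\<rangle>, c \<cdot> ?u\<rangle>"
    using hsem_ev[OF GLet.prems(2) GLet.hyps(1) L] cmp_hom[OF d v] cmp_hom[OF u c] by blast
  have "csem \<M> \<Theta> (plug A H K (gcren r (GLet op V M))) (Eff B T)
    = Some (g \<cdot> \<langle>\<langle>ide \<M> \<lbrakk>\<Theta>\<rbrakk>\<^sub>x, ?v \<cdot> d\<rangle>, c \<cdot> ?u\<rangle>)"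
    using sem_subst(2)[OF sub_sem_sub2[OF arg kont] g] L by simp
  moreover have "hdenU \<M> T \<Sigma> \<lbrakk>B\<rbrakk> \<Delta> (GLet op V M) A \<cdot> ?u
    = ev (mon \<M> T) (\<lbrakk>emb A'\<rbrakk> \<otimes> ?K') \<lbrakk>B\<rbrakk> \<cdot> \<langle>hproj \<M> T \<Sigma> \<lbrakk>B\<rbrakk> op \<cdot> h, \<langle>?v \<cdot> d, c \<cdot> ?u\<rangle>\<rangle>"
  proof -
    let ?e = "Arrow (kexp (mon \<M> T) (\<lbrakk>emb A'\<rbrakk> \<otimes> ?K') \<lbrakk>B\<rbrakk> \<otimes> (\<lbrakk>emb A'\<rbrakk> \<otimes> ?K'))
      (ev (mon \<M> T) (\<lbrakk>emb A'\<rbrakk> \<otimes> ?K') \<lbrakk>B\<rbrakk>) (TOb (mon \<M> T) \<lbrakk>B\<rbrakk>)"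
    let ?p = "Arrow ?P (hproj \<M> T \<Sigma> \<lbrakk>B\<rbrakk> op) (kexp (mon \<M> T) (\<lbrakk>emb A'\<rbrakk> \<otimes> ?K') \<lbrakk>B\<rbrakk>)"
    let ?av = "Arrow \<lbrakk>\<Delta>\<rbrakk>\<^sub>d ?v \<lbrakk>emb A'\<rbrakk>" and ?c = "Arrow (?P \<otimes> (\<lbrakk>\<Delta>\<rbrakk>\<^sub>d \<otimes> ?K)) c ?K'"
    let ?h = "Arrow \<lbrakk>\<Theta>\<rbrakk>\<^sub>x h ?P" and ?d = "Arrow \<lbrakk>\<Theta>\<rbrakk>\<^sub>x d \<lbrakk>\<Delta>\<rbrakk>\<^sub>d" and ?k = "Arrow \<lbrakk>\<Theta>\<rbrakk>\<^sub>x k ?K"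
    let ?q = "asnd ?P (\<lbrakk>\<Delta>\<rbrakk>\<^sub>d \<otimes> ?K)"
    \<comment> \<open>The defining composite of \<open>hdenU\<close> at the triple is evaluated by
      the normal form of typed arrows, with \<open>c\<close> kept opaque.\<close>
    have "(?e \<odot> apair (?p \<odot> afst ?P (\<lbrakk>\<Delta>\<rbrakk>\<^sub>d \<otimes> ?K)) (apair (?av \<odot> afst \<lbrakk>\<Delta>\<rbrakk>\<^sub>d ?K \<odot> ?q) ?c))
        \<odot> apair ?h (apair ?d ?k)
      = ?e \<odot> apair (?p \<odot> ?h) (apair (?av \<odot> ?d) (?c \<odot> apair ?h (apair ?d ?k)))"
      using h d k v c hproj_hom[OF GLet.hyps(1)] by (simp add: ev_hom)
    then show ?thesis by (simp add: arrow_defs c_def Let_def GLet.hyps(1) comp_def)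
  qed
  ultimately show ?case using ev by simp
next
  case (GCase \<Delta> V As Ms A)
  let ?P = "hobj \<M> T \<Sigma> \<lbrakk>B\<rbrakk>" and ?K = "kexp (mon \<M> T) \<lbrakk>emb A\<rbrakk> \<lbrakk>B\<rbrakk>"
  let ?m = "\<lambda>i. hdenU \<M> T \<Sigma> \<lbrakk>B\<rbrakk> (As ! i # \<Delta>) (Ms ! i) A" and ?v = "gvsem \<M> \<Delta> V (GSum As)"
  let ?D = "?P \<otimes> (\<lbrakk>\<Delta>\<rbrakk>\<^sub>d \<otimes> ?K)" and ?u = "\<langle>h, \<langle>d, k\<rangle>\<rangle>"
  let ?Xs = "map (tysem \<M>) (map emb As)"
  let ?fs = "map (\<lambda>(M, A'). hdenU \<M> T \<Sigma> \<lbrakk>B\<rbrakk> (A' # \<Delta>) M A \<cdot> rearr \<M> ?P \<lbrakk>\<Delta>\<rbrakk>\<^sub>d ?K \<lbrakk>emb A'\<rbrakk>) (zip Ms As)"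
  let ?gs = "map (\<lambda>i. ?m i \<cdot> \<langle>h \<cdot> p1 \<M> \<lbrakk>\<Theta>\<rbrakk>\<^sub>x \<lbrakk>emb (As ! i)\<rbrakk>,
    \<langle>lift \<lbrakk>\<Theta>\<rbrakk>\<^sub>x \<lbrakk>emb (As ! i)\<rbrakk> d, k \<cdot> p1 \<M> \<lbrakk>\<Theta>\<rbrakk>\<^sub>x \<lbrakk>emb (As ! i)\<rbrakk>\<rangle>\<rangle>) [0..<length As]"
  have d: "d \<in> hom \<M> \<lbrakk>\<Theta>\<rbrakk>\<^sub>x \<lbrakk>\<Delta>\<rbrakk>\<^sub>d" using GCase by (simp add: ren_sem_def)
  have h: "h \<in> hom \<M> \<lbrakk>\<Theta>\<rbrakk>\<^sub>x ?P" by (rule hsem_hom[OF GCase.prems(2)])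
  have k: "k \<in> hom \<M> \<lbrakk>\<Theta>\<rbrakk>\<^sub>x ?K" using sem_hom(1)[OF GCase.prems(3)] by simp
  have u: "?u \<in> hom \<M> \<lbrakk>\<Theta>\<rbrakk>\<^sub>x ?D" by (rule pair_hom[OF h pair_hom[OF d k]])
  have v: "?v \<in> hom \<M> \<lbrakk>\<Delta>\<rbrakk>\<^sub>d (kcop (cops \<M>) ?Xs)" using gvsem_hom[OF GCase.hyps(1)] by simp
  have m: "?m i \<in> hom \<M> (?P \<otimes> ((\<lbrakk>\<Delta>\<rbrakk>\<^sub>d \<otimes> \<lbrakk>emb (As ! i)\<rbrakk>) \<otimes> ?K)) (TOb (mon \<M> T) \<lbrakk>B\<rbrakk>)" if "i < length As" for i
    using hdenU_hom[OF GCase.hyps(3)[OF that]] by simp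
  have fs: "?fs ! i = ?m i \<cdot> rearr \<M> ?P \<lbrakk>\<Delta>\<rbrakk>\<^sub>d ?K \<lbrakk>emb (As ! i)\<rbrakk>" if "i < length As" for i
    using that GCase.hyps(2) by simp
  have gs: "?gs ! i = ?fs ! i \<cdot> lift \<lbrakk>\<Theta>\<rbrakk>\<^sub>x \<lbrakk>emb (As ! i)\<rbrakk> ?u" if "i < length As" for i
    unfolding fs[OF that] cmp_assoc[OF lift_hom[OF u] rearr_hom m[OF that]] rearr_lift[OF h d k]
    using that by simp
  have "csem \<M> (emb (As ! i) # \<Theta>) (plug A (hren Suc H) (vren Suc K) (gcren (rlift r) (Ms ! i))) (Eff B T)
      = Some (?gs ! i)" if "i < length As" for i
    using GCase.IH[OF that _ hsem_hren[OF ren_sem_Suc GCase.prems(2)]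
        sem_ren(1)[OF ren_sem_Suc GCase.prems(3)], of "emb (As ! i)"]
      ren_sem_lift[OF GCase.prems(1), of "emb (As ! i)"] that by simp
  moreover have "vsem \<M> \<Theta> (embv (gvren r V)) (Sum (map emb As)) = Some (?v \<cdot> d)"
    using sem_ren(1)[OF GCase.prems(1) gvsem_embv[OF GCase.hyps(1)]] by (simp add: embv_gvren)
  ultimately have "csem \<M> \<Theta> (plug A H K (gcren r (GCase As V Ms))) (Eff B T)
    = Some (copair (cops \<M>) T \<lbrakk>\<Theta>\<rbrakk>\<^sub>x ?Xs \<lbrakk>B\<rbrakk> ?gs \<cdot> \<langle>ide \<M> \<lbrakk>\<Theta>\<rbrakk>\<^sub>x, ?v \<cdot> d\<rangle>)"
    using GCase.hyps(2) by (auto simp: csem_Case_iff intro!: exI[of _ ?gs])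
  \<comment> \<open>Reindexing along \<open>?u\<close> turns the copairing over the parameter object
    \<open>?D\<close> into one over \<Theta>, whose branches are those obtained from the induction
    hypothesis.\<close>
  moreover have "(copair (cops \<M>) T ?D ?Xs \<lbrakk>B\<rbrakk> ?fs \<cdot> \<langle>ide \<M> ?D, ?v \<cdot> p1 \<M> \<lbrakk>\<Delta>\<rbrakk>\<^sub>d ?K \<cdot> p2 \<M> ?P (\<lbrakk>\<Delta>\<rbrakk>\<^sub>d \<otimes> ?K)\<rangle>) \<cdot> ?u
    = copair (cops \<M>) T \<lbrakk>\<Theta>\<rbrakk>\<^sub>x ?Xs \<lbrakk>B\<rbrakk> ?gs
      \<cdot> \<langle>ide \<M> \<lbrakk>\<Theta>\<rbrakk>\<^sub>x, (?v \<cdot> p1 \<M> \<lbrakk>\<Delta>\<rbrakk>\<^sub>d ?K \<cdot> p2 \<M> ?P (\<lbrakk>\<Delta>\<rbrakk>\<^sub>d \<otimes> ?K)) \<cdot> ?u\<rangle>"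
  proof (rule case_cmp[OF _ _ _ u])
    show "?v \<cdot> p1 \<M> \<lbrakk>\<Delta>\<rbrakk>\<^sub>d ?K \<cdot> p2 \<M> ?P (\<lbrakk>\<Delta>\<rbrakk>\<^sub>d \<otimes> ?K) \<in> hom \<M> ?D (kcop (cops \<M>) ?Xs)"
      by (rule cmp_hom[OF cmp_hom[OF p2_hom p1_hom] v])
  qed (use GCase.hyps(2) cmp_hom[OF rearr_hom m] fs gs in auto)
  moreover have "(?v \<cdot> p1 \<M> \<lbrakk>\<Delta>\<rbrakk>\<^sub>d ?K \<cdot> p2 \<M> ?P (\<lbrakk>\<Delta>\<rbrakk>\<^sub>d \<otimes> ?K)) \<cdot> ?u = ?v \<cdot> d"
    using cmp_assoc[OF u cmp_hom[OF p2_hom p1_hom] v] cmp_assoc[OF u p2_hom p1_hom]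
      p2_pair[OF h pair_hom[OF d k]] p1_pair[OF d k] by simp
  ultimately show ?case by (simp add: Let_def comp_def)
qed

end

section \<open>Soundness\<close>

context eff_model
begin

text \<open>By \<open>csem_plug\<close> each hypothesis equates the two \<open>hdenU\<close>
  composed with one arrow \<open>?u\<close> out of \<Theta>. Precomposing with an arrow
  \<open>s\<close> for which \<open>?u \<cdot> s\<close> is \<open>lift\<close> of \<open>h\<close>,
  and then currying, produces the equation required of \<open>h\<close>.\<close>

lemma hpsh_if_plug_eq:
  assumes H: "hsem \<M> \<Gamma> H (sig T) (Eff B T') = Some h"
    and eq: "\<And>\<Delta> M N A. (\<Delta>, M, N, A) \<in> axs T \<Longrightarrow>
      let \<Theta> = Fun (emb A) (Eff B T') # map emb \<Delta> @ \<Gamma>; H' = hren ((+) (Suc (length \<Delta>))) H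
      in csem \<M> \<Theta> (plug A H' (Var 0) (gcren Suc M)) (Eff B T')
        = csem \<M> \<Theta> (plug A H' (Var 0) (gcren Suc N)) (Eff B T')"
  shows "h \<in> hpsh \<M> T T' \<lbrakk>B\<rbrakk> \<lbrakk>\<Gamma>\<rbrakk>\<^sub>x"
proof -
  let ?P = "hobj \<M> T' (sig T) \<lbrakk>B\<rbrakk>"
  note h = hsem_hom[OF H]
  have "hden \<M> T' (sig T) \<lbrakk>B\<rbrakk> \<Delta> M A \<cdot> h = hden \<M> T' (sig T) \<lbrakk>B\<rbrakk> \<Delta> N A \<cdot> h"
    if ax: "(\<Delta>, M, N, A) \<in> axs T" for \<Delta> M N A
  proof -
    let ?K = "kexp (mon \<M> T') \<lbrakk>emb A\<rbrakk> \<lbrakk>B\<rbrakk>" and ?D = "\<lbrakk>\<Delta>\<rbrakk>\<^sub>d"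
    let ?\<Xi> = "map emb \<Delta> @ \<Gamma>"
    let ?\<Theta> = "Fun (emb A) (Eff B T') # ?\<Xi>" and ?n = "length \<Delta>"
    let ?k = "p2 \<M> \<lbrakk>?\<Xi>\<rbrakk>\<^sub>x ?K"
    obtain w where w: "ren_sem ?\<Theta> ((+) (Suc ?n)) \<Gamma> w"
      by (rule ex_ren_sem[of \<Gamma> "(+) (Suc ?n)" ?\<Theta>]) (auto simp: nth_append)
    obtain d where d: "ren_sem ?\<Theta> Suc (map emb \<Delta>) d"
      by (rule ex_ren_sem[of "map emb \<Delta>" Suc ?\<Theta>]) (auto simp: nth_append)
    have w_hom: "w \<in> hom \<M> \<lbrakk>?\<Theta>\<rbrakk>\<^sub>x \<lbrakk>\<Gamma>\<rbrakk>\<^sub>x" and d_hom: "d \<in> hom \<M> \<lbrakk>?\<Theta>\<rbrakk>\<^sub>x ?D"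
      using w d by (simp_all only: ren_sem_def)
    have k_hom: "?k \<in> hom \<M> \<lbrakk>?\<Theta>\<rbrakk>\<^sub>x ?K" by (simp add: p2_hom)
    have k: "vsem \<M> ?\<Theta> (Var 0) (Fun (emb A) (Eff B T')) = Some ?k" by (simp add: vsem_Var_iff)
    let ?u = "\<langle>h \<cdot> w, \<langle>d, ?k\<rangle>\<rangle>"
    note hw = cmp_hom[OF w_hom h]
    have u: "?u \<in> hom \<M> \<lbrakk>?\<Theta>\<rbrakk>\<^sub>x (?P \<otimes> (?D \<otimes> ?K))" by (rule pair_hom[OF hw pair_hom[OF d_hom k_hom]])
    have eq_u: "hdenU \<M> T' (sig T) \<lbrakk>B\<rbrakk> \<Delta> M A \<cdot> ?u = hdenU \<M> T' (sig T) \<lbrakk>B\<rbrakk> \<Delta> N A \<cdot> ?u"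
      using eq[OF ax] csem_plug[OF _ d hsem_hren[OF w H] k] axs_typed[OF ax] by (simp add: Let_def)
    let ?Z = "\<lbrakk>\<Gamma>\<rbrakk>\<^sub>x \<otimes> (?D \<otimes> ?K)"
    let ?q = "p2 \<M> \<lbrakk>\<Gamma>\<rbrakk>\<^sub>x (?D \<otimes> ?K)"
    \<comment> \<open>The components of \<open>s\<close>: index \<open>0\<close> is the
      continuation, the next \<open>?n\<close> indices are the variables of \<Delta> shifted by one,
      and the remaining ones are those of \<Gamma>, shifted by \<open>Suc ?n\<close> as in the
      weakening of the handler.\<close>
    define F where "F = (\<lambda>i. if i = 0 then p2 \<M> ?D ?K \<cdot> ?q
      else if i \<le> ?n then lproj \<M> (map (tysem \<M>) (map emb \<Delta>)) (i - 1) \<cdot> p1 \<M> ?D ?K \<cdot> ?q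
      else lproj \<M> (map (tysem \<M>) \<Gamma>) (i - Suc ?n) \<cdot> p1 \<M> \<lbrakk>\<Gamma>\<rbrakk>\<^sub>x (?D \<otimes> ?K))"
    have F_hom: "F i \<in> hom \<M> ?Z (map (tysem \<M>) ?\<Theta> ! i)" if i: "i < length (map (tysem \<M>) ?\<Theta>)" for i
    proof -
      consider "i = 0" | j where "i = Suc j" "j < ?n" | j where "i = Suc ?n + j" "j < length \<Gamma>"
        using i by (cases i; simp) (metis add_diff_inverse_nat nat_add_left_cancel_less)
      then show ?thesis
      proof cases
        case 1
        then show ?thesis by (simp add: F_def cmp_hom[OF p2_hom p2_hom])
      next
        case 2
        then have "lproj \<M> (map (tysem \<M>) (map emb \<Delta>)) j \<in> hom \<M> ?D \<lbrakk>emb (\<Delta> ! j)\<rbrakk>"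
          using lproj_ctx_hom[of j "map emb \<Delta>"] by simp
        then show ?thesis
          using 2 cmp_hom[OF cmp_hom[OF p2_hom p1_hom]] by (simp add: F_def nth_append)
      next
        case 3
        then show ?thesis using cmp_hom[OF p1_hom lproj_ctx_hom] by (simp add: F_def nth_append)
      qed
    qed
    \<comment> \<open>The canonical arrow \<open>\<lbrakk>\<Gamma>\<rbrakk> \<otimes> (\<lbrakk>\<Delta>\<rbrakk> \<otimes> K) \<rightarrow> \<lbrakk>\<Theta>\<rbrakk>\<close>: it turns \<open>w\<close>, \<open>d\<close> and \<open>k\<close> into projections.\<close>
    obtain s where s: "s \<in> hom \<M> ?Z \<lbrakk>?\<Theta>\<rbrakk>\<^sub>x"
      and s_proj: "\<And>i. i < length (map (tysem \<M>) ?\<Theta>) \<Longrightarrow> lproj \<M> (map (tysem \<M>) ?\<Theta>) i \<cdot> s = F i"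
      using ex_ltup[of "map (tysem \<M>) ?\<Theta>" F ?Z] F_hom by blast
    have ws: "w \<cdot> s = p1 \<M> \<lbrakk>\<Gamma>\<rbrakk>\<^sub>x (?D \<otimes> ?K)"
    proof (rule lprod_ext[OF cmp_hom[OF s w_hom] p1_hom])
      fix j assume "j < length (map (tysem \<M>) \<Gamma>)"
      then have j: "j < length \<Gamma>" by simp
      have "lproj \<M> (map (tysem \<M>) \<Gamma>) j \<cdot> w \<cdot> s = lproj \<M> (map (tysem \<M>) ?\<Theta>) (Suc ?n + j) \<cdot> s"
        using w j cmp_assoc[OF s w_hom lproj_ctx_hom[OF j]] unfolding ren_sem_def by metis
      also have "\<dots> = F (Suc ?n + j)" by (rule s_proj) (use j in simp)
      finally show "lproj \<M> (map (tysem \<M>) \<Gamma>) j \<cdot> w \<cdot> s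
        = lproj \<M> (map (tysem \<M>) \<Gamma>) j \<cdot> p1 \<M> \<lbrakk>\<Gamma>\<rbrakk>\<^sub>x (?D \<otimes> ?K)" by (simp add: F_def)
    qed
    have ds: "d \<cdot> s = p1 \<M> ?D ?K \<cdot> ?q"
    proof (rule lprod_ext[OF cmp_hom[OF s d_hom] cmp_hom[OF p2_hom p1_hom]])
      fix j assume "j < length (map (tysem \<M>) (map emb \<Delta>))"
      then have j: "j < length (map emb \<Delta>)" by simp
      have "lproj \<M> (map (tysem \<M>) (map emb \<Delta>)) j \<cdot> d \<cdot> s = lproj \<M> (map (tysem \<M>) ?\<Theta>) (Suc j) \<cdot> s"
        using d j cmp_assoc[OF s d_hom lproj_ctx_hom[OF j]] unfolding ren_sem_def by metis
      also have "\<dots> = F (Suc j)" by (rule s_proj) (use j in simp)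
      finally show "lproj \<M> (map (tysem \<M>) (map emb \<Delta>)) j \<cdot> d \<cdot> s
        = lproj \<M> (map (tysem \<M>) (map emb \<Delta>)) j \<cdot> p1 \<M> ?D ?K \<cdot> ?q" using j by (simp add: F_def)
    qed
    have ks: "?k \<cdot> s = p2 \<M> ?D ?K \<cdot> ?q" using s_proj[of 0] by (simp add: F_def)
    have us: "?u \<cdot> s = lift \<lbrakk>\<Gamma>\<rbrakk>\<^sub>x (?D \<otimes> ?K) h"
      using pair_cmp[OF hw pair_hom[OF d_hom k_hom] s] pair_cmp[OF d_hom k_hom s] ws ds ks
        cmp_assoc[OF s w_hom h] pair_unique[OF p2_hom[of "\<lbrakk>\<Gamma>\<rbrakk>\<^sub>x" "?D \<otimes> ?K"]] by simp
    \<comment> \<open>Naturality of currying turns \<open>hden\<close> after \<open>h\<close> into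
      the currying of \<open>hdenU\<close> after \<open>lift\<close> of \<open>h\<close>, and
      \<open>us\<close> factors the latter through \<open>?u\<close>, where \<open>eq_u\<close>
      applies.\<close>
    have "hden \<M> T' (sig T) \<lbrakk>B\<rbrakk> \<Delta> L A \<cdot> h
      = cur (mon \<M> T') \<lbrakk>\<Gamma>\<rbrakk>\<^sub>x (?D \<otimes> ?K) \<lbrakk>B\<rbrakk> ((hdenU \<M> T' (sig T) \<lbrakk>B\<rbrakk> \<Delta> L A \<cdot> ?u) \<cdot> s)"
      if "gctyp (sig T) \<Delta> L A" for L
      using cur_cmp[OF hdenU_hom[OF that] h] cmp_assoc[OF s u hdenU_hom[OF that]] us
      by (simp add: hden_def comp_def)
    then show ?thesis using axs_typed[OF ax] eq_u by simp
  qed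
  then show ?thesis using h by (auto simp: hpsh_def)
qed

text \<open>The denotation of handling an operation feeds \<open>hdl\<close> with a
  \<open>tmap\<close>, while \<open>hdl_op\<close> speaks of \<open>aop\<close> applied to an
  argument and a continuation. With the body curried into the continuation, the two agree.\<close>

lemma aop_pair_cur:
  assumes op: "fmlookup (sig T) op = Some (A, B)" and v: "v \<in> hom \<M> G \<lbrakk>emb A\<rbrakk>"
    and n: "n \<in> hom \<M> (G \<otimes> \<lbrakk>emb B\<rbrakk>) (TOb (mon \<M> T') X)"
  shows "aop \<M> T T' X op \<cdot> \<langle>v, cur (mon \<M> T') G \<lbrakk>emb B\<rbrakk> X n\<rangle> = tmap T G \<lbrakk>emb B\<rbrakk> (opm \<M> T op \<cdot> v) n"
proof -
  let ?K = "kexp (mon \<M> T') \<lbrakk>emb B\<rbrakk> X" and ?TB = "TOb (mon \<M> T) \<lbrakk>emb B\<rbrakk>"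
  let ?c = "cur (mon \<M> T') G \<lbrakk>emb B\<rbrakk> X n" and ?e = "ev (mon \<M> T') \<lbrakk>emb B\<rbrakk> X" and ?o = "opm \<M> T op"
  let ?ae = "Arrow (?K \<otimes> \<lbrakk>emb B\<rbrakk>) ?e (TOb (mon \<M> T') X)" and ?ao = "Arrow \<lbrakk>emb A\<rbrakk> ?o ?TB"
  let ?av = "Arrow G v \<lbrakk>emb A\<rbrakk>" and ?ac = "Arrow G ?c ?K"
  note c = cur_hom[OF n] and o = opm_hom[OF op]
  have "(aT T ?ae \<odot> astrn T ?K \<lbrakk>emb B\<rbrakk> \<odot> apair (asnd ?TB ?K) (afst ?TB ?K)
      \<odot> apair (?ao \<odot> afst \<lbrakk>emb A\<rbrakk> ?K) (aide ?K \<odot> asnd \<lbrakk>emb A\<rbrakk> ?K)) \<odot> apair ?av ?ac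
    = aT T ?ae \<odot> astrn T ?K \<lbrakk>emb B\<rbrakk> \<odot> apair ?ac (?ao \<odot> ?av)"
    using v c o ev_hom by simp
  then have "aop \<M> T T' X op \<cdot> \<langle>v, ?c\<rangle>
    = TMor (mon \<M> T) ?e \<cdot> strn (mon \<M> T) ?K \<lbrakk>emb B\<rbrakk> \<cdot> \<langle>?c, ?o \<cdot> v\<rangle>"
    by (simp add: marrow_defs cross_def swap_def Let_def aop_def op)
  also have "\<dots> = tmap T G \<lbrakk>emb B\<rbrakk> (?o \<cdot> v) (?e \<cdot> lift G \<lbrakk>emb B\<rbrakk> ?c)"
    by (rule tmap_pair[OF ev_hom c cmp_hom[OF v o]])
  also have "?e \<cdot> lift G \<lbrakk>emb B\<rbrakk> ?c = n"
    using ev_cur[OF n] ide_left[OF p2_hom] by (simp add: cross_def)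
  finally show ?thesis .
qed

text \<open>The multiplication inside a bind is pulled out by \<open>tmap_bind\<close>, and
  \<open>hdl_mult\<close> trades it for an inner use of the handler, which naturality then
  specialises to the body of the \<open>Let\<close>.\<close>

lemma handle_bind:
  assumes h: "h \<in> hpsh \<M> T T' X G" and l: "l \<in> hom \<M> G (TOb (mon \<M> T) A)"
    and m: "m \<in> hom \<M> (G \<otimes> A) (TOb (mon \<M> T) B)" and n: "n \<in> hom \<M> (G \<otimes> B) (TOb (mon \<M> T') X)"
  shows "hdl \<M> T T' X G h (tmap T G B (mult (mon \<M> T) B \<cdot> tmap T G A l m) n)
    = hdl \<M> T T' X G h (tmap T G A l (hdl \<M> T T' X (G \<otimes> A) (h \<cdot> p1 \<M> G A)
        (tmap T (G \<otimes> A) B m (n \<cdot> lift (G \<otimes> A) B (p1 \<M> G A)))))"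
proof -
  let ?W = "TOb (mon \<M> T) (TOb (mon \<M> T') X)"
  let ?k = "tmap T (G \<otimes> A) B m (n \<cdot> lift (G \<otimes> A) B (p1 \<M> G A))"
  \<comment> \<open>The handler applied to the generic computation, the second projection. Its use
    at a particular computation is precomposition with a pairing.\<close>
  let ?t = "hdl \<M> T T' X (G \<otimes> ?W) (h \<cdot> p1 \<M> G ?W) (p2 \<M> G ?W)"
  note hp = hpsh_cmp[OF h p1_hom[of G ?W]]
  have k: "?k \<in> hom \<M> (G \<otimes> A) ?W" by (rule tmap_hom[OF m cmp_hom[OF lift_hom[OF p1_hom] n]])
  have t: "?t \<in> hom \<M> (G \<otimes> ?W) (TOb (mon \<M> T') X)" by (rule hdl_hom[OF hp p2_hom])
  have pk: "\<langle>p1 \<M> G A, ?k\<rangle> \<in> hom \<M> (G \<otimes> A) (G \<otimes> ?W)" by (rule pair_hom[OF p1_hom k])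
  have "hdl \<M> T T' X G h (tmap T G B (mult (mon \<M> T) B \<cdot> tmap T G A l m) n)
    = hdl \<M> T T' X G h (mult (mon \<M> T) (TOb (mon \<M> T') X) \<cdot> tmap T G A l ?k)"
    by (simp only: tmap_bind[OF l m n])
  also have "\<dots> = hdl \<M> T T' X G h (tmap T G ?W (tmap T G A l ?k) ?t)"
    using hdl_mult[OF h tmap_hom[OF l k] refl] by (simp add: tmap_def)
  also have "tmap T G ?W (tmap T G A l ?k) ?t = tmap T G A l (?t \<cdot> \<langle>p1 \<M> G A, ?k\<rangle>)"
    by (rule tmap_tmap[OF l k t])
  also have "?t \<cdot> \<langle>p1 \<M> G A, ?k\<rangle> = hdl \<M> T T' X (G \<otimes> A) (h \<cdot> p1 \<M> G A) ?k"
    using hdl_nat[OF hp p2_hom pk] cmp_assoc[OF pk p1_hom hpsh_hom[OF h]] p1_pair[OF p1_hom k] p2_pair[OF p1_hom k]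
    by simp
  finally show ?thesis .
qed

text \<open>For \<open>hresp\<close> the claim includes membership in \<open>hpsh\<close>, since
  otherwise a handled computation would have no denotation. For equations it includes definedness of
  both sides, from which the symmetry, transitivity and congruence rules follow directly.\<close>

lemma soundness:
  shows "vtyp \<Gamma> V A \<Longrightarrow> \<exists>f. vsem \<M> \<Gamma> V A = Some f"
    and "ctyp \<Gamma> M C \<Longrightarrow> \<exists>f. csem \<M> \<Gamma> M C = Some f"
    and "htyp \<Gamma> H \<Sigma> C \<Longrightarrow> \<exists>h. hsem \<M> \<Gamma> H \<Sigma> C = Some h"
    and "hresp \<Gamma> H T C \<Longrightarrow> \<exists>B T' h. C = Eff B T' \<and> hsem \<M> \<Gamma> H (sig T) C = Some h
      \<and> h \<in> hpsh \<M> T T' \<lbrakk>B\<rbrakk> \<lbrakk>\<Gamma>\<rbrakk>\<^sub>x"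
    and "veq \<Gamma> V W A \<Longrightarrow> \<exists>f. vsem \<M> \<Gamma> V A = Some f \<and> vsem \<M> \<Gamma> W A = Some f"
    and "ceq \<Gamma> M N C \<Longrightarrow> \<exists>f. csem \<M> \<Gamma> M C = Some f \<and> csem \<M> \<Gamma> N C = Some f"
proof (induction rule: vtyp_ctyp_htyp_hresp_veq_ceq.inducts)
  case (t_var i \<Gamma>)
  then show ?case by (simp add: vsem_Var_iff)
next
  case (t_tup Vs As \<Gamma>)
  then obtain F where "\<And>i. i < length As \<Longrightarrow> vsem \<M> \<Gamma> (Vs ! i) (As ! i) = Some (F i)" by metis
  then show ?case using t_tup(1) by (auto simp: vsem_Tup_iff intro!: exI[of _ "map F [0..<length As]"])
next
  case (t_proj \<Gamma> V As i)
  then show ?case by (auto simp: vsem_Proj_iff)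
next
  case (t_inj i As \<Gamma> V)
  then show ?case by (auto simp: vsem_Inj_iff)
next
  case (t_lam A \<Gamma> M C)
  then show ?case by (cases C) (auto simp: vsem_Lam_iff)
next
  case (t_ret \<Gamma> V A T)
  then show ?case by (auto simp: csem_Ret_iff)
next
  case (t_let \<Gamma> M A T N B)
  then show ?case by (auto simp: csem_Let_iff)
next
  case (t_app \<Gamma> V A C W)
  then show ?case by (cases C) (auto simp: csem_App_iff)
next
  case (t_op T op A B \<Gamma> V)
  then show ?case by (auto simp: csem_Op_iff)
next
  case (t_handle \<Gamma> M A T H C N)
  then show ?case by (auto simp: csem_Handle_iff)
next
  case (t_case \<Gamma> V As Ms C)
  obtain B T where C: "C = Eff B T" by (cases C)
  obtain F where "\<And>i. i < length As \<Longrightarrow> csem \<M> (As ! i # \<Gamma>) (Ms ! i) C = Some (F i)" using t_case.IH(2) by metis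
  then show ?case using t_case.hyps t_case.IH(1)
    by (auto simp: C csem_Case_iff intro!: exI[of _ "map F [0..<length As]"])
next
  case (t_handler H \<Sigma> C \<Gamma>)
  obtain B T where C: "C = Eff B T" by (cases C)
  \<comment> \<open>\<open>hsem_iff\<close> asks for a function of the operation alone, so the
    clause and the types it binds are looked up in \<open>H\<close> and in the signature.\<close>
  define g where "g = (\<lambda>op. let (A, B) = the (fmlookup \<Sigma> op)
    in the (csem \<M> (Fun (emb B) C # emb A # \<Gamma>) (the (fmlookup H op)) C))"
  have "csem \<M> (Fun (emb B') C # emb A' # \<Gamma>) M C = Some (g op)"
    if "fmlookup \<Sigma> op = Some (A', B')" "fmlookup H op = Some M" for op A' B' M
    using t_handler(3)[OF that] that by (auto simp: g_def)
  then show ?case using t_handler(1) unfolding C hsem_iff by blast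
next
  case (t_respects \<Gamma> H T C)
  obtain B T' where C: "C = Eff B T'" by (cases C)
  obtain h where h: "hsem \<M> \<Gamma> H (sig T) C = Some h" using t_respects.IH by blast
  have "h \<in> hpsh \<M> T T' \<lbrakk>B\<rbrakk> \<lbrakk>\<Gamma>\<rbrakk>\<^sub>x"
    using t_respects.IH(2) by (intro hpsh_if_plug_eq[OF h[unfolded C]]) (fastforce simp: Let_def C)
  then show ?case using C h by blast
next
  case (v_sym \<Gamma> V W A)
  then show ?case by blast
next
  case (v_trans \<Gamma> U V A W)
  then show ?case by auto
next
  case (c_sym \<Gamma> M N C)
  then show ?case by blast
next
  case (c_trans \<Gamma> L M C N)
  then show ?case by auto
next
  case (cong_tup Vs As Ws \<Gamma>)
  obtain F where "\<And>i. i < length As \<Longrightarrow> vsem \<M> \<Gamma> (Vs ! i) (As ! i) = Some (F i) \<and> vsem \<M> \<Gamma> (Ws ! i) (As ! i) = Some (F i)"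
    using cong_tup.IH by metis
  then show ?case using cong_tup.hyps
    by (intro exI[of _ "ltup \<M> \<lbrakk>\<Gamma>\<rbrakk>\<^sub>x (map F [0..<length As])"])
      (auto simp: vsem_Tup_iff intro!: exI[of _ "map F [0..<length As]"])
next
  case (cong_proj \<Gamma> V W As i)
  then show ?case by (auto simp: vsem_Proj_iff)
next
  case (cong_inj i As \<Gamma> V W)
  then show ?case by (auto simp: vsem_Inj_iff)
next
  case (cong_lam A \<Gamma> M N C)
  then show ?case by (cases C) (auto simp: vsem_Lam_iff)
next
  case (cong_ret \<Gamma> V W A T)
  then show ?case by (auto simp: csem_Ret_iff)
next
  case (cong_let \<Gamma> M M' A T N N' B)
  then obtain f g where "csem \<M> \<Gamma> M (Eff A T) = Some f" "csem \<M> \<Gamma> M' (Eff A T) = Some f"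
    "csem \<M> (A # \<Gamma>) N (Eff B T) = Some g" "csem \<M> (A # \<Gamma>) N' (Eff B T) = Some g" by blast
  then show ?case by (simp add: csem_Let_iff)
next
  case (cong_app \<Gamma> V V' A C W W')
  then obtain f g where "vsem \<M> \<Gamma> V (Fun A C) = Some f" "vsem \<M> \<Gamma> V' (Fun A C) = Some f"
    "vsem \<M> \<Gamma> W A = Some g" "vsem \<M> \<Gamma> W' A = Some g" by blast
  then show ?case by (cases C) (simp add: csem_App_iff)
next
  case (cong_op T op A B \<Gamma> V W)
  then show ?case by (auto simp: csem_Op_iff)
next
  case (cong_handle \<Gamma> M M' A T H C H' N N')
  obtain B T' h where C: "C = Eff B T'" and h: "hsem \<M> \<Gamma> H (sig T) C = Some h"
    and h': "h \<in> hpsh \<M> T T' \<lbrakk>B\<rbrakk> \<lbrakk>\<Gamma>\<rbrakk>\<^sub>x" using cong_handle.IH(2) by blast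
  obtain g where dom: "fmdom H = fmdom (sig T)"
    and g: "\<And>op A' B' M. fmlookup (sig T) op = Some (A', B') \<Longrightarrow> fmlookup H op = Some M
        \<Longrightarrow> csem \<M> (Fun (emb B') C # emb A' # \<Gamma>) M C = Some (g op)"
    and h_eq: "h = ltup \<M> \<lbrakk>\<Gamma>\<rbrakk>\<^sub>x (map (\<lambda>op. clsem T' (sig T) \<lbrakk>\<Gamma>\<rbrakk>\<^sub>x \<lbrakk>B\<rbrakk> op (g op)) (ops (sig T)))"
    using h unfolding C hsem_iff by blast
  \<comment> \<open>The clauses of \<open>H'\<close> have the same denotations as those of
    \<open>H\<close>. Hence both handlers denote the same \<open>h\<close>, and its membership in
    \<open>hpsh\<close> makes the right-hand side defined too.\<close>
  have "csem \<M> (Fun (emb B') C # emb A' # \<Gamma>) L' C = Some (g op)"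
    if L': "fmlookup (sig T) op = Some (A', B')" "fmlookup H' op = Some L'" for op A' B' L'
  proof -
    have "op |\<in>| fmdom H" using fmdomI[OF L'(1)] dom by simp
    then obtain L where L: "fmlookup H op = Some L" by (rule fmdomE)
    show ?thesis using cong_handle.IH(3)[OF L'(1) L L'(2)] g[OF L'(1) L] by auto
  qed
  then have "hsem \<M> \<Gamma> H' (sig T) C = Some h"
    using dom cong_handle.hyps h_eq unfolding C hsem_iff by auto
  moreover obtain f n where "csem \<M> \<Gamma> M (Eff A T) = Some f" "csem \<M> \<Gamma> M' (Eff A T) = Some f"
    "csem \<M> (A # \<Gamma>) N C = Some n" "csem \<M> (A # \<Gamma>) N' C = Some n"
    using cong_handle.IH(1,4) by blast
  ultimately show ?case using h h' by (simp add: C csem_Handle_iff)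
next
  case (cong_case \<Gamma> V V' As Ms Ms' C)
  obtain B T where C: "C = Eff B T" by (cases C)
  obtain F where F: "\<And>i. i < length As \<Longrightarrow>
      csem \<M> (As ! i # \<Gamma>) (Ms ! i) C = Some (F i) \<and> csem \<M> (As ! i # \<Gamma>) (Ms' ! i) C = Some (F i)"
    using cong_case.IH(2) by metis
  obtain v where v: "vsem \<M> \<Gamma> V (Sum As) = Some v" "vsem \<M> \<Gamma> V' (Sum As) = Some v"
    using cong_case.IH(1) by blast
  have "csem \<M> \<Gamma> (Case As V Ms) C = Some (copair (cops \<M>) T \<lbrakk>\<Gamma>\<rbrakk>\<^sub>x (map (tysem \<M>) As) \<lbrakk>B\<rbrakk>
      (map F [0..<length As]) \<cdot> \<langle>ide \<M> \<lbrakk>\<Gamma>\<rbrakk>\<^sub>x, v\<rangle>)"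
    "csem \<M> \<Gamma> (Case As V' Ms') C = Some (copair (cops \<M>) T \<lbrakk>\<Gamma>\<rbrakk>\<^sub>x (map (tysem \<M>) As) \<lbrakk>B\<rbrakk>
      (map F [0..<length As]) \<cdot> \<langle>ide \<M> \<lbrakk>\<Gamma>\<rbrakk>\<^sub>x, v\<rangle>)"
    unfolding C csem_Case_iff using F v cong_case.hyps C by (auto intro!: exI[of _ "map F [0..<length As]"])
  then show ?case by blast
next
  case (fun_beta A \<Gamma> M C V)
  obtain B T where C: "C = Eff B T" by (cases C)
  obtain f g where f: "csem \<M> (A # \<Gamma>) M (Eff B T) = Some f" and g: "vsem \<M> \<Gamma> V A = Some g"
    using fun_beta.IH C by blast
  have f_hom: "f \<in> hom \<M> (\<lbrakk>\<Gamma>\<rbrakk>\<^sub>x \<otimes> \<lbrakk>A\<rbrakk>) (TOb (mon \<M> T) \<lbrakk>B\<rbrakk>)" using sem_hom(2)[OF f] by simp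
  show ?case
    using ev_pair_cur[OF f_hom sem_hom(1)[OF g]] sem_subst(2)[OF sub_sem_sub1[OF g] f] f g
    by (simp add: C csem_App_iff vsem_Lam_iff)
next
  case (fun_eta \<Gamma> V A C)
  obtain B T where C: "C = Eff B T" by (cases C)
  obtain v where v: "vsem \<M> \<Gamma> V (Fun A C) = Some v" using fun_eta.IH by blast
  have "vsem \<M> (A # \<Gamma>) (vren Suc V) (Fun A C) = Some (v \<cdot> p1 \<M> \<lbrakk>\<Gamma>\<rbrakk>\<^sub>x \<lbrakk>A\<rbrakk>)"
    by (rule sem_ren(1)[OF ren_sem_Suc v])
  then show ?case
    using v cur_eta[of v "\<lbrakk>\<Gamma>\<rbrakk>\<^sub>x" T "\<lbrakk>A\<rbrakk>" "\<lbrakk>B\<rbrakk>"] sem_hom(1)[OF v]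
    by (simp add: C vsem_Lam_iff csem_App_iff vsem_Var_iff)
next
  case (prod_beta Vs As \<Gamma> i)
  obtain F where F: "\<And>i. i < length As \<Longrightarrow> vsem \<M> \<Gamma> (Vs ! i) (As ! i) = Some (F i)"
    using prod_beta.IH by metis
  have "lproj \<M> (map (tysem \<M>) As) i \<cdot> ltup \<M> \<lbrakk>\<Gamma>\<rbrakk>\<^sub>x (map F [0..<length As]) = F i"
    using lproj_ltup[of "map F [0..<length As]" "map (tysem \<M>) As" "\<lbrakk>\<Gamma>\<rbrakk>\<^sub>x" i]
      sem_hom(1)[OF F] prod_beta.hyps by simp
  moreover have "vsem \<M> \<Gamma> (Tup Vs) (Prod As) = Some (ltup \<M> \<lbrakk>\<Gamma>\<rbrakk>\<^sub>x (map F [0..<length As]))"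
    using F prod_beta.hyps by (auto simp: vsem_Tup_iff intro!: exI[of _ "map F [0..<length As]"])
  ultimately show ?case using F prod_beta.hyps by (simp add: vsem_Proj_iff)
next
  case (prod_eta \<Gamma> V As)
  then obtain v where v: "vsem \<M> \<Gamma> V (Prod As) = Some v" by blast
  have v_hom: "v \<in> hom \<M> \<lbrakk>\<Gamma>\<rbrakk>\<^sub>x (lprod \<M> (map (tysem \<M>) As))" using sem_hom(1)[OF v] by simp
  let ?F = "\<lambda>i. lproj \<M> (map (tysem \<M>) As) i \<cdot> v"
  let ?fs = "map ?F [0..<length As]"
  have fs: "?fs ! i \<in> hom \<M> \<lbrakk>\<Gamma>\<rbrakk>\<^sub>x (map (tysem \<M>) As ! i)" if "i < length (map (tysem \<M>) As)" for i
    using cmp_hom[OF v_hom lproj_hom[OF that]] that by simp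
  have "ltup \<M> \<lbrakk>\<Gamma>\<rbrakk>\<^sub>x ?fs = v"
  proof (rule lprod_ext[OF ltup_hom[OF _ fs] v_hom])
    fix i assume i: "i < length (map (tysem \<M>) As)"
    have "lproj \<M> (map (tysem \<M>) As) i \<cdot> ltup \<M> \<lbrakk>\<Gamma>\<rbrakk>\<^sub>x ?fs = ?fs ! i"
      by (rule lproj_ltup[OF _ fs i]) simp_all
    then show "lproj \<M> (map (tysem \<M>) As) i \<cdot> ltup \<M> \<lbrakk>\<Gamma>\<rbrakk>\<^sub>x ?fs = ?F i" using i by simp
  qed simp_all
  moreover have "vsem \<M> \<Gamma> (Tup (map (\<lambda>i. Proj As i V) [0..<length As])) (Prod As) = Some (ltup \<M> \<lbrakk>\<Gamma>\<rbrakk>\<^sub>x ?fs)"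
    using v unfolding vsem_Tup_iff by (intro exI[of _ As] exI[of _ ?fs]) (simp add: vsem_Proj_iff)
  ultimately show ?case using v by simp
next
  case (sum_beta i As \<Gamma> V Ms C)
  obtain B T where C: "C = Eff B T" by (cases C)
  obtain v where v: "vsem \<M> \<Gamma> V (As ! i) = Some v" using sum_beta.IH by blast
  obtain F where F: "\<And>i. i < length As \<Longrightarrow> csem \<M> (As ! i # \<Gamma>) (Ms ! i) (Eff B T) = Some (F i)"
    using sum_beta.IH(2) C by metis
  let ?fs = "map F [0..<length As]" and ?Xs = "map (tysem \<M>) As"
  have fs: "?fs ! i \<in> hom \<M> (\<lbrakk>\<Gamma>\<rbrakk>\<^sub>x \<otimes> (?Xs ! i)) (TOb (mon \<M> T) \<lbrakk>B\<rbrakk>)" if "i < length ?Xs" for i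
    using sem_hom(2)[OF F, of i] that by simp
  have "csem \<M> \<Gamma> (Case As (Inj i V) Ms) (Eff B T)
    = Some (copair (cops \<M>) T \<lbrakk>\<Gamma>\<rbrakk>\<^sub>x ?Xs \<lbrakk>B\<rbrakk> ?fs \<cdot> \<langle>ide \<M> \<lbrakk>\<Gamma>\<rbrakk>\<^sub>x, kinj (cops \<M>) ?Xs i \<cdot> v\<rangle>)"
    unfolding csem_Case_iff using F v sum_beta.hyps
    by (auto simp: vsem_Inj_iff intro!: exI[of _ ?fs])
  moreover have "copair (cops \<M>) T \<lbrakk>\<Gamma>\<rbrakk>\<^sub>x ?Xs \<lbrakk>B\<rbrakk> ?fs \<cdot> \<langle>ide \<M> \<lbrakk>\<Gamma>\<rbrakk>\<^sub>x, kinj (cops \<M>) ?Xs i \<cdot> v\<rangle>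
    = ?fs ! i \<cdot> \<langle>ide \<M> \<lbrakk>\<Gamma>\<rbrakk>\<^sub>x, v\<rangle>"
    by (rule copair_inj'[OF _ fs _ ide_hom]) (use sum_beta.hyps sem_hom(1)[OF v] in simp_all)
  moreover have "csem \<M> \<Gamma> (csubst (sub1 V) (Ms ! i)) (Eff B T) = Some (F i \<cdot> \<langle>ide \<M> \<lbrakk>\<Gamma>\<rbrakk>\<^sub>x, v\<rangle>)"
    by (rule sem_subst(2)[OF sub_sem_sub1[OF v] F[OF sum_beta.hyps(1)]])
  ultimately show ?case using sum_beta.hyps by (simp add: C)
next
  case (sum_eta \<Gamma> V As M C)
  obtain B T where C: "C = Eff B T" by (cases C)
  obtain v m where v: "vsem \<M> \<Gamma> V (Sum As) = Some v" and m: "csem \<M> (Sum As # \<Gamma>) M (Eff B T) = Some m"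
    using sum_eta.IH C by blast
  let ?Xs = "map (tysem \<M>) As" and ?G = "\<lbrakk>\<Gamma>\<rbrakk>\<^sub>x"
  let ?F = "\<lambda>i. m \<cdot> \<langle>p1 \<M> ?G (?Xs ! i), kinj (cops \<M>) ?Xs i \<cdot> p2 \<M> ?G (?Xs ! i)\<rangle>"
  have m_hom: "m \<in> hom \<M> (?G \<otimes> kcop (cops \<M>) ?Xs) (TOb (mon \<M> T) \<lbrakk>B\<rbrakk>)" using sem_hom(2)[OF m] by simp
  have "csem \<M> (As ! i # \<Gamma>) (csubst (case_nat (Inj i (Var 0)) (Var \<circ> Suc)) M) (Eff B T) = Some (?F i)"
    if i: "i < length As" for i
  proof (rule sem_subst(2)[OF _ m])
    have "vsem \<M> (As ! i # \<Gamma>) (Inj i (Var 0)) (Sum As) = Some (kinj (cops \<M>) ?Xs i \<cdot> p2 \<M> ?G (?Xs ! i))"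
      using i by (simp add: vsem_Inj_iff vsem_Var_iff)
    \<comment> \<open>The variable of sum type is replaced by an injection of the new variable and
      all others are weakened. This denotes exactly the arrow along which \<open>copair_eta\<close>
      restricts \<open>m\<close>.\<close>
    from sub_sem_Cons[OF ren_sem_sub_sem[OF ren_sem_Suc] this]
    show "sub_sem (As ! i # \<Gamma>) (case_nat (Inj i (Var 0)) (Var \<circ> Suc)) (Sum As # \<Gamma>)
      \<langle>p1 \<M> ?G (?Xs ! i), kinj (cops \<M>) ?Xs i \<cdot> p2 \<M> ?G (?Xs ! i)\<rangle>" using i by simp
  qed
  then have "csem \<M> \<Gamma> (Case As V (map (\<lambda>i. csubst (case_nat (Inj i (Var 0)) (Var \<circ> Suc)) M) [0..<length As])) (Eff B T)
    = Some (copair (cops \<M>) T ?G ?Xs \<lbrakk>B\<rbrakk> (map ?F [0..<length As]) \<cdot> \<langle>ide \<M> ?G, v\<rangle>)"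
    unfolding csem_Case_iff using v by (intro exI[of _ v] exI[of _ "map ?F [0..<length As]"]) simp
  moreover have "copair (cops \<M>) T ?G ?Xs \<lbrakk>B\<rbrakk> (map ?F [0..<length As]) = m"
    using copair_eta[OF m_hom] by simp
  ultimately show ?case using sem_subst(2)[OF sub_sem_sub1[OF v] m] by (simp add: C)
next
  case (let_ret \<Gamma> V A M B T)
  then obtain v m where v: "vsem \<M> \<Gamma> V A = Some v" and m: "csem \<M> (A # \<Gamma>) M (Eff B T) = Some m" by blast
  have "m \<in> hom \<M> (\<lbrakk>\<Gamma>\<rbrakk>\<^sub>x \<otimes> \<lbrakk>A\<rbrakk>) (TOb (mon \<M> T) \<lbrakk>B\<rbrakk>)" using sem_hom(2)[OF m] by simp
  from bind_unit[OF sem_hom(1)[OF v] this] show ?case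
    using v m sem_subst(2)[OF sub_sem_sub1[OF v] m] by (simp add: csem_Let_iff csem_Ret_iff)
next
  case (let_eta \<Gamma> M A T)
  then obtain m where m: "csem \<M> \<Gamma> M (Eff A T) = Some m" by blast
  show ?case using m bind_eta[OF sem_hom(2)[OF m]] by (simp add: csem_Let_iff csem_Ret_iff vsem_Var_iff)
next
  case (let_assoc \<Gamma> L A T M B N D)
  then obtain l m n where l: "csem \<M> \<Gamma> L (Eff A T) = Some l" and m: "csem \<M> (A # \<Gamma>) M (Eff B T) = Some m"
    and n: "csem \<M> (B # \<Gamma>) N (Eff D T) = Some n" by blast
  have hom: "m \<in> hom \<M> (\<lbrakk>\<Gamma>\<rbrakk>\<^sub>x \<otimes> \<lbrakk>A\<rbrakk>) (TOb (mon \<M> T) \<lbrakk>B\<rbrakk>)" "n \<in> hom \<M> (\<lbrakk>\<Gamma>\<rbrakk>\<^sub>x \<otimes> \<lbrakk>B\<rbrakk>) (TOb (mon \<M> T) \<lbrakk>D\<rbrakk>)"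
    using sem_hom(2)[OF m] sem_hom(2)[OF n] by simp_all
  \<comment> \<open>Weakening \<open>N\<close> below its own binder denotes precomposition with
    \<open>lift\<close> of the first projection, the arrow that appears in
    \<open>bind_bind\<close>.\<close>
  show ?case
    using l m n sem_ren(2)[OF ren_sem_lift[OF ren_sem_Suc[of A]] n] bind_bind[OF sem_hom(2)[OF l] hom]
    by (simp add: csem_Let_iff)
next
  case (handle_ret \<Gamma> V A H T C N)
  then obtain B T' h where C: "C = Eff B T'" and h: "hsem \<M> \<Gamma> H (sig T) (Eff B T') = Some h"
    and h': "h \<in> hpsh \<M> T T' \<lbrakk>B\<rbrakk> \<lbrakk>\<Gamma>\<rbrakk>\<^sub>x" by blast
  obtain v n where v: "vsem \<M> \<Gamma> V A = Some v" and n: "csem \<M> (A # \<Gamma>) N (Eff B T') = Some n"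
    using handle_ret.IH C by blast
  have n_hom: "n \<in> hom \<M> (\<lbrakk>\<Gamma>\<rbrakk>\<^sub>x \<otimes> \<lbrakk>A\<rbrakk>) (TOb (mon \<M> T') \<lbrakk>B\<rbrakk>)" using sem_hom(2)[OF n] by simp
  \<comment> \<open>\<open>tmap_unit\<close> exposes a unit in the argument of \<open>hdl\<close>,
    which \<open>hdl_unit\<close> cancels; what remains is the denotation of the substitution in
    \<open>N\<close>.\<close>
  show ?case
    using h h' v n sem_subst(2)[OF sub_sem_sub1[OF v] n] tmap_unit[OF sem_hom(1)[OF v] n_hom]
      hdl_unit[OF h' cmp_hom[OF pair_hom[OF ide_hom sem_hom(1)[OF v]] n_hom]]
    by (simp add: C csem_Handle_iff csem_Ret_iff)
next
  case (handle_let \<Gamma> L A T M B H C N)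
  then obtain D T' h where C: "C = Eff D T'" and h: "hsem \<M> \<Gamma> H (sig T) (Eff D T') = Some h"
    and h': "h \<in> hpsh \<M> T T' \<lbrakk>D\<rbrakk> \<lbrakk>\<Gamma>\<rbrakk>\<^sub>x" by blast
  obtain l m n where l: "csem \<M> \<Gamma> L (Eff A T) = Some l" and m: "csem \<M> (A # \<Gamma>) M (Eff B T) = Some m"
    and n: "csem \<M> (B # \<Gamma>) N (Eff D T') = Some n" using handle_let.IH C by blast
  have hom: "m \<in> hom \<M> (\<lbrakk>\<Gamma>\<rbrakk>\<^sub>x \<otimes> \<lbrakk>A\<rbrakk>) (TOb (mon \<M> T) \<lbrakk>B\<rbrakk>)" "n \<in> hom \<M> (\<lbrakk>\<Gamma>\<rbrakk>\<^sub>x \<otimes> \<lbrakk>B\<rbrakk>) (TOb (mon \<M> T') \<lbrakk>D\<rbrakk>)"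
    using sem_hom(2)[OF m] sem_hom(2)[OF n] by simp_all
  show ?case
    using l m n h h' sem_ren(2)[OF ren_sem_lift[OF ren_sem_Suc[of A]] n] hsem_hren[OF ren_sem_Suc[of A] h]
      hpsh_cmp[OF h' p1_hom[of _ "\<lbrakk>A\<rbrakk>"]] handle_bind[OF h' sem_hom(2)[OF l] hom]
    by (simp add: C csem_Handle_iff csem_Let_iff)
next
  case (handle_op T op A B \<Gamma> V H C N M)
  then obtain D T' h where C: "C = Eff D T'" and h: "hsem \<M> \<Gamma> H (sig T) (Eff D T') = Some h"
    and h': "h \<in> hpsh \<M> T T' \<lbrakk>D\<rbrakk> \<lbrakk>\<Gamma>\<rbrakk>\<^sub>x" by blast
  obtain v n where v: "vsem \<M> \<Gamma> V (emb A) = Some v" and n: "csem \<M> (emb B # \<Gamma>) N (Eff D T') = Some n"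
    using handle_op.IH C by blast
  let ?c = "cur (mon \<M> T') \<lbrakk>\<Gamma>\<rbrakk>\<^sub>x \<lbrakk>emb B\<rbrakk> \<lbrakk>D\<rbrakk> n"
  have n_hom: "n \<in> hom \<M> (\<lbrakk>\<Gamma>\<rbrakk>\<^sub>x \<otimes> \<lbrakk>emb B\<rbrakk>) (TOb (mon \<M> T') \<lbrakk>D\<rbrakk>)" using sem_hom(2)[OF n] by simp
  have k: "vsem \<M> \<Gamma> (Lam N) (Fun (emb B) (Eff D T')) = Some ?c" using n by (simp add: vsem_Lam_iff)
  note v_hom = sem_hom(1)[OF v] and c_hom = cur_hom[OF n_hom]
  obtain g where g: "csem \<M> (Fun (emb B) (Eff D T') # emb A # \<Gamma>) M (Eff D T') = Some g"
    and ev: "ev (mon \<M> T') (\<lbrakk>emb A\<rbrakk> \<otimes> kexp (mon \<M> T') \<lbrakk>emb B\<rbrakk> \<lbrakk>D\<rbrakk>) \<lbrakk>D\<rbrakk>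
        \<cdot> \<langle>hproj \<M> T' (sig T) \<lbrakk>D\<rbrakk> op \<cdot> h, \<langle>v, ?c\<rangle>\<rangle> = g \<cdot> \<langle>\<langle>ide \<M> \<lbrakk>\<Gamma>\<rbrakk>\<^sub>x, v\<rangle>, ?c\<rangle>"
    using hsem_ev[OF h handle_op.hyps(1)] handle_op.hyps v_hom c_hom by blast
  \<comment> \<open>From the left, the denotation passes through \<open>aop_pair_cur\<close>,
    \<open>hdl_op\<close> and the computation rule \<open>ev\<close> to the clause denotation
    \<open>g\<close> precomposed with the denotation of \<open>sub2\<close>.\<close>
  show ?case
    using h h' v n sem_subst(2)[OF sub_sem_sub2[OF v k] g] ev handle_op.hyps(1)
      hdl_op[OF h' handle_op.hyps(1) pair_hom[OF v_hom c_hom]] aop_pair_cur[OF handle_op.hyps(1) v_hom n_hom]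
    by (simp add: C csem_Handle_iff csem_Op_iff)
next
  case (axiom_inst \<Delta> M N A T \<Gamma> \<sigma>)
  \<comment> \<open>The induction hypothesis makes each component of \<sigma> defined, so \<sigma>
    has a denotation \<open>s\<close>. Both sides of the instance are then the two interpretations
    of the axiom, equal in the model, composed with \<open>s\<close>.\<close>
  obtain s where s: "sub_sem \<Gamma> \<sigma> (map emb \<Delta>) s"
    by (rule ex_sub_sem[of "map emb \<Delta>" \<Gamma> \<sigma>]) (use axiom_inst.IH in auto)
  show ?case
    using sem_subst(2)[OF s gcsem_embc] axs_typed[OF axiom_inst.hyps(1)] opm_satisfy[OF axiom_inst.hyps(1)] by simp
qed blast+

end

theorem theorem6p14:
  fixes \<M> :: "('ob, 'm, 'b, 'o) model"
    and \<Gamma> :: "('b, 'o) ctx" and M N :: "('b, 'o) comp"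
    and A :: "('b, 'o) ty" and T :: "('b, 'o) effthy"
  assumes "ceq \<Gamma> M N (Eff A T)"
    and "eff_model \<M>"
  shows "csem \<M> \<Gamma> M (Eff A T) \<noteq> None \<and> csem \<M> \<Gamma> N (Eff A T) \<noteq> None \<and>
         csem \<M> \<Gamma> M (Eff A T) = csem \<M> \<Gamma> N (Eff A T)"
  using eff_model.soundness(6)[OF assms(2,1)] by auto

end
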